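(* A consistent, conservative, adjoint consistent, and (energy) stable LDG type SAT with no mesh dependent stabilization parameter, i.e. $\mu=0$, is obtained if the penalty coefficients of the SBP-SAT discretization are chosen such that $$T^{(1)}_{\gamma k}=T^{(1)}_{\gamma v}=B_\gamma\Big[\tfrac{\beta_{\gamma k}-\beta_{\gamma v}+1}{\alpha_{\gamma k}}\Upsilon_{\gamma\gamma k}+\tfrac{\beta_{\gamma v}-\beta_{\gamma k}+1}{\alpha_{\gamma v}}\Upsilon_{\gamma\gamma v}\Big]B_\gamma,\quad T^{(D)}_\gamma=\tfrac1{\alpha_{\gamma k}}B_\gamma\Upsilon_{\gamma\gamma k}B_\gamma,\quad T^{(4)}_{\gamma k}=T^{(4)}_{\gamma v}=0,$$ $$T^{(2)}_{\gamma k}=\tfrac{\beta_{\gamma v}-\beta_{\gamma k}-1}2B_\gamma,\quad T^{(2)}_{\gamma v}=\tfrac{\beta_{\gamma k}-\beta_{\gamma v}-1}2B_\gamma,\quad T^{(3)}_{\gamma k}=\tfrac{\beta_{\gamma v}-\beta_{\gamma k}+1}2B_\gamma,\quad T^{(3)}_{\gamma v}=\tfrac{\beta_{\gamma k}-\beta_{\gamma v}+1}2B_\gamma,$$ $$T^{(5)}_{\gamma\epsilon k}=-T^{(6)}_{\gamma\epsilon k}=\tfrac{[1+\beta_{\gamma k}-\beta_{\gamma v}][1+\beta_{\epsilon k}-\beta_{\epsilon g}]}{16}B_\gamma\Upsilon_{\gamma\epsilon k}B_\epsilon,\quad T^{(6)}_{\gamma\delta v}=-T^{(5)}_{\gamma\delta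 v}=\tfrac{[\beta_{\gamma k}-\beta_{\gamma v}-1][1+\beta_{\delta v}-\beta_{\delta q}]}{16}B_\gamma\Upsilon_{\gamma\delta v}B_\delta.$$
   Context: **Problem.** $\Omega\subset\mathbb R^2$ is compact with piecewise smooth boundary $\Gamma^D\cup\Gamma^N$ ($\Gamma^D\ne\emptyset$), $\lambda$ a symmetric positive definite (SPD) $2\times2$ tensor field. $\partial_t\mathcal U-\nabla\cdot(\lambda\nabla\mathcal U)=\mathcal F$ in $\Omega$, $\mathcal U=\mathcal U_D$ on $\Gamma^D$, $(\lambda\nabla\mathcal U)\cdot n=\mathcal U_N$ on $\Gamma^N$. Adjoint of the steady problem for $\mathcal I(\mathcal U)=\int_\Omega\mathcal G\mathcal U-\int_{\Gamma^D}\psi_D(\lambda\nabla\mathcal U)\cdot n+\int_{\Gamma^N}\psi_N\mathcal U$: $-\nabla\cdot(\lambda\nabla\psi)=\mathcal G$, $\psi=\psi_D$ on $\Gamma^D$, $(\lambda\nabla\psi)\cdot n=\psi_N$ on $\Gamma^N$. **Mesh.** Non-overlapping (possibly curved) triangles $\Omega_k$ of diameter $h$, images of the reference triangle under bijective polynomial maps of degree at most $p+1$ with exact metric terms. $\Gamma_k$: facets of $\Omega_k$; $\Gamma_k^I$: the interior ones. For an interior facet $\gamma$ of $\Omega_k$, $\Omega_v$ is the neighbour across $\gamma$; $\epsilon$ runs over the other interior facets of $\Omega_k$ (neighbour $\Omega_g$), $\delta$ over the other interior facets of $\Omega_v$ (neighbour $\Omega_q$). **Operators.** On $\Omega_k$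 ($n_p$ volume nodes, $n_f$ nodes per facet, Legendre–Gauss facet quadrature of degree $2p+1$): $H_k$ diagonal SPD norm (quadrature) matrix; $B_\gamma$ diagonal matrix of positive facet quadrature weights (common to both sides); $N_{x\gamma k},N_{y\gamma k}$ diagonal matrices of outward unit normal components at facet nodes; $R_{\gamma k}\in\mathbb R^{n_f\times n_p}$ extrapolation to facet nodes, exact for degree $\le p$ polynomials on the reference element; $D_{xk},D_{yk}$ degree-$p$ SBP first-derivative matrices (order $p$ accurate at nodes, $D_{xk}\mathbf 1=D_{yk}\mathbf 1=0$) with $H_kD_{xk}+(H_kD_{xk})^T=\sum_{\gamma\subset\Gamma_k}R_{\gamma k}^TB_\gamma N_{x\gamma k}R_{\gamma k}$, similarly $y$. $\Lambda_k$: $2\times2$ block matrix with diagonal blocks holding $\lambda$ at the volume nodes. $N_{\gamma k}=\begin{bmatrix}N_{x\gamma k}\\ N_{y\gamma k}\end{bmatrix}$, $\bar R_{\gamma k}=\mathrm{diag}(R_{\gamma k},R_{\gamma k})$, $\bar H_k=\mathrm{diag}(H_k,H_k)$, $D^{(2)}_k=[D_{xk}\; D_{yk}]\Lambda_k\begin{bmatrix}D_{xk}\\ D_{yk}\end{bmatrix}$, $D_{\gamma k}=N_{\gamma k}^T\bar R_{\gamma k}\Lambda_k\begin{bmatrix}D_{xk}\\ D_{yk}\end{bmatrix}$, $\Upsilon_{abk}=N_{ak}^T\bar R_{ak}\bar H_k^{-1}\Lambda_k\bar R_{bk}^TN_{bk}$. Facet weights $\alpha_{\gamma k}>0$ with $\sum_{\gamma\subset\Gamma_k}\alpha_{\gamma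 k}=1$. **Discretization.** $\frac{du_{h,k}}{dt}=D^{(2)}_ku_{h,k}+f_k-H_k^{-1}s_k^I-H_k^{-1}s_k^B$, with $$s_k^I=\sum_{\gamma\subset\Gamma_k^I}[R_{\gamma k}^T\; D_{\gamma k}^T]\begin{bmatrix}T^{(1)}_{\gamma k}&T^{(3)}_{\gamma k}\\ T^{(2)}_{\gamma k}&T^{(4)}_{\gamma k}\end{bmatrix}\begin{bmatrix}R_{\gamma k}u_k-R_{\gamma v}u_v\\ D_{\gamma k}u_k+D_{\gamma v}u_v\end{bmatrix}+\sum_{\gamma\subset\Gamma_k^I}\Big\{\sum_{\epsilon}R_{\gamma k}^TT^{(5)}_{\gamma\epsilon k}[R_{\epsilon k}u_k-R_{\epsilon g}u_g]+\sum_{\delta}R_{\gamma k}^TT^{(6)}_{\gamma\delta v}[R_{\delta v}u_v-R_{\delta q}u_q]\Big\},$$ $$s_k^B=\sum_{\gamma\subset\Gamma^D\cap\Gamma_k}[R_{\gamma k}^T\; D_{\gamma k}^T]\begin{bmatrix}T_\gamma^{(D)}\\ -B_\gamma\end{bmatrix}(R_{\gamma k}u_k-u_{\gamma k})+\sum_{\gamma\subset\Gamma^N\cap\Gamma_k}R_{\gamma k}^TB_\gamma(D_{\gamma k}u_k-w_{\gamma k}),$$ $f_k$, $u_{\gamma k}$, $w_{\gamma k}$ the nodal values of $\mathcal F$, $\mathcal U$, $n\cdot(\lambda\nabla\mathcal U)$; set $L_{h,k}(u)=-D^{(2)}_ku_k+H_k^{-1}s^I_k+H_k^{-1}s^B_k$.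 **Definitions.** *Energy stable*: for $\mathcal F=\mathcal U_D=\mathcal U_N=0$, $\frac{d}{dt}\sum_ku_{h,k}^TH_ku_{h,k}\le0$. *Consistent*: $\lim_{h\to0}\sum_k\|L_{h,k}(u)-f_k\|_{H_k}=0$ for the exact steady solution in $\mathcal C^{p+1}$. *Conservative*: for $f_k=0$, $\sum_k\mathbf 1^TH_k\frac{du_{h,k}}{dt}$ reduces to boundary-facet terms only. *Adjoint consistent*: $\lim_{h\to0}\sum_k\|L^*_{h,k}(\psi)-g_k\|_{H_k}=0$ for the exact adjoint in $\mathcal C^{p+1}$, where $g_k$ are nodal values of $\mathcal G$ and $L^*_{h,k}(\psi)=-D_k^{(2)}\psi_k+H_k^{-1}(s_k^I)^*+H_k^{-1}(s_k^B)^*$, $(s_k^B)^*$ being $s_k^B$ with $(u_k,u_{\gamma k},w_{\gamma k})$ replaced by $\psi_k$ and the facet values of $\psi$, $n\cdot(\lambda\nabla\psi)$, and $$(s_k^I)^*=\sum_{\gamma\subset\Gamma_k^I}[R_{\gamma k}^T\; D_{\gamma k}^T]\begin{bmatrix}T^{(1)}_{\gamma k}&-T^{(1)}_{\gamma v}&T^{(2)}_{\gamma k}+B_\gamma&-T^{(2)}_{\gamma v}\\ T^{(3)}_{\gamma k}-B_\gamma&T^{(3)}_{\gamma v}&T^{(4)}_{\gamma k}&T^{(4)}_{\gamma v}\end{bmatrix}\begin{bmatrix}R_{\gamma k}\psi_k\\ R_{\gamma v}\psi_v\\ D_{\gamma k}\psi_k\\ D_{\gamma v}\psi_v\end{bmatrix}+\sum_{\gamma\subset\Gamma_k^I}\Big\{\sum_\epsilon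 R_{\gamma k}^T[T^{(5)}_{\gamma\epsilon k}R_{\epsilon k}\psi_k+T^{(6)}_{\gamma\epsilon k}R_{\epsilon g}\psi_g]-\sum_\delta R_{\gamma k}^T[T^{(5)}_{\gamma\delta v}R_{\delta v}\psi_v+T^{(6)}_{\gamma\delta v}R_{\delta q}\psi_q]\Big\}.$$ **LDG and switches.** On each interior facet $\gamma$ shared by $\Omega_k,\Omega_v$, the switches $\beta_{\gamma k},\beta_{\gamma v}\in\{0,1\}$ are constants with $\beta_{\gamma k}+\beta_{\gamma v}=1$ (chosen as $\beta_{\gamma k}=1$ if $n_k\cdot\mathbf g\ge0$, else $0$, for a fixed global vector $\mathbf g$ and the normal $n_k$ of the straight-sided facet); they are $0$ on boundary facets. The local discontinuous Galerkin method uses interior numerical fluxes $\widehat{\mathcal U}=\{\mathcal U_h\}-\boldsymbol\beta\cdot[\![\mathcal U_h]\!]$, $\widehat{\mathcal W}=\{\mathcal W_h\}+\boldsymbol\beta[\![\mathcal W_h]\!]-\mu h^{-1}[\![\mathcal U_h]\!]$ with $\boldsymbol\beta=\frac12(\beta_{\gamma k}n_k+\beta_{\gamma v}n_v)$ ($\{\cdot\}$ average, $[\![\cdot]\!]$ jump); $\mu$ is its mesh-dependent stabilization parameter. "LDG type" means that, up to scalings of $T^{(1)},T^{(5)},T^{(6)},T^{(D)}$, the coefficients are those obtained by discretizing this method.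
   Formalization: Consistency and adjoint consistency as limits of the sum over elements are claimed only for p≥3 (false for p=1,2, where each element's norm is shown O(h^p)); these parts assume quasi-uniform refinement with scaled operators and facet weights bounded below; the tensor λ is assumed C^p. *)

theory Defs
  imports "HOL-Analysis.Analysis"
begin

section \<open>Smooth fields in the plane and the diffusion problem\<close>

definition pd :: "2 \<Rightarrow> (real^2 \<Rightarrow> real) \<Rightarrow> real^2 \<Rightarrow> real" where
  "pd i f x = frechet_derivative f (at x) (axis i 1)"

primrec Ck :: "nat \<Rightarrow> (real^2 \<Rightarrow> real) \<Rightarrow> bool" where
  "Ck 0 f \<longleftrightarrow> continuous_on UNIV f"
| "Ck (Suc m) f \<longleftrightarrow> (\<forall>x. f differentiable (at x)) \<and> (\<forall>i. Ck m (pd i f))"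

definition grad :: "(real^2 \<Rightarrow> real) \<Rightarrow> real^2 \<Rightarrow> real^2" where
  "grad f x = (\<chi> i. pd i f x)"

text \<open>
  A function of class \<open>C\<^sup>k\<close> on a compact set is represented by a \<open>C\<^sup>k\<close> extension to the plane; only
  its values on the set are ever used.
\<close>

record diffusion =
  dom :: "(real^2) set"
  gamD :: "(real^2) set"
  gamN :: "(real^2) set"
  lam :: "real^2 \<Rightarrow> real^2^2"

definition piecewise_smooth_curve :: "(real^2) set \<Rightarrow> bool" where
  "piecewise_smooth_curve S \<longleftrightarrow> (\<exists>G. finite G \<and> S = (\<Union>g\<in>G. path_image g) \<and>
     (\<forall>g\<in>G. g C1_differentiable_on {0..1} \<and> (\<forall>t\<in>{0..1}. vector_derivative g (at t) \<noteq> 0)))"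

definition diffusion_problem :: "nat \<Rightarrow> diffusion \<Rightarrow> bool" where
  "diffusion_problem p pb \<longleftrightarrow>
     compact (dom pb) \<and> frontier (dom pb) = gamD pb \<union> gamN pb \<and> gamD pb \<noteq> {} \<and>
     piecewise_smooth_curve (gamD pb) \<and> piecewise_smooth_curve (gamN pb) \<and>
     (\<forall>i j. Ck p (\<lambda>x. lam pb x $ i $ j)) \<and>
     (\<forall>x\<in>dom pb. transpose (lam pb x) = lam pb x \<and> (\<forall>v. v \<noteq> 0 \<longrightarrow> v \<bullet> (lam pb x *v v) > 0))"

text \<open>
  There is no such \<open>n\<close> at a corner, so boundary conditions involving the normal are not imposed
  there.
\<close>

definition outward_unit_normal :: "(real^2) set \<Rightarrow> real^2 \<Rightarrow> real^2 \<Rightarrow> bool" where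
  "outward_unit_normal S x n \<longleftrightarrow> norm n = 1 \<and>
     (\<forall>v. v \<bullet> n < 0 \<longrightarrow> eventually (\<lambda>t. x + t *\<^sub>R v \<in> S) (at_right 0)) \<and>
     (\<forall>v. v \<bullet> n > 0 \<longrightarrow> eventually (\<lambda>t. x + t *\<^sub>R v \<notin> S) (at_right 0))"

definition flux :: "diffusion \<Rightarrow> (real^2 \<Rightarrow> real) \<Rightarrow> real^2 \<Rightarrow> real^2" where
  "flux pb U x = lam pb x *v grad U x"

text \<open>
  As the tensor is symmetric, the adjoint problem is the same boundary value problem with data
  \<open>(\<G>, \<psi>\<^sub>D, \<psi>\<^sub>N)\<close>.
\<close>

definition steady_solution ::
  "diffusion \<Rightarrow> (real^2 \<Rightarrow> real) \<Rightarrow> (real^2 \<Rightarrow> real) \<Rightarrow> (real^2 \<Rightarrow> real) \<Rightarrow> (real^2 \<Rightarrow> real) \<Rightarrow> bool" where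
  "steady_solution pb F uD uN U \<longleftrightarrow>
     (\<forall>x\<in>dom pb. - (\<Sum>i\<in>UNIV. pd i (\<lambda>y. flux pb U y $ i) x) = F x) \<and>
     (\<forall>x\<in>gamD pb. U x = uD x) \<and>
     (\<forall>x\<in>gamN pb. \<forall>n. outward_unit_normal (dom pb) x n \<longrightarrow> flux pb U x \<bullet> n = uN x)"

section \<open>Curved triangulations\<close>

definition rvert :: "nat \<Rightarrow> real^2" where
  "rvert e = (if e = 0 then 0 else if e = 1 then axis 1 1 else axis 2 1)"

definition ref_triangle :: "(real^2) set" where
  "ref_triangle = convex hull (rvert ` {..<3})"

text \<open>The boundary of the reference triangle is traversed counterclockwise.\<close>

definition redge :: "nat \<Rightarrow> real \<Rightarrow> real^2" where
  "redge e = linepath (rvert e) (rvert (Suc e mod 3))"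

definition poly_map :: "nat \<Rightarrow> (nat \<Rightarrow> nat \<Rightarrow> real^2) \<Rightarrow> (real^2 \<Rightarrow> real^2) \<Rightarrow> bool" where
  "poly_map q c F \<longleftrightarrow> (\<forall>x. F x = (\<Sum>i\<le>q. \<Sum>j\<le>q - i. ((x $ 1)^i * (x $ 2)^j) *\<^sub>R c i j))"

definition cw :: "real^2 \<Rightarrow> real^2" where
  "cw t = (\<chi> i. if i = 1 then t $ 2 else - t $ 1)"

text \<open>
  Facets are point sets, so that the two elements adjacent to an interior facet refer to the same
  object. The elements are numbered by \<open>{..<nel d}\<close>; \<open>'n\<close> and \<open>'f\<close> index the volume nodes and the
  nodes on one facet. Diagonal matrices are stored as vectors, except for the facet normals, which
  are stored as one vector of the plane per facet node.
\<close>

type_synonym facet = "(real^2) set"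

record ('n::finite, 'f::finite) disc =
  nel :: nat
  emap :: "nat \<Rightarrow> real^2 \<Rightarrow> real^2"
  rnode :: "'n \<Rightarrow> real^2"
  qnode :: "'f \<Rightarrow> real"
  qwt :: "'f \<Rightarrow> real"
  fnode :: "facet \<Rightarrow> 'f \<Rightarrow> real^2"
  fwt :: "facet \<Rightarrow> real^'f"
  nrm :: "facet \<Rightarrow> nat \<Rightarrow> 'f \<Rightarrow> real^2"
  Rm :: "facet \<Rightarrow> nat \<Rightarrow> real^'n^'f"
  Hd :: "nat \<Rightarrow> real^'n"
  Dm :: "nat \<Rightarrow> 2 \<Rightarrow> real^'n^'n"
  alpha :: "facet \<Rightarrow> nat \<Rightarrow> real"
  beta :: "facet \<Rightarrow> nat \<Rightarrow> real"

definition elem :: "('n::finite,'f::finite) disc \<Rightarrow> nat \<Rightarrow> (real^2) set" where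
  "elem d k = emap d k ` ref_triangle"

definition mesh_size :: "('n::finite,'f::finite) disc \<Rightarrow> real" where
  "mesh_size d = Max ((\<lambda>k. diameter (elem d k)) ` {..<nel d})"

definition lfacet :: "('n::finite,'f::finite) disc \<Rightarrow> nat \<Rightarrow> nat \<Rightarrow> facet" where
  "lfacet d k e = path_image (emap d k \<circ> redge e)"

definition facets :: "('n::finite,'f::finite) disc \<Rightarrow> nat \<Rightarrow> facet set" where
  "facets d k = lfacet d k ` {..<3}"

definition adj :: "('n::finite,'f::finite) disc \<Rightarrow> facet \<Rightarrow> nat set" where
  "adj d \<gamma> = {k. k < nel d \<and> \<gamma> \<in> facets d k}"

definition ifacets :: "('n::finite,'f::finite) disc \<Rightarrow> nat \<Rightarrow> facet set" where
  "ifacets d k = {\<gamma> \<in> facets d k. \<exists>v. v \<noteq> k \<and> v \<in> adj d \<gamma>}"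

definition nb :: "('n::finite,'f::finite) disc \<Rightarrow> nat \<Rightarrow> facet \<Rightarrow> nat" where
  "nb d k \<gamma> = (THE v. v \<noteq> k \<and> v \<in> adj d \<gamma>)"

definition dfacets :: "diffusion \<Rightarrow> ('n::finite,'f::finite) disc \<Rightarrow> nat \<Rightarrow> facet set" where
  "dfacets pb d k = {\<gamma> \<in> facets d k. \<gamma> \<subseteq> gamD pb}"

definition nfacets :: "diffusion \<Rightarrow> ('n::finite,'f::finite) disc \<Rightarrow> nat \<Rightarrow> facet set" where
  "nfacets pb d k = {\<gamma> \<in> facets d k. \<gamma> \<subseteq> gamN pb}"

definition ftangent :: "('n::finite,'f::finite) disc \<Rightarrow> nat \<Rightarrow> nat \<Rightarrow> real \<Rightarrow> real^2" where
  "ftangent d k e s = vector_derivative (emap d k \<circ> redge e) (at s)"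

definition mesh :: "nat \<Rightarrow> diffusion \<Rightarrow> ('n::finite,'f::finite) disc \<Rightarrow> bool" where
  "mesh p pb d \<longleftrightarrow>
     (\<forall>k<nel d. (\<exists>c. poly_map (p + 1) c (emap d k)) \<and> inj_on (emap d k) ref_triangle \<and>
        (\<forall>x\<in>ref_triangle. det (matrix (frechet_derivative (emap d k) (at x))) > 0)) \<and>
     (\<Union>k<nel d. elem d k) = dom pb \<and>
     (\<forall>j<nel d. \<forall>k<nel d. j \<noteq> k \<longrightarrow> interior (elem d j) \<inter> interior (elem d k) = {}) \<and>
     (\<forall>k<nel d. \<forall>\<gamma>\<in>facets d k.
        card (adj d \<gamma>) = 2 \<and> \<not> \<gamma> \<subseteq> gamD pb \<and> \<not> \<gamma> \<subseteq> gamN pb \<or>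
        card (adj d \<gamma>) = 1 \<and> (\<gamma> \<subseteq> gamD pb) \<noteq> (\<gamma> \<subseteq> gamN pb)) \<and>
     (\<forall>j<nel d. \<forall>k<nel d. \<forall>e<3. \<forall>e'<3. j \<noteq> k \<and> lfacet d j e = lfacet d k e' \<longrightarrow>
        (\<forall>s\<in>{0..1}. emap d j (redge e s) = emap d k (redge e' (1 - s))))"

text \<open>
  The \<open>p + 1\<close> point rule on \<open>[0, 1]\<close> of degree \<open>2p + 1\<close> is unique: it is the Legendre-Gauss rule.
  The permutation below reconciles the common node numbering of a facet with its parametrization
  from either side. Since element maps preserve orientation, turning the tangent clockwise gives
  the outward normal.
\<close>

definition gauss_rule :: "nat \<Rightarrow> ('n::finite,'f::finite) disc \<Rightarrow> bool" where
  "gauss_rule p d \<longleftrightarrow> CARD('f) = p + 1 \<and> inj (qnode d) \<and>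
     (\<forall>a. 0 < qnode d a \<and> qnode d a < 1 \<and> qwt d a > 0) \<and>
     (\<forall>m\<le>2 * p + 1. (\<Sum>a\<in>UNIV. qwt d a * qnode d a ^ m) = 1 / (real m + 1))"

definition facet_quadrature :: "('n::finite,'f::finite) disc \<Rightarrow> nat \<Rightarrow> nat \<Rightarrow> bool" where
  "facet_quadrature d k e \<longleftrightarrow> (\<exists>\<pi>. bij \<pi> \<and> (\<forall>a. let \<gamma> = lfacet d k e; s = qnode d (\<pi> a) in
     fnode d \<gamma> a = emap d k (redge e s) \<and>
     fwt d \<gamma> $ a = qwt d (\<pi> a) * norm (ftangent d k e s) \<and>
     nrm d \<gamma> k a = sgn (cw (ftangent d k e s))))"

section \<open>Summation-by-parts operators\<close>

definition diagm :: "real^'m \<Rightarrow> real^'m^'m" where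
  "diagm x = (\<chi> i j. if i = j then x $ i else 0)"

definition vnode :: "('n::finite,'f::finite) disc \<Rightarrow> nat \<Rightarrow> 'n \<Rightarrow> real^2" where
  "vnode d k a = emap d k (rnode d a)"

definition nodal :: "('n::finite,'f::finite) disc \<Rightarrow> (real^2 \<Rightarrow> real) \<Rightarrow> nat \<Rightarrow> real^'n" where
  "nodal d w k = (\<chi> a. w (vnode d k a))"

definition fnodal :: "('n::finite,'f::finite) disc \<Rightarrow> (real^2 \<Rightarrow> real) \<Rightarrow> facet \<Rightarrow> real^'f" where
  "fnodal d w \<gamma> = (\<chi> a. w (fnode d \<gamma> a))"

definition Hm :: "('n::finite,'f::finite) disc \<Rightarrow> nat \<Rightarrow> real^'n^'n" where
  "Hm d k = diagm (Hd d k)"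

definition Hinv :: "('n::finite,'f::finite) disc \<Rightarrow> nat \<Rightarrow> real^'n^'n" where
  "Hinv d k = matrix_inv (Hm d k)"

definition Bm :: "('n::finite,'f::finite) disc \<Rightarrow> facet \<Rightarrow> real^'f^'f" where
  "Bm d \<gamma> = diagm (fwt d \<gamma>)"

definition Nm :: "('n::finite,'f::finite) disc \<Rightarrow> facet \<Rightarrow> nat \<Rightarrow> 2 \<Rightarrow> real^'f^'f" where
  "Nm d \<gamma> k i = diagm (\<chi> a. nrm d \<gamma> k a $ i)"

definition Lam :: "diffusion \<Rightarrow> ('n::finite,'f::finite) disc \<Rightarrow> nat \<Rightarrow> 2 \<Rightarrow> 2 \<Rightarrow> real^'n^'n" where
  "Lam pb d k i j = diagm (\<chi> a. lam pb (vnode d k a) $ i $ j)"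

text \<open>The products of \<open>2 \<times> 2\<close> block matrices are written as sums over the block indices.\<close>

definition D2 :: "diffusion \<Rightarrow> ('n::finite,'f::finite) disc \<Rightarrow> nat \<Rightarrow> real^'n^'n" where
  "D2 pb d k = (\<Sum>i\<in>UNIV. \<Sum>j\<in>UNIV. Dm d k i ** Lam pb d k i j ** Dm d k j)"

definition Dg :: "diffusion \<Rightarrow> ('n::finite,'f::finite) disc \<Rightarrow> facet \<Rightarrow> nat \<Rightarrow> real^'n^'f" where
  "Dg pb d \<gamma> k = (\<Sum>i\<in>UNIV. \<Sum>j\<in>UNIV. Nm d \<gamma> k i ** Rm d \<gamma> k ** Lam pb d k i j ** Dm d k j)"

definition Ups :: "diffusion \<Rightarrow> ('n::finite,'f::finite) disc \<Rightarrow> facet \<Rightarrow> facet \<Rightarrow> nat \<Rightarrow> real^'f^'f" where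
  "Ups pb d a b k = (\<Sum>i\<in>UNIV. \<Sum>j\<in>UNIV.
     Nm d a k i ** Rm d a k ** Hinv d k ** Lam pb d k i j ** transpose (Rm d b k) ** Nm d b k j)"

definition sbp_operators :: "nat \<Rightarrow> ('n::finite,'f::finite) disc \<Rightarrow> nat \<Rightarrow> bool" where
  "sbp_operators p d k \<longleftrightarrow>
     (\<forall>a. Hd d k $ a > 0) \<and>
     (\<forall>i. Dm d k i *v 1 = 0) \<and>
     (\<forall>i. Hm d k ** Dm d k i + transpose (Hm d k ** Dm d k i) =
        (\<Sum>\<gamma>\<in>facets d k. transpose (Rm d \<gamma> k) ** Bm d \<gamma> ** Nm d \<gamma> k i ** Rm d \<gamma> k)) \<and>
     (\<forall>\<gamma>\<in>facets d k. \<forall>a i j. i + j \<le> p \<longrightarrow>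
        (let z = inv_into ref_triangle (emap d k) (fnode d \<gamma> a) in
         (\<Sum>b\<in>UNIV. Rm d \<gamma> k $ a $ b * ((rnode d b $ 1)^i * (rnode d b $ 2)^j)) = (z $ 1)^i * (z $ 2)^j))"

text \<open>
  The normal of the straight-sided facet is that of the chord joining its end points. If the chord
  is parallel to \<open>g\<close>, the rule assigns 1 on both sides; requiring the two switches to add up to 1
  excludes that case.
\<close>

definition switches :: "real^2 \<Rightarrow> ('n::finite,'f::finite) disc \<Rightarrow> bool" where
  "switches g d \<longleftrightarrow> (\<forall>k<nel d. \<forall>e<3. let \<gamma> = lfacet d k e in
     if \<gamma> \<in> ifacets d k then
       beta d \<gamma> k + beta d \<gamma> (nb d k \<gamma>) = 1 \<and>
       beta d \<gamma> k =
         (if sgn (cw (emap d k (redge e 1) - emap d k (redge e 0))) \<bullet> g \<ge> 0 then 1 else 0)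
     else beta d \<gamma> k = 0)"

definition sbp_discretization ::
  "nat \<Rightarrow> diffusion \<Rightarrow> ('n::finite,'f::finite) disc \<Rightarrow> bool" where
  "sbp_discretization p pb d \<longleftrightarrow>
     mesh p pb d \<and> gauss_rule p d \<and> (\<forall>k<nel d. \<forall>e<3. facet_quadrature d k e) \<and>
     inj (rnode d) \<and> range (rnode d) \<subseteq> ref_triangle \<and>
     (\<forall>k<nel d. sbp_operators p d k) \<and>
     (\<forall>k<nel d. \<forall>\<gamma>\<in>facets d k - ifacets d k. \<forall>a.
        outward_unit_normal (dom pb) (fnode d \<gamma> a) (nrm d \<gamma> k a)) \<and>
     (\<forall>k<nel d. (\<forall>\<gamma>\<in>facets d k. alpha d \<gamma> k > 0) \<and> (\<Sum>\<gamma>\<in>facets d k. alpha d \<gamma> k) = 1)"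

text \<open>
  Order \<open>p\<close> accuracy concerns a sequence of refined meshes, with a constant independent of the
  mesh. The remaining bounds say that the sequence is quasi-uniform: element maps whose derivatives
  of order \<open>m\<close> are \<open>O(h\<^sup>m)\<close>, and matrices with the scaling in \<open>h\<close> inherited from the reference
  element.
\<close>

definition order_accurate :: "nat \<Rightarrow> diffusion \<Rightarrow> real \<Rightarrow> ('n::finite,'f::finite) disc \<Rightarrow> bool" where
  "order_accurate p pb C d \<longleftrightarrow> (\<forall>w M. Ck (p + 1) w \<and>
     (\<forall>is. length is \<le> p + 1 \<longrightarrow> (\<forall>x\<in>dom pb. \<bar>foldr pd is w x\<bar> \<le> M)) \<longrightarrow>
     (\<forall>k<nel d. \<forall>i a. \<bar>(Dm d k i *v nodal d w k) $ a - pd i w (vnode d k a)\<bar> \<le> C * mesh_size d ^ p * M))"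

definition scaling :: "nat \<Rightarrow> real \<Rightarrow> ('n::finite,'f::finite) disc \<Rightarrow> bool" where
  "scaling p C d \<longleftrightarrow> (let h = mesh_size d in \<forall>k<nel d.
     (\<exists>c. poly_map (p + 1) c (emap d k) \<and>
        (\<forall>i j. 1 \<le> i + j \<and> i + j \<le> p + 1 \<longrightarrow> norm (c i j) \<le> C * h ^ (i + j))) \<and>
     h\<^sup>2 \<le> C * measure lebesgue (interior (elem d k)) \<and>
     (\<forall>a. h\<^sup>2 \<le> C * Hd d k $ a \<and> Hd d k $ a \<le> C * h\<^sup>2) \<and>
     (\<forall>i a b. \<bar>Dm d k i $ a $ b\<bar> \<le> C / h) \<and>
     (\<forall>\<gamma>\<in>facets d k. 1 \<le> C * alpha d \<gamma> k \<and> (\<forall>a b. \<bar>Rm d \<gamma> k $ a $ b\<bar> \<le> C)))"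

definition refinement :: "nat \<Rightarrow> diffusion \<Rightarrow> (nat \<Rightarrow> ('n::finite,'f::finite) disc) \<Rightarrow> bool" where
  "refinement p pb \<D> \<longleftrightarrow> (\<lambda>n. mesh_size (\<D> n)) \<longlonglongrightarrow> 0 \<and>
     (\<exists>C. \<forall>n. order_accurate p pb C (\<D> n) \<and> scaling p C (\<D> n))"

section \<open>The SBP-SAT discretization\<close>

record 'f::finite penalty =
  T1 :: "facet \<Rightarrow> nat \<Rightarrow> real^'f^'f"
  T2 :: "facet \<Rightarrow> nat \<Rightarrow> real^'f^'f"
  T3 :: "facet \<Rightarrow> nat \<Rightarrow> real^'f^'f"
  T4 :: "facet \<Rightarrow> nat \<Rightarrow> real^'f^'f"
  T5 :: "facet \<Rightarrow> facet \<Rightarrow> nat \<Rightarrow> real^'f^'f"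
  T6 :: "facet \<Rightarrow> facet \<Rightarrow> nat \<Rightarrow> real^'f^'f"
  TD :: "facet \<Rightarrow> real^'f^'f"

definition jmp :: "('n::finite,'f::finite) disc \<Rightarrow> (nat \<Rightarrow> real^'n) \<Rightarrow> facet \<Rightarrow> nat \<Rightarrow> real^'f" where
  "jmp d u \<gamma> k = Rm d \<gamma> k *v u k - Rm d \<gamma> (nb d k \<gamma>) *v u (nb d k \<gamma>)"

definition djmp ::
  "diffusion \<Rightarrow> ('n::finite,'f::finite) disc \<Rightarrow> (nat \<Rightarrow> real^'n) \<Rightarrow> facet \<Rightarrow> nat \<Rightarrow> real^'f" where
  "djmp pb d u \<gamma> k = Dg pb d \<gamma> k *v u k + Dg pb d \<gamma> (nb d k \<gamma>) *v u (nb d k \<gamma>)"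

definition sI :: "diffusion \<Rightarrow> ('n::finite,'f::finite) disc \<Rightarrow> 'f penalty \<Rightarrow> (nat \<Rightarrow> real^'n) \<Rightarrow> nat \<Rightarrow> real^'n" where
  "sI pb d T u k =
     (\<Sum>\<gamma>\<in>ifacets d k.
        transpose (Rm d \<gamma> k) *v (T1 T \<gamma> k *v jmp d u \<gamma> k + T3 T \<gamma> k *v djmp pb d u \<gamma> k) +
        transpose (Dg pb d \<gamma> k) *v (T2 T \<gamma> k *v jmp d u \<gamma> k + T4 T \<gamma> k *v djmp pb d u \<gamma> k)) +
     (\<Sum>\<gamma>\<in>ifacets d k. let v = nb d k \<gamma> in
        (\<Sum>\<epsilon>\<in>ifacets d k - {\<gamma>}. transpose (Rm d \<gamma> k) *v (T5 T \<gamma> \<epsilon> k *v jmp d u \<epsilon> k)) +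
        (\<Sum>\<delta>\<in>ifacets d v - {\<gamma>}. transpose (Rm d \<gamma> k) *v (T6 T \<gamma> \<delta> v *v jmp d u \<delta> v)))"

definition sB ::
  "diffusion \<Rightarrow> ('n::finite,'f::finite) disc \<Rightarrow> 'f penalty \<Rightarrow> (facet \<Rightarrow> real^'f) \<Rightarrow> (facet \<Rightarrow> real^'f) \<Rightarrow>
   (nat \<Rightarrow> real^'n) \<Rightarrow> nat \<Rightarrow> real^'n" where
  "sB pb d T ub wb u k =
     (\<Sum>\<gamma>\<in>dfacets pb d k. let r = Rm d \<gamma> k *v u k - ub \<gamma> in
        transpose (Rm d \<gamma> k) *v (TD T \<gamma> *v r) - transpose (Dg pb d \<gamma> k) *v (Bm d \<gamma> *v r)) +
     (\<Sum>\<gamma>\<in>nfacets pb d k.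
        transpose (Rm d \<gamma> k) *v (Bm d \<gamma> *v (Dg pb d \<gamma> k *v u k - wb \<gamma>)))"

definition Lh ::
  "diffusion \<Rightarrow> ('n::finite,'f::finite) disc \<Rightarrow> 'f penalty \<Rightarrow> (facet \<Rightarrow> real^'f) \<Rightarrow> (facet \<Rightarrow> real^'f) \<Rightarrow>
   (nat \<Rightarrow> real^'n) \<Rightarrow> nat \<Rightarrow> real^'n" where
  "Lh pb d T ub wb u k =
     - (D2 pb d k *v u k) + Hinv d k *v sI pb d T u k + Hinv d k *v sB pb d T ub wb u k"

definition sat_rhs ::
  "diffusion \<Rightarrow> ('n::finite,'f::finite) disc \<Rightarrow> 'f penalty \<Rightarrow> (nat \<Rightarrow> real^'n) \<Rightarrow>
   (facet \<Rightarrow> real^'f) \<Rightarrow> (facet \<Rightarrow> real^'f) \<Rightarrow> (nat \<Rightarrow> real^'n) \<Rightarrow> nat \<Rightarrow> real^'n" where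
  "sat_rhs pb d T f ub wb u k =
     D2 pb d k *v u k + f k - Hinv d k *v sI pb d T u k - Hinv d k *v sB pb d T ub wb u k"

definition sI_adj :: "diffusion \<Rightarrow> ('n::finite,'f::finite) disc \<Rightarrow> 'f penalty \<Rightarrow> (nat \<Rightarrow> real^'n) \<Rightarrow> nat \<Rightarrow> real^'n" where
  "sI_adj pb d T \<psi> k =
     (\<Sum>\<gamma>\<in>ifacets d k.
        let v = nb d k \<gamma>; rk = Rm d \<gamma> k *v \<psi> k; rv = Rm d \<gamma> v *v \<psi> v;
            dk = Dg pb d \<gamma> k *v \<psi> k; dv = Dg pb d \<gamma> v *v \<psi> v in
        transpose (Rm d \<gamma> k) *v
          (T1 T \<gamma> k *v rk - T1 T \<gamma> v *v rv + (T2 T \<gamma> k + Bm d \<gamma>) *v dk - T2 T \<gamma> v *v dv) +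
        transpose (Dg pb d \<gamma> k) *v
          ((T3 T \<gamma> k - Bm d \<gamma>) *v rk + T3 T \<gamma> v *v rv + T4 T \<gamma> k *v dk + T4 T \<gamma> v *v dv)) +
     (\<Sum>\<gamma>\<in>ifacets d k. let v = nb d k \<gamma> in
        (\<Sum>\<epsilon>\<in>ifacets d k - {\<gamma>}. let g = nb d k \<epsilon> in transpose (Rm d \<gamma> k) *v
           (T5 T \<gamma> \<epsilon> k *v (Rm d \<epsilon> k *v \<psi> k) + T6 T \<gamma> \<epsilon> k *v (Rm d \<epsilon> g *v \<psi> g))) -
        (\<Sum>\<delta>\<in>ifacets d v - {\<gamma>}. let q = nb d v \<delta> in transpose (Rm d \<gamma> k) *v
           (T5 T \<gamma> \<delta> v *v (Rm d \<delta> v *v \<psi> v) + T6 T \<gamma> \<delta> v *v (Rm d \<delta> q *v \<psi> q))))"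

definition Lh_adj ::
  "diffusion \<Rightarrow> ('n::finite,'f::finite) disc \<Rightarrow> 'f penalty \<Rightarrow> (facet \<Rightarrow> real^'f) \<Rightarrow> (facet \<Rightarrow> real^'f) \<Rightarrow>
   (nat \<Rightarrow> real^'n) \<Rightarrow> nat \<Rightarrow> real^'n" where
  "Lh_adj pb d T \<psi>b \<zeta>b \<psi> k =
     - (D2 pb d k *v \<psi> k) + Hinv d k *v sI_adj pb d T \<psi> k + Hinv d k *v sB pb d T \<psi>b \<zeta>b \<psi> k"

section \<open>Properties of the scheme\<close>

definition Hnorm :: "('n::finite,'f::finite) disc \<Rightarrow> nat \<Rightarrow> real^'n \<Rightarrow> real" where
  "Hnorm d k v = sqrt (v \<bullet> (Hm d k *v v))"

definition energy_stable :: "diffusion \<Rightarrow> ('n::finite,'f::finite) disc \<Rightarrow> 'f penalty \<Rightarrow> bool" where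
  "energy_stable pb d T \<longleftrightarrow> (\<forall>u.
     (\<forall>t\<ge>0. \<forall>k<nel d. ((\<lambda>\<tau>. u \<tau> k) has_vector_derivative
        sat_rhs pb d T (\<lambda>_. 0) (\<lambda>_. 0) (\<lambda>_. 0) (u t) k) (at t within {0..})) \<longrightarrow>
     (\<forall>t\<ge>0. \<exists>r\<le>0. ((\<lambda>\<tau>. \<Sum>k<nel d. u \<tau> k \<bullet> (Hm d k *v u \<tau> k)) has_real_derivative r)
        (at t within {0..})))"

text \<open>
  What remains in a conservative scheme is, on each boundary facet, the flux left over by
  summation by parts and the boundary penalty term.
\<close>

definition conservative :: "diffusion \<Rightarrow> ('n::finite,'f::finite) disc \<Rightarrow> 'f penalty \<Rightarrow> bool" where
  "conservative pb d T \<longleftrightarrow> (\<forall>ub wb u.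
     (\<Sum>k<nel d. 1 \<bullet> (Hm d k *v sat_rhs pb d T (\<lambda>_. 0) ub wb u k)) =
     (\<Sum>k<nel d. (\<Sum>\<gamma>\<in>facets d k - ifacets d k. 1 \<bullet> (Bm d \<gamma> *v (Dg pb d \<gamma> k *v u k)))
        - 1 \<bullet> sB pb d T ub wb u k))"

definition trunc ::
  "diffusion \<Rightarrow> ('n::finite,'f::finite) disc \<Rightarrow> 'f penalty \<Rightarrow>
   (real^2 \<Rightarrow> real) \<Rightarrow> (real^2 \<Rightarrow> real) \<Rightarrow> (real^2 \<Rightarrow> real) \<Rightarrow> (real^2 \<Rightarrow> real) \<Rightarrow> nat \<Rightarrow> real" where
  "trunc pb d T F uD uN U k =
     Hnorm d k (Lh pb d T (fnodal d uD) (fnodal d uN) (nodal d U) k - nodal d F k)"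

definition trunc_adj ::
  "diffusion \<Rightarrow> ('n::finite,'f::finite) disc \<Rightarrow> 'f penalty \<Rightarrow>
   (real^2 \<Rightarrow> real) \<Rightarrow> (real^2 \<Rightarrow> real) \<Rightarrow> (real^2 \<Rightarrow> real) \<Rightarrow> (real^2 \<Rightarrow> real) \<Rightarrow> nat \<Rightarrow> real" where
  "trunc_adj pb d T G \<psi>D \<psi>N \<psi> k =
     Hnorm d k (Lh_adj pb d T (fnodal d \<psi>D) (fnodal d \<psi>N) (nodal d \<psi>) k - nodal d G k)"

definition consistent ::
  "nat \<Rightarrow> diffusion \<Rightarrow> (nat \<Rightarrow> ('n::finite,'f::finite) disc) \<Rightarrow> (nat \<Rightarrow> 'f penalty) \<Rightarrow> bool" where
  "consistent p pb \<D> \<T> \<longleftrightarrow> (\<forall>F uD uN U. Ck (p + 1) U \<and> steady_solution pb F uD uN U \<longrightarrow>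
     (\<lambda>n. \<Sum>k<nel (\<D> n). trunc pb (\<D> n) (\<T> n) F uD uN U k) \<longlonglongrightarrow> 0)"

definition adjoint_consistent ::
  "nat \<Rightarrow> diffusion \<Rightarrow> (nat \<Rightarrow> ('n::finite,'f::finite) disc) \<Rightarrow> (nat \<Rightarrow> 'f penalty) \<Rightarrow> bool" where
  "adjoint_consistent p pb \<D> \<T> \<longleftrightarrow> (\<forall>G \<psi>D \<psi>N \<psi>. Ck (p + 1) \<psi> \<and> steady_solution pb G \<psi>D \<psi>N \<psi> \<longrightarrow>
     (\<lambda>n. \<Sum>k<nel (\<D> n). trunc_adj pb (\<D> n) (\<T> n) G \<psi>D \<psi>N \<psi> k) \<longlonglongrightarrow> 0)"

text \<open>
  Bounds on each term of the above sums. There are \<open>O(h\<^sup>-\<^sup>2)\<close> terms, so that the sums themselves are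
  \<open>O(h\<^sup>p\<^sup>-\<^sup>2)\<close>.
\<close>

definition consistent_rate ::
  "nat \<Rightarrow> diffusion \<Rightarrow> (nat \<Rightarrow> ('n::finite,'f::finite) disc) \<Rightarrow> (nat \<Rightarrow> 'f penalty) \<Rightarrow> bool" where
  "consistent_rate p pb \<D> \<T> \<longleftrightarrow> (\<forall>F uD uN U. Ck (p + 1) U \<and> steady_solution pb F uD uN U \<longrightarrow>
     (\<exists>C. \<forall>n. \<forall>k<nel (\<D> n). trunc pb (\<D> n) (\<T> n) F uD uN U k \<le> C * mesh_size (\<D> n) ^ p))"

definition adjoint_consistent_rate ::
  "nat \<Rightarrow> diffusion \<Rightarrow> (nat \<Rightarrow> ('n::finite,'f::finite) disc) \<Rightarrow> (nat \<Rightarrow> 'f penalty) \<Rightarrow> bool" where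
  "adjoint_consistent_rate p pb \<D> \<T> \<longleftrightarrow> (\<forall>G \<psi>D \<psi>N \<psi>. Ck (p + 1) \<psi> \<and> steady_solution pb G \<psi>D \<psi>N \<psi> \<longrightarrow>
     (\<exists>C. \<forall>n. \<forall>k<nel (\<D> n). trunc_adj pb (\<D> n) (\<T> n) G \<psi>D \<psi>N \<psi> k \<le> C * mesh_size (\<D> n) ^ p))"

section \<open>The local discontinuous Galerkin method\<close>

text \<open>
  The method reads \<open>W = \<lambda>\<nabla>U\<close>, \<open>\<partial>\<^sub>tU - \<nabla>\<cdot>W = F\<close>, each equation being integrated by parts on every
  element with the traces replaced by numerical fluxes (written \<open>ldg_u\<close>, \<open>ldg_w\<close> below). Integrating
  the first one back, the discrete equations on element \<open>k\<close> are, with test vectors \<open>z\<close>, \<open>v\<close>,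

  \<^item> \<open>z\<^sup>T H W = z\<^sup>T H \<Lambda> D u + \<Sum>\<^sub>\<gamma> (N\<^sup>T R \<Lambda> z)\<^sup>T B (ldg_u - R u)\<close>,
  \<^item> \<open>v\<^sup>T H du/dt = v\<^sup>T H f - (D v)\<^sup>T H W + \<Sum>\<^sub>\<gamma> (R v)\<^sup>T B (n \<cdot> ldg_w)\<close>.

  The first one says that \<open>W\<close> is \<open>\<Lambda> D u\<close> plus the \<open>ldg_lift\<close> of \<open>ldg_u - R u\<close> from every facet.
  Inserting this and the summation-by-parts property into the second one leaves \<open>H D\<^sup>2 u + H f\<close> minus

    \<open>\<Sum>\<^sub>\<gamma> R\<^sup>T B (D\<^sub>\<gamma> u - n \<cdot> ldg_w) + D\<^sub>\<gamma>\<^sup>T B (ldg_u - R u)\<close>,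

  to be compared with the penalty terms. On a Dirichlet facet \<open>ldg_u\<close> is the boundary value and
  \<open>ldg_w\<close> the interior trace of \<open>W\<close>, minus \<open>\<mu> h\<^sup>-\<^sup>1\<close> times the jump. The penalty terms contain no
  coupling of a Dirichlet facet with the other facets of its element; accordingly the
  lifting of a Dirichlet jump is taken into account on its own facet only.
\<close>

definition ldg_switch :: "('n::finite,'f::finite) disc \<Rightarrow> nat \<Rightarrow> facet \<Rightarrow> 'f \<Rightarrow> real^2" where
  "ldg_switch d k \<gamma> a = (let v = nb d k \<gamma> in
     (1/2) *\<^sub>R (beta d \<gamma> k *\<^sub>R nrm d \<gamma> k a + beta d \<gamma> v *\<^sub>R nrm d \<gamma> v a))"

definition ldg_jump :: "('n::finite,'f::finite) disc \<Rightarrow> (nat \<Rightarrow> real^'n) \<Rightarrow> nat \<Rightarrow> facet \<Rightarrow> 'f \<Rightarrow> real^2" where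
  "ldg_jump d u k \<gamma> a = (let v = nb d k \<gamma> in
     (Rm d \<gamma> k *v u k) $ a *\<^sub>R nrm d \<gamma> k a + (Rm d \<gamma> v *v u v) $ a *\<^sub>R nrm d \<gamma> v a)"

definition ldg_u :: "('n::finite,'f::finite) disc \<Rightarrow> (nat \<Rightarrow> real^'n) \<Rightarrow> nat \<Rightarrow> facet \<Rightarrow> real^'f" where
  "ldg_u d u k \<gamma> = (let v = nb d k \<gamma> in \<chi> a.
     ((Rm d \<gamma> k *v u k) $ a + (Rm d \<gamma> v *v u v) $ a) / 2 - ldg_switch d k \<gamma> a \<bullet> ldg_jump d u k \<gamma> a)"

definition ldg_lift ::
  "diffusion \<Rightarrow> ('n::finite,'f::finite) disc \<Rightarrow> nat \<Rightarrow> facet \<Rightarrow> real^'f \<Rightarrow> 2 \<Rightarrow> real^'n" where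
  "ldg_lift pb d k \<gamma> r i = (\<Sum>j\<in>UNIV.
     (Hinv d k ** Lam pb d k i j ** transpose (Rm d \<gamma> k) ** Nm d \<gamma> k j ** Bm d \<gamma>) *v r)"

definition ldg_grad ::
  "diffusion \<Rightarrow> ('n::finite,'f::finite) disc \<Rightarrow> (nat \<Rightarrow> real^'n) \<Rightarrow> nat \<Rightarrow> 2 \<Rightarrow> real^'n" where
  "ldg_grad pb d u k i = (\<Sum>j\<in>UNIV. (Lam pb d k i j ** Dm d k j) *v u k)"

definition ldg_flux ::
  "diffusion \<Rightarrow> ('n::finite,'f::finite) disc \<Rightarrow> (nat \<Rightarrow> real^'n) \<Rightarrow> nat \<Rightarrow> 2 \<Rightarrow> real^'n" where
  "ldg_flux pb d u k i = ldg_grad pb d u k i +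
     (\<Sum>\<gamma>\<in>ifacets d k. ldg_lift pb d k \<gamma> (ldg_u d u k \<gamma> - Rm d \<gamma> k *v u k) i)"

definition trace ::
  "('n::finite,'f::finite) disc \<Rightarrow> facet \<Rightarrow> nat \<Rightarrow> (2 \<Rightarrow> real^'n) \<Rightarrow> 'f \<Rightarrow> real^2" where
  "trace d \<gamma> k W a = (\<chi> i. (Rm d \<gamma> k *v W i) $ a)"

definition ldg_w ::
  "diffusion \<Rightarrow> ('n::finite,'f::finite) disc \<Rightarrow> real \<Rightarrow> (nat \<Rightarrow> real^'n) \<Rightarrow> nat \<Rightarrow> facet \<Rightarrow> 'f \<Rightarrow> real^2" where
  "ldg_w pb d \<mu> u k \<gamma> a =
     (let v = nb d k \<gamma>;
          wk = trace d \<gamma> k (ldg_flux pb d u k) a; wv = trace d \<gamma> v (ldg_flux pb d u v) a in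
      (1/2) *\<^sub>R (wk + wv) + (wk \<bullet> nrm d \<gamma> k a + wv \<bullet> nrm d \<gamma> v a) *\<^sub>R ldg_switch d k \<gamma> a
      - (\<mu> / mesh_size d) *\<^sub>R ldg_jump d u k \<gamma> a)"

definition ldg_w_dirichlet ::
  "diffusion \<Rightarrow> ('n::finite,'f::finite) disc \<Rightarrow> real \<Rightarrow> real^'f \<Rightarrow> (nat \<Rightarrow> real^'n) \<Rightarrow> nat \<Rightarrow> facet \<Rightarrow> 'f \<Rightarrow> real^2"
  where
  "ldg_w_dirichlet pb d \<mu> ub u k \<gamma> a =
     trace d \<gamma> k (\<lambda>i. ldg_grad pb d u k i + ldg_lift pb d k \<gamma> (ub - Rm d \<gamma> k *v u k) i) a
     - (\<mu> / mesh_size d) *\<^sub>R (((Rm d \<gamma> k *v u k) $ a - ub $ a) *\<^sub>R nrm d \<gamma> k a)"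

definition ldg_coefficients ::
  "diffusion \<Rightarrow> ('n::finite,'f::finite) disc \<Rightarrow> real \<Rightarrow> 'f penalty \<Rightarrow> bool" where
  "ldg_coefficients pb d \<mu> T \<longleftrightarrow>
     (\<forall>u. \<forall>k<nel d. \<forall>\<gamma>\<in>ifacets d k. let v = nb d k \<gamma> in
        Bm d \<gamma> *v (Dg pb d \<gamma> k *v u k - (\<chi> a. ldg_w pb d \<mu> u k \<gamma> a \<bullet> nrm d \<gamma> k a)) =
          T1 T \<gamma> k *v jmp d u \<gamma> k + T3 T \<gamma> k *v djmp pb d u \<gamma> k +
          (\<Sum>\<epsilon>\<in>ifacets d k - {\<gamma>}. T5 T \<gamma> \<epsilon> k *v jmp d u \<epsilon> k) +
          (\<Sum>\<delta>\<in>ifacets d v - {\<gamma>}. T6 T \<gamma> \<delta> v *v jmp d u \<delta> v) \<and>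
        Bm d \<gamma> *v (ldg_u d u k \<gamma> - Rm d \<gamma> k *v u k) =
          T2 T \<gamma> k *v jmp d u \<gamma> k + T4 T \<gamma> k *v djmp pb d u \<gamma> k) \<and>
     (\<forall>u ub. \<forall>k<nel d. \<forall>\<gamma>\<in>dfacets pb d k.
        Bm d \<gamma> *v (Dg pb d \<gamma> k *v u k - (\<chi> a. ldg_w_dirichlet pb d \<mu> ub u k \<gamma> a \<bullet> nrm d \<gamma> k a)) =
          TD T \<gamma> *v (Rm d \<gamma> k *v u k - ub))"

definition ldg_type ::
  "diffusion \<Rightarrow> ('n::finite,'f::finite) disc \<Rightarrow> real \<Rightarrow> 'f penalty \<Rightarrow> bool" where
  "ldg_type pb d \<mu> T \<longleftrightarrow> (\<exists>S. ldg_coefficients pb d \<mu> S \<and>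
     (\<forall>k<nel d. \<forall>\<gamma>\<in>ifacets d k.
        (\<exists>c>0. T1 T \<gamma> k = c *\<^sub>R T1 S \<gamma> k) \<and>
        T2 T \<gamma> k = T2 S \<gamma> k \<and> T3 T \<gamma> k = T3 S \<gamma> k \<and> T4 T \<gamma> k = T4 S \<gamma> k \<and>
        (\<forall>\<epsilon>\<in>ifacets d k - {\<gamma>}. (\<exists>c>0. T5 T \<gamma> \<epsilon> k = c *\<^sub>R T5 S \<gamma> \<epsilon> k) \<and>
                              (\<exists>c>0. T6 T \<gamma> \<epsilon> k = c *\<^sub>R T6 S \<gamma> \<epsilon> k))) \<and>
     (\<forall>k<nel d. \<forall>\<gamma>\<in>dfacets pb d k. \<exists>c>0. TD T \<gamma> = c *\<^sub>R TD S \<gamma>))"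

section \<open>The choice of penalty coefficients\<close>

definition ldg_sat ::
  "diffusion \<Rightarrow> ('n::finite,'f::finite) disc \<Rightarrow> 'f penalty \<Rightarrow> bool" where
  "ldg_sat pb d T \<longleftrightarrow>
     (\<forall>k<nel d. \<forall>\<gamma>\<in>ifacets d k.
        let v = nb d k \<gamma>; B = Bm d \<gamma>; bk = beta d \<gamma> k; bv = beta d \<gamma> v;
            X = B ** (((bk - bv + 1) / alpha d \<gamma> k) *\<^sub>R Ups pb d \<gamma> \<gamma> k
                    + ((bv - bk + 1) / alpha d \<gamma> v) *\<^sub>R Ups pb d \<gamma> \<gamma> v) ** B in
        T1 T \<gamma> k = X \<and> T1 T \<gamma> v = X \<and>
        T2 T \<gamma> k = ((bv - bk - 1) / 2) *\<^sub>R B \<and> T2 T \<gamma> v = ((bk - bv - 1) / 2) *\<^sub>R B \<and>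
        T3 T \<gamma> k = ((bv - bk + 1) / 2) *\<^sub>R B \<and> T3 T \<gamma> v = ((bk - bv + 1) / 2) *\<^sub>R B \<and>
        T4 T \<gamma> k = 0 \<and> T4 T \<gamma> v = 0 \<and>
        (\<forall>\<epsilon>\<in>ifacets d k - {\<gamma>}.
           let g = nb d k \<epsilon>;
               Y = ((1 + bk - bv) * (1 + beta d \<epsilon> k - beta d \<epsilon> g) / 16) *\<^sub>R
                     (B ** Ups pb d \<gamma> \<epsilon> k ** Bm d \<epsilon>) in
           T5 T \<gamma> \<epsilon> k = Y \<and> - T6 T \<gamma> \<epsilon> k = Y) \<and>
        (\<forall>\<delta>\<in>ifacets d v - {\<gamma>}.
           let q = nb d v \<delta>;
               Z = ((bk - bv - 1) * (1 + beta d \<delta> v - beta d \<delta> q) / 16) *\<^sub>R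
                     (B ** Ups pb d \<gamma> \<delta> v ** Bm d \<delta>) in
           T6 T \<gamma> \<delta> v = Z \<and> - T5 T \<gamma> \<delta> v = Z)) \<and>
     (\<forall>k<nel d. \<forall>\<gamma>\<in>dfacets pb d k.
        TD T \<gamma> = (1 / alpha d \<gamma> k) *\<^sub>R (Bm d \<gamma> ** Ups pb d \<gamma> \<gamma> k ** Bm d \<gamma>))"

end

theory Submission
  imports Defs
begin

text \<open>
  Pairing the two sides of every interior facet, the penalty terms with switch 1 turn the scheme into
  a symmetric bilinear form. Tested with constants it reduces to boundary terms, and tested with the
  solution it is, on every element and in the inner product with matrix \<open>H\<Lambda>\<close>, at most a sum over the
  facets of negative squares of \<open>\<alpha>\<^sub>\<gamma> D u\<close> minus the lifting of the jump. With these coefficients the adjoint interior penalties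
  coincide with the primal ones, so adjoint consistency is consistency for the adjoint data. For
  consistency, a smooth function becomes, in the variable \<open>w = h z\<close> on the reference triangle, a
  function with derivatives bounded independently of the mesh. Hence \<open>R\<close>, which is exact for degree \<open>p\<close>,
  extrapolates it with error \<open>O(h\<^sup>p\<^sup>+\<^sup>1)\<close>, and every term of the truncation error is \<open>O(h\<^sup>p\<^sup>-\<^sup>1)\<close> pointwise.
  The norm contributes a further factor \<open>h\<close>, and there are \<open>O(h\<^sup>-\<^sup>2)\<close> elements.
\<close>


text \<open>What shapes the error analysis is the balance of powers of h. \<open>Hinv\<close> is of
  size h^-2, so the penalties \<open>sI\<close> and \<open>sB\<close> must be O(h^(p+1)) to leave
  O(h^(p-1)). Jumps of a smooth function have this order, hence their coefficients may at most be
  O(1). They are, because \<open>Ups\<close>, of size h^-2 through \<open>Hinv\<close>, always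
  stands between two factors \<open>Bm\<close> of size h. Jumps of the normal flux are one order
  worse, and \<open>T3\<close> is of size h; where \<open>Dg\<close>, of size 1/h, multiplies a
  jump, \<open>T2\<close> or \<open>Bm\<close> restores the lost power. All bounds must hold with
  one constant for every mesh, element and facet. They are therefore stated for families indexed by
  mesh, element and facets, with an explicit exponent of h, and not as limits. For stability the
  constants leave room: the square completed on an interior facet uses only half of the penalty
  2/\<alpha>, and the other half pays for the coupling between different facets of an element. This
  coupling is the Gram matrix of the liftings, so its total sign is governed by the square of a
  sum.\<close>

lemma inner_mv_left: "(A *v x) \<bullet> y = x \<bullet> (transpose A *v y)" for A :: "real^'m^'k"
  by (metis dot_lmul_matrix inner_commute transpose_matrix_vector)

lemma inner_mv_right: "x \<bullet> (transpose A *v y) = (A *v x) \<bullet> y" for A :: "real^'m^'k"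
  by (simp add: inner_mv_left)

section \<open>Diagonal matrices and elementary vector identities\<close>

lemma diagm_mv: "(diagm x *v y) $ a = x $ a * y $ a"
  unfolding diagm_def matrix_vector_mult_def
  by (simp add: if_distrib[of "\<lambda>z. z * _"] sum.delta cong: if_cong)

lemma transpose_diagm [simp]: "transpose (diagm x) = diagm x"
  by (auto simp: diagm_def transpose_def vec_eq_iff)

lemma diagm_mult: "diagm x ** diagm y = diagm (\<chi> a. x $ a * y $ a)"
  by (intro matrix_eq[THEN iffD2] allI)
    (simp add: matrix_vector_mul_assoc[symmetric] vec_eq_iff diagm_mv)

lemma diagm_commute: "diagm x ** diagm y = diagm y ** diagm x"
  by (simp add: diagm_mult mult.commute)

lemma matrix_inv_diagm:
  assumes "\<And>a. x $ a \<noteq> 0"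
  shows "matrix_inv (diagm x) = diagm (\<chi> a. 1 / x $ a)"
proof -
  have 1: "diagm x ** diagm (\<chi> a. 1 / x $ a) = mat 1" "diagm (\<chi> a. 1 / x $ a) ** diagm x = mat 1"
    unfolding diagm_mult using assms by (auto simp: diagm_def mat_def vec_eq_iff)
  then have "\<exists>A'. diagm x ** A' = mat 1 \<and> A' ** diagm x = mat 1" by blast
  then have "diagm x ** matrix_inv (diagm x) = mat 1"
    unfolding matrix_inv_def by (rule someI2_ex) simp
  with 1 show ?thesis by (metis matrix_mul_assoc matrix_mul_lid matrix_mul_rid)
qed

lemma matrix_sum_mv: "(\<Sum>i\<in>I. A i) *v x = (\<Sum>i\<in>I. A i *v x)" for x :: "real^'m"
  by (induction I rule: infinite_finite_induct) (auto simp: matrix_vector_mult_add_rdistrib)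

lemma matrix_mv_sum: "A *v (\<Sum>i\<in>I. f i) = (\<Sum>i\<in>I. A *v f i)" for A :: "real^'m^'k"
  by (induction I rule: infinite_finite_induct) (auto simp: matrix_vector_right_distrib)

lemma scaleR_mv: "(c *\<^sub>R A) *v x = c *\<^sub>R (A *v x)" for A :: "real^'m^'k"
  by (simp add: vec_eq_iff matrix_vector_mult_def sum_distrib_left mult.assoc)

lemma mv_scaleR: "A *v (c *\<^sub>R x) = c *\<^sub>R (A *v x)" for A :: "real^'m^'k"
  by (simp add: vec_eq_iff matrix_vector_mult_def sum_distrib_left algebra_simps)

lemma vec_1_nth [simp]: "(1::real^'m) $ a = 1"
  by (simp add: one_vec_def)

lemma cw_minus: "cw (- x) = - cw x"
  by (simp add: cw_def vec_eq_iff)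

lemma norm_cw: "norm (cw x) = norm x"
proof -
  have "cw x \<bullet> cw x = x \<bullet> x" by (simp add: inner_vec_def cw_def sum_2)
  then show ?thesis by (simp add: norm_eq_sqrt_inner)
qed

subsection \<open>Element maps and facet normals\<close>

text \<open>\<open>rvert\<close> takes the same value at all indices from 2 on, so no bound on
  \<open>e\<close> is required.\<close>

lemma rvert_in [simp]: "rvert e \<in> ref_triangle"
proof -
  have "rvert e = rvert (min e 2)" by (auto simp: rvert_def min_def)
  then have "rvert e \<in> rvert ` {..<3}" by (rule image_eqI) auto
  then show ?thesis unfolding ref_triangle_def by (rule hull_inc)
qed

lemma ref_triangle_convex: "convex ref_triangle"
  unfolding ref_triangle_def by (rule convex_convex_hull)

lemma redge_in: "s \<in> {0..1} \<Longrightarrow> redge e s \<in> ref_triangle"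
proof -
  assume "s \<in> {0..1}"
  then have "redge e s \<in> closed_segment (rvert e) (rvert (Suc e mod 3))"
    by (metis path_image_linepath redge_def path_image_def imageI)
  moreover have "closed_segment (rvert e) (rvert (Suc e mod 3)) \<subseteq> ref_triangle"
    by (rule closed_segment_subset) (simp_all add: ref_triangle_convex)
  ultimately show ?thesis by blast
qed

lemma ref_triangle_compact: "compact ref_triangle"
  unfolding ref_triangle_def by (intro finite_imp_compact_convex_hull) auto

lemma ref_triangle_bounds:
  assumes "z \<in> ref_triangle" shows "0 \<le> z $ i" "z $ i \<le> 1"
proof -
  let ?K = "{z :: real^2. \<forall>i. 0 \<le> z $ i \<and> z $ i \<le> 1}"
  have "convex ?K" by (auto simp: convex_def intro: convex_bound_le)
  moreover have "rvert ` {..<3} \<subseteq> ?K" by (auto simp: rvert_def axis_def)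
  ultimately have "ref_triangle \<subseteq> ?K" unfolding ref_triangle_def by (intro hull_minimal) auto
  then show "0 \<le> z $ i" "z $ i \<le> 1" using assms by auto
qed

lemma redge_deriv: "(redge e has_vector_derivative (rvert (Suc e mod 3) - rvert e)) (at s)"
  unfolding redge_def by (rule has_vector_derivative_linepath_within)

text \<open>For larger indices an edge may degenerate: at \<open>e = 4\<close> both end points are
  the third vertex.\<close>

lemma rvert_neq:
  assumes "e < 3" shows "rvert (Suc e mod 3) \<noteq> rvert e"
proof -
  have "axis 1 (1::real) \<noteq> (axis 2 1 :: real^2)" by (simp add: axis_eq_axis)
  moreover have "e = 0 \<or> e = 1 \<or> e = 2" using assms by linarith
  ultimately show ?thesis by (auto simp: rvert_def axis_eq_0_iff)
qed

lemma poly_map_eq: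
  assumes "poly_map q c F"
  shows "F = (\<lambda>x. \<Sum>i\<le>q. \<Sum>j\<le>q - i. ((x $ 1)^i * (x $ 2)^j) *\<^sub>R c i j)"
  using assms by (auto simp: poly_map_def)

lemma poly_map_differentiable:
  assumes "poly_map q c F" shows "F differentiable (at x)"
proof -
  have nth: "(\<lambda>x::real^2. x $ i) differentiable (at x)" for i
    by (rule bounded_linear_imp_differentiable) (rule bounded_linear_vec_nth)
  show ?thesis
    unfolding poly_map_eq[OF assms]
    by (intro differentiable_sum ballI differentiable_scaleR differentiable_mult differentiable_power nth
        differentiable_const finite_atMost)
qed


section \<open>Incidence of elements and facets on one mesh\<close>

locale sbp_disc =
  fixes p :: nat and pb :: diffusion and d :: "('n::finite, 'f::finite) disc"
  assumes dp: "diffusion_problem p pb" and sd: "sbp_discretization p pb d"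
begin

lemma mesh: "mesh p pb d" and gauss: "gauss_rule p d"
  and quad: "k < nel d \<Longrightarrow> e < 3 \<Longrightarrow> facet_quadrature d k e"
  and rnode_in: "rnode d b \<in> ref_triangle"
  and sbp: "k < nel d \<Longrightarrow> sbp_operators p d k"
  and outward: "k < nel d \<Longrightarrow> \<gamma> \<in> facets d k - ifacets d k \<Longrightarrow>
        outward_unit_normal (dom pb) (fnode d \<gamma> a) (nrm d \<gamma> k a)"
  and alpha_pos: "k < nel d \<Longrightarrow> \<gamma> \<in> facets d k \<Longrightarrow> alpha d \<gamma> k > 0"
  and alpha_sum: "k < nel d \<Longrightarrow> (\<Sum>\<gamma>\<in>facets d k. alpha d \<gamma> k) = 1"
  using sd unfolding sbp_discretization_def by auto

lemma
  assumes "k < nel d"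
  shows emap_poly: "\<exists>c. poly_map (p + 1) c (emap d k)"
    and emap_inj: "inj_on (emap d k) ref_triangle"
    and emap_det: "x \<in> ref_triangle \<Longrightarrow> det (matrix (frechet_derivative (emap d k) (at x))) > 0"
  using conjunct1[OF mesh[unfolded mesh_def]] assms by auto

lemma elem_Union: "(\<Union>k<nel d. elem d k) = dom pb"
  using mesh unfolding mesh_def by (elim conjE)

lemma elem_disjoint: "j < nel d \<Longrightarrow> k < nel d \<Longrightarrow> j \<noteq> k \<Longrightarrow> interior (elem d j) \<inter> interior (elem d k) = {}"
  using mesh unfolding mesh_def by (elim conjE) simp

lemma facet_dichotomy:
  assumes "k < nel d" "\<gamma> \<in> facets d k"
  shows "card (adj d \<gamma>) = 2 \<and> \<not> \<gamma> \<subseteq> gamD pb \<and> \<not> \<gamma> \<subseteq> gamN pb \<or>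
    card (adj d \<gamma>) = 1 \<and> (\<gamma> \<subseteq> gamD pb) \<noteq> (\<gamma> \<subseteq> gamN pb)"
proof -
  have "\<forall>k<nel d. \<forall>\<gamma>\<in>facets d k.
        card (adj d \<gamma>) = 2 \<and> \<not> \<gamma> \<subseteq> gamD pb \<and> \<not> \<gamma> \<subseteq> gamN pb \<or>
        card (adj d \<gamma>) = 1 \<and> (\<gamma> \<subseteq> gamD pb) \<noteq> (\<gamma> \<subseteq> gamN pb)"
    using mesh unfolding mesh_def by (elim conjE)
  then show ?thesis using assms by (elim allE impE ballE) auto
qed

lemma facet_reversed:
  assumes "j < nel d" "k < nel d" "e < 3" "e' < 3" "j \<noteq> k" "lfacet d j e = lfacet d k e'" "s \<in> {0..1}"
  shows "emap d j (redge e s) = emap d k (redge e' (1 - s))"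
proof -
  have "\<forall>j<nel d. \<forall>k<nel d. \<forall>e<3. \<forall>e'<3. j \<noteq> k \<and> lfacet d j e = lfacet d k e' \<longrightarrow>
        (\<forall>s\<in>{0..1}. emap d j (redge e s) = emap d k (redge e' (1 - s)))"
    using mesh unfolding mesh_def by (elim conjE)
  from this[rule_format, OF assms(1,2,3,4) conjI[OF assms(5,6)] assms(7)] show ?thesis .
qed

lemma finite_facets [simp]: "finite (facets d k)" and finite_ifacets [simp]: "finite (ifacets d k)"
  and finite_dfacets [simp]: "finite (dfacets pb d k)" and finite_nfacets [simp]: "finite (nfacets pb d k)"
  by (auto simp: facets_def ifacets_def dfacets_def nfacets_def)

lemma card_facets_le: "card (facets d k) \<le> 3"
  unfolding facets_def by (rule card_image_le[THEN order_trans]) auto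

lemma ifacets_subset: "\<gamma> \<in> ifacets d k \<Longrightarrow> \<gamma> \<in> facets d k"
  and dfacets_subset: "\<gamma> \<in> dfacets pb d k \<Longrightarrow> \<gamma> \<in> facets d k"
  and nfacets_subset: "\<gamma> \<in> nfacets pb d k \<Longrightarrow> \<gamma> \<in> facets d k"
  by (auto simp: ifacets_def dfacets_def nfacets_def)

lemma ifacets_iff: "k < nel d \<Longrightarrow> \<gamma> \<in> facets d k \<Longrightarrow> \<gamma> \<in> ifacets d k \<longleftrightarrow> card (adj d \<gamma>) = 2"
proof -
  assume k: "k < nel d" "\<gamma> \<in> facets d k"
  then have ka: "k \<in> adj d \<gamma>" by (simp add: adj_def)
  have "card (adj d \<gamma>) = 1 \<or> card (adj d \<gamma>) = 2" using facet_dichotomy[OF k] by blast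
  then show ?thesis
  proof
    assume c: "card (adj d \<gamma>) = 1"
    then obtain x where "adj d \<gamma> = {x}" by (auto simp: card_1_singleton_iff)
    then show ?thesis using ka c by (auto simp: ifacets_def)
  next
    assume c: "card (adj d \<gamma>) = 2"
    then obtain x y where "adj d \<gamma> = {x, y}" "x \<noteq> y" by (auto simp: card_2_iff)
    then show ?thesis using ka c k by (auto simp: ifacets_def)
  qed
qed

text \<open>Exactly two elements contain an interior facet, so the definite description in
  \<open>nb\<close> is determined from either side, and crossing the facet twice leads back.\<close>

lemma nb:
  assumes k: "k < nel d" and g: "\<gamma> \<in> ifacets d k"
  shows "nb d k \<gamma> < nel d" "nb d k \<gamma> \<noteq> k" "\<gamma> \<in> ifacets d (nb d k \<gamma>)" "nb d (nb d k \<gamma>) \<gamma> = k"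
    "adj d \<gamma> = {k, nb d k \<gamma>}"
proof -
  have gf: "\<gamma> \<in> facets d k" using g by (rule ifacets_subset)
  have ka: "k \<in> adj d \<gamma>" using k gf by (simp add: adj_def)
  have "card (adj d \<gamma>) = 2" using ifacets_iff[OF k gf] g by simp
  then obtain x y where "adj d \<gamma> = {x, y}" "x \<noteq> y" by (auto simp: card_2_iff)
  then obtain v where v: "adj d \<gamma> = {k, v}" "v \<noteq> k" using ka by (cases "k = x") auto
  have e1: "nb d k \<gamma> = v" unfolding nb_def v(1) using v(2) by (intro the_equality) auto
  have e2: "nb d v \<gamma> = k" unfolding nb_def v(1) using v(2) by (intro the_equality) auto
  have va: "v < nel d" "\<gamma> \<in> facets d v" using v by (auto simp: adj_def)
  show "\<gamma> \<in> ifacets d (nb d k \<gamma>)" unfolding e1 ifacets_def using va(2) not_sym[OF v(2)] ka by simp (rule exI[of _ k], simp)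
  show "nb d k \<gamma> < nel d" "nb d k \<gamma> \<noteq> k" "nb d (nb d k \<gamma>) \<gamma> = k" "adj d \<gamma> = {k, nb d k \<gamma>}"
    unfolding e1 e2 using va v by auto
qed

lemma facets_partition:
  assumes "k < nel d"
  shows "facets d k = ifacets d k \<union> (dfacets pb d k \<union> nfacets pb d k)"
    "ifacets d k \<inter> (dfacets pb d k \<union> nfacets pb d k) = {}" "dfacets pb d k \<inter> nfacets pb d k = {}"
proof -
  have "\<gamma> \<in> ifacets d k \<and> \<not> \<gamma> \<subseteq> gamD pb \<and> \<not> \<gamma> \<subseteq> gamN pb \<or>
      \<gamma> \<notin> ifacets d k \<and> (\<gamma> \<subseteq> gamD pb) \<noteq> (\<gamma> \<subseteq> gamN pb)" if "\<gamma> \<in> facets d k" for \<gamma>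
    using facet_dichotomy[OF assms that] ifacets_iff[OF assms that] by (elim disjE) simp_all
  moreover have "ifacets d k \<subseteq> facets d k" by (auto intro: ifacets_subset)
  ultimately show "facets d k = ifacets d k \<union> (dfacets pb d k \<union> nfacets pb d k)"
    "ifacets d k \<inter> (dfacets pb d k \<union> nfacets pb d k) = {}" "dfacets pb d k \<inter> nfacets pb d k = {}"
    unfolding dfacets_def nfacets_def by blast+
qed

lemma sum_facets:
  assumes "k < nel d"
  shows "(\<Sum>\<gamma>\<in>facets d k. F \<gamma>) =
    (\<Sum>\<gamma>\<in>ifacets d k. F \<gamma>) + (\<Sum>\<gamma>\<in>dfacets pb d k. F \<gamma>) + (\<Sum>\<gamma>\<in>nfacets pb d k. F \<gamma>)"
proof -
  note P = facets_partition[OF assms]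
  have "(\<Sum>\<gamma>\<in>facets d k. F \<gamma>) =
      (\<Sum>\<gamma>\<in>ifacets d k. F \<gamma>) + (\<Sum>\<gamma>\<in>dfacets pb d k \<union> nfacets pb d k. F \<gamma>)"
    by (subst P(1), rule sum.union_disjoint) (use P(2) in simp_all)
  also have "(\<Sum>\<gamma>\<in>dfacets pb d k \<union> nfacets pb d k. F \<gamma>) =
      (\<Sum>\<gamma>\<in>dfacets pb d k. F \<gamma>) + (\<Sum>\<gamma>\<in>nfacets pb d k. F \<gamma>)"
    by (rule sum.union_disjoint) (use P(3) in simp_all)
  finally show ?thesis by (simp add: add.assoc)
qed

lemma boundary_facets:
  assumes "k < nel d"
  shows "facets d k - ifacets d k = dfacets pb d k \<union> nfacets pb d k"
  using facets_partition(1,2)[OF assms] by auto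

text \<open>\<open>TD\<close> is indexed by the facet alone whereas its formula names the element;
  this lets the element be recovered from the facet.\<close>

lemma dfacets_unique:
  assumes "k < nel d" "j < nel d" "\<gamma> \<in> dfacets pb d k" "\<gamma> \<in> dfacets pb d j"
  shows "j = k"
proof -
  have "card (adj d \<gamma>) = 1" using assms facet_dichotomy[of k \<gamma>] by (auto simp: dfacets_def)
  moreover have "j \<in> adj d \<gamma>" "k \<in> adj d \<gamma>" using assms by (auto simp: dfacets_def adj_def)
  ultimately show ?thesis by (auto simp: card_1_singleton_iff)
qed

text \<open>Crossing the facet is an involution on the pairs of an element and one of its interior
  facets. It is the device that turns sums over elements into sums over the two sides of
  facets.\<close>

lemma sum_swap_sides:
  "(\<Sum>k<nel d. \<Sum>\<gamma>\<in>ifacets d k. F k \<gamma>) = (\<Sum>k<nel d. \<Sum>\<gamma>\<in>ifacets d k. F (nb d k \<gamma>) \<gamma>)"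
proof -
  let ?i = "\<lambda>(k, \<gamma>). (nb d k \<gamma>, \<gamma>)"
  have "(\<Sum>(k, \<gamma>)\<in>Sigma {..<nel d} (ifacets d). F k \<gamma>) =
    (\<Sum>(k, \<gamma>)\<in>Sigma {..<nel d} (ifacets d). F (nb d k \<gamma>) \<gamma>)"
    by (rule sum.reindex_bij_witness[of _ ?i ?i]) (auto simp: nb)
  then show ?thesis by (simp add: sum.Sigma)
qed

lemma emap_differentiable: "k < nel d \<Longrightarrow> emap d k differentiable (at x)"
  using emap_poly poly_map_differentiable by blast

lemma emap_edge_deriv:
  assumes "k < nel d"
  shows "((emap d k \<circ> redge e) has_vector_derivative
    frechet_derivative (emap d k) (at (redge e s)) (rvert (Suc e mod 3) - rvert e)) (at s)"
proof -
  have "(emap d k has_derivative frechet_derivative (emap d k) (at (redge e s))) (at (redge e s))"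
    using emap_differentiable[OF assms] by (simp add: frechet_derivative_works)
  then show ?thesis using redge_deriv
    by (metis has_derivative_at_withinI vector_derivative_diff_chain_within)
qed

lemma ftangent_deriv:
  "k < nel d \<Longrightarrow> ((emap d k \<circ> redge e) has_vector_derivative ftangent d k e s) (at s)"
  unfolding ftangent_def by (rule vector_derivative_works[THEN iffD1, OF differentiableI_vector, OF emap_edge_deriv])

text \<open>The Jacobian of the element map is invertible on the reference triangle and the edge
  vector is nonzero. Otherwise \<open>sgn\<close> could return 0 in place of a unit normal.\<close>

lemma ftangent_nonzero:
  assumes "k < nel d" "e < 3" "s \<in> {0..1}"
  shows "ftangent d k e s \<noteq> 0"
proof -
  let ?D = "frechet_derivative (emap d k) (at (redge e s))" and ?v = "rvert (Suc e mod 3) - rvert e"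
  have "linear ?D" using emap_differentiable[OF assms(1)]
    by (metis frechet_derivative_works has_derivative_linear)
  then have D: "?D ?v = matrix ?D *v ?v" by (simp add: matrix_works)
  have "det (matrix ?D) \<noteq> 0" using emap_det[OF assms(1) redge_in[OF assms(3)], of e] by linarith
  then have "invertible (matrix ?D)" by (simp add: invertible_det_nz)
  then have "matrix ?D *v ?v \<noteq> 0"
    using rvert_neq[OF assms(2)] inj_matrix_vector_mult[of "matrix ?D"]
    by (metis eq_iff_diff_eq_0 injD matrix_vector_mult_0_right)
  moreover have "ftangent d k e s = ?D ?v"
    unfolding ftangent_def using emap_edge_deriv[OF assms(1)] by (rule vector_derivative_at)
  ultimately show ?thesis using D by simp
qed

text \<open>The node permutation of \<open>facet_quadrature\<close> is absorbed into
  \<open>s\<close> and \<open>w\<close>, which belong to the chosen side of the facet.\<close>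

lemma facet_nodes:
  assumes "k < nel d" "\<gamma> \<in> facets d k"
  obtains e s w where "e < 3" "\<gamma> = lfacet d k e" "\<And>a. s a \<in> {0<..<1}" "\<And>a. w a > 0" "\<And>a. w a \<le> 1"
    "\<And>a. fnode d \<gamma> a = emap d k (redge e (s a))"
    "\<And>a. fwt d \<gamma> $ a = w a * norm (ftangent d k e (s a))"
    "\<And>a. nrm d \<gamma> k a = sgn (cw (ftangent d k e (s a)))"
proof -
  obtain e where e: "e < 3" "\<gamma> = lfacet d k e" using assms(2) by (auto simp: facets_def)
  obtain \<pi> where "\<forall>a. let \<gamma> = lfacet d k e; s = qnode d (\<pi> a) in
     fnode d \<gamma> a = emap d k (redge e s) \<and> fwt d \<gamma> $ a = qwt d (\<pi> a) * norm (ftangent d k e s) \<and>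
     nrm d \<gamma> k a = sgn (cw (ftangent d k e s))"
    using quad[OF assms(1) e(1)] unfolding facet_quadrature_def by blast
  then have q: "fnode d \<gamma> a = emap d k (redge e (qnode d (\<pi> a)))"
    "fwt d \<gamma> $ a = qwt d (\<pi> a) * norm (ftangent d k e (qnode d (\<pi> a)))"
    "nrm d \<gamma> k a = sgn (cw (ftangent d k e (qnode d (\<pi> a))))" for a
    unfolding e(2) Let_def by auto
  have pos: "0 < qnode d a" "qnode d a < 1" "qwt d a > 0" for a
    using gauss by (auto simp: gauss_rule_def)
  have "\<forall>m\<le>2 * p + 1. (\<Sum>a\<in>UNIV. qwt d a * qnode d a ^ m) = 1 / (real m + 1)"
    using gauss by (simp add: gauss_rule_def)
  \<comment> \<open>Exactness for the constant 1; with positivity it bounds each weight by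
    1.\<close>
  from this[rule_format, of 0] have "(\<Sum>a\<in>UNIV. qwt d a) = 1" by simp
  then have "qwt d a \<le> 1" for a
    using member_le_sum[of a UNIV "qwt d"] pos(3) by (simp add: less_imp_le)
  with that[OF e, of "qnode d \<circ> \<pi>" "qwt d \<circ> \<pi>"] q pos show thesis by simp
qed

lemma norm_nrm:
  assumes "k < nel d" "\<gamma> \<in> facets d k" shows "norm (nrm d \<gamma> k a) = 1"
proof (rule facet_nodes[OF assms])
  fix e s assume *: "e < 3" "\<And>a. s a \<in> {0<..<1::real}"
    and n: "\<And>a. nrm d \<gamma> k a = sgn (cw (ftangent d k e (s a)))"
  have "ftangent d k e (s a) \<noteq> 0" using *(2)[of a] by (intro ftangent_nonzero assms *) auto
  then show ?thesis unfolding n norm_sgn by (metis norm_cw norm_eq_zero)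
qed

text \<open>
  The parametrizations of a facet from its two sides run in opposite directions, so that the nodes
  correspond under \<open>s \<mapsto> 1 - s\<close>.
\<close>

lemma nrm_nb:
  assumes k: "k < nel d" and g: "\<gamma> \<in> ifacets d k"
  shows "nrm d \<gamma> (nb d k \<gamma>) a = - nrm d \<gamma> k a"
proof -
  let ?v = "nb d k \<gamma>"
  note v = nb[OF k g]
  obtain e s where e: "e < 3" "\<gamma> = lfacet d k e" "\<And>a. s a \<in> {0<..<1}"
    "\<And>a. fnode d \<gamma> a = emap d k (redge e (s a))" "\<And>a. nrm d \<gamma> k a = sgn (cw (ftangent d k e (s a)))"
    using facet_nodes[OF k ifacets_subset[OF g]] by metis
  obtain e' s' where e': "e' < 3" "\<gamma> = lfacet d ?v e'" "\<And>a. s' a \<in> {0<..<1}"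
    "\<And>a. fnode d \<gamma> a = emap d ?v (redge e' (s' a))"
    "\<And>a. nrm d \<gamma> ?v a = sgn (cw (ftangent d ?v e' (s' a)))"
    using facet_nodes[OF v(1) ifacets_subset[OF v(3)]] by metis
  have rev: "t \<in> {0..1} \<Longrightarrow> emap d k (redge e t) = emap d ?v (redge e' (1 - t))" for t
    using facet_reversed[OF k v(1) e(1) e'(1)] e(2) e'(2) v(2) by metis
  have s: "s a \<in> {0<..<1}" "s' a \<in> {0<..<1}" using e(3) e'(3) by auto
  have "emap d ?v (redge e' (1 - s a)) = emap d ?v (redge e' (s' a))"
    using rev[of "s a"] s e(4)[of a] e'(4)[of a] by simp
  moreover have "redge e' (1 - s a) \<in> ref_triangle" "redge e' (s' a) \<in> ref_triangle"
    using s by (auto intro!: redge_in)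
  ultimately have "redge e' (1 - s a) = redge e' (s' a)" using emap_inj[OF v(1)] by (meson inj_onD)
  then have "(1 - s a - s' a) *\<^sub>R (rvert (Suc e' mod 3) - rvert e') = 0"
    by (simp add: redge_def linepath_def algebra_simps)
  then have s': "s' a = 1 - s a" using rvert_neq[OF e'(1)] by auto
  have "((emap d ?v \<circ> redge e') has_vector_derivative ftangent d ?v e' (s' a)) (at (1 - s a))"
    using ftangent_deriv[OF v(1)] s' by metis
  moreover have "((\<lambda>t. 1 - t) has_vector_derivative - 1) (at (s a))"
    by (auto intro!: derivative_eq_intros)
  ultimately have "((emap d ?v \<circ> redge e') \<circ> (\<lambda>t. 1 - t) has_vector_derivative
      (- 1) *\<^sub>R ftangent d ?v e' (s' a)) (at (s a))"
    by (intro vector_diff_chain_at) auto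
  \<comment> \<open>The two parametrizations are only known to agree on the unit interval. This
    suffices for derivatives because Gauss nodes are interior points.\<close>
  then have "((emap d k \<circ> redge e) has_vector_derivative (- 1) *\<^sub>R ftangent d ?v e' (s' a)) (at (s a))"
    by (rule has_vector_derivative_transform_within_open[of _ _ _ "{0<..<1}"]) (use s rev in auto)
  from vector_derivative_unique_at[OF ftangent_deriv[OF k] this]
  have "ftangent d k e (s a) = - ftangent d ?v e' (s' a)" by simp
  then show ?thesis by (simp add: e(5) e'(5) cw_minus sgn_minus)
qed

end

subsection \<open>Conservation and stability\<close>

lemma uminus_mv: "(- A) *v x = - (A *v x)" for A :: "real^'m^'k"
  by (simp add: vec_eq_iff matrix_vector_mult_def sum_negf)

section \<open>Discrete vector fields, liftings and Green's identity\<close>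

context sbp_disc begin

definition grad_mv :: "nat \<Rightarrow> real^'n \<Rightarrow> real^'n^2" where
  "grad_mv k u = (\<chi> i. Dm d k i *v u)"

text \<open>Discrete counterpart of the integral of x . \<lambda> y for vector fields, each given by
  one nodal vector per space direction.\<close>

definition ip :: "nat \<Rightarrow> real^'n^2 \<Rightarrow> real^'n^2 \<Rightarrow> real" where
  "ip k x y = (\<Sum>i\<in>UNIV. \<Sum>j\<in>UNIV. x $ i \<bullet> (Hm d k *v (Lam pb d k i j *v y $ j)))"

text \<open>All blocks of H and \<Lambda> are diagonal, so the form decouples into the quadratic
  form of \<lambda> at each node; symmetry and positivity are inherited from there.\<close>

lemma ip_nodes: "ip k x y = (\<Sum>a\<in>UNIV. Hd d k $ a *
    ((\<chi> i. x $ i $ a) \<bullet> (lam pb (vnode d k a) *v (\<chi> i. y $ i $ a))))"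
proof -
  have "ip k x y = (\<Sum>i\<in>UNIV. \<Sum>j\<in>UNIV. \<Sum>a\<in>UNIV.
      Hd d k $ a * (x $ i $ a * (lam pb (vnode d k a) $ i $ j * y $ j $ a)))"
    by (simp add: ip_def inner_vec_def Hm_def Lam_def diagm_mv mult.left_commute)
  also have "\<dots> = (\<Sum>i\<in>UNIV. \<Sum>a\<in>UNIV. \<Sum>j\<in>UNIV.
      Hd d k $ a * (x $ i $ a * (lam pb (vnode d k a) $ i $ j * y $ j $ a)))"
    by (intro sum.cong refl sum.swap)
  also have "\<dots> = (\<Sum>a\<in>UNIV. \<Sum>i\<in>UNIV. \<Sum>j\<in>UNIV.
      Hd d k $ a * (x $ i $ a * (lam pb (vnode d k a) $ i $ j * y $ j $ a)))"
    by (rule sum.swap)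
  finally show ?thesis
    by (simp add: inner_vec_def matrix_vector_mult_def sum_distrib_left)
qed

lemma ip_diff_left: "ip k (x - y) z = ip k x z - ip k y z"
  and ip_diff_right: "ip k z (x - y) = ip k z x - ip k z y"
  and ip_scaleR_left: "ip k (c *\<^sub>R x) z = c * ip k x z"
  and ip_scaleR_right: "ip k z (c *\<^sub>R x) = c * ip k z x"
  and ip_add_left: "ip k (x + y) z = ip k x z + ip k y z"
  and ip_add_right: "ip k z (x + y) = ip k z x + ip k z y"
  and ip_zero: "ip k 0 z = 0" "ip k z 0 = 0"
  by (simp_all add: ip_def algebra_simps inner_simps sum_subtractf sum.distrib mv_scaleR
      sum_distrib_left matrix_vector_mult_diff_distrib matrix_vector_right_distrib)

lemma ip_sum_left: "ip k (\<Sum>s\<in>S. x s) z = (\<Sum>s\<in>S. ip k (x s) z)"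
  and ip_sum_right: "ip k z (\<Sum>s\<in>S. x s) = (\<Sum>s\<in>S. ip k z (x s))"
  by (induction S rule: infinite_finite_induct) (simp_all add: ip_zero ip_add_left ip_add_right)

lemma Hd_pos: "k < nel d \<Longrightarrow> Hd d k $ a > 0"
  and Dm_one: "k < nel d \<Longrightarrow> Dm d k i *v 1 = 0"
  and sbp_property: "k < nel d \<Longrightarrow> Hm d k ** Dm d k i + transpose (Hm d k ** Dm d k i) =
        (\<Sum>\<gamma>\<in>facets d k. transpose (Rm d \<gamma> k) ** Bm d \<gamma> ** Nm d \<gamma> k i ** Rm d \<gamma> k)"
  using sbp unfolding sbp_operators_def by auto

lemma vnode_in_dom: "k < nel d \<Longrightarrow> vnode d k a \<in> dom pb"
  using elem_Union rnode_in by (auto simp: vnode_def elem_def)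

lemma lam_symmetric: "x \<in> dom pb \<Longrightarrow> transpose (lam pb x) = lam pb x"
  and lam_pos: "x \<in> dom pb \<Longrightarrow> v \<bullet> (lam pb x *v v) \<ge> 0"
proof -
  have *: "\<forall>x\<in>dom pb. transpose (lam pb x) = lam pb x \<and> (\<forall>v. v \<noteq> 0 \<longrightarrow> v \<bullet> (lam pb x *v v) > 0)"
    using dp unfolding diffusion_problem_def by (elim conjE)
  show "x \<in> dom pb \<Longrightarrow> transpose (lam pb x) = lam pb x" using * by blast
  show "x \<in> dom pb \<Longrightarrow> v \<bullet> (lam pb x *v v) \<ge> 0"
    using * by (cases "v = 0") (auto intro: less_imp_le)
qed

lemma ip_commute:
  assumes "k < nel d" shows "ip k x y = ip k y x"
proof -
  have "v \<bullet> (lam pb z *v w) = w \<bullet> (lam pb z *v v)" if "z \<in> dom pb" for v w z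
    using lam_symmetric[OF that] by (metis inner_commute inner_mv_left)
  then show ?thesis unfolding ip_nodes using vnode_in_dom[OF assms] by simp
qed

lemma ip_nonneg: "k < nel d \<Longrightarrow> ip k x x \<ge> 0"
  unfolding ip_nodes by (intro sum_nonneg mult_nonneg_nonneg lam_pos vnode_in_dom) (auto intro: less_imp_le Hd_pos)

lemma Hinv_eq: "k < nel d \<Longrightarrow> Hinv d k = diagm (\<chi> a. 1 / Hd d k $ a)"
  unfolding Hinv_def Hm_def using Hd_pos by (intro matrix_inv_diagm) (metis less_irrefl)

lemma Hm_Hinv:
  assumes "k < nel d" shows "Hm d k *v (Hinv d k *v x) = x"
proof -
  have "Hd d k $ a \<noteq> 0" for a using Hd_pos[OF assms, of a] by simp
  then show ?thesis by (simp add: Hinv_eq[OF assms] Hm_def vec_eq_iff diagm_mv)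
qed

lemma Hm_inner: "(Hm d k *v x) \<bullet> y = x \<bullet> (Hm d k *v y)"
  and Bm_inner: "(Bm d \<gamma> *v z) \<bullet> w = z \<bullet> (Bm d \<gamma> *v w)"
  and Nm_inner: "(Nm d \<gamma> k i *v z) \<bullet> w = z \<bullet> (Nm d \<gamma> k i *v w)"
  by (simp_all add: Hm_def Bm_def Nm_def inner_mv_left)

text \<open>The lifting operator of discontinuous Galerkin methods. Unlike in
  \<open>ldg_lift\<close> the factor \<Lambda> is absent, since \<open>ip\<close> supplies
  it.\<close>

definition lift :: "nat \<Rightarrow> facet \<Rightarrow> real^'f \<Rightarrow> real^'n^2" where
  "lift k \<gamma> r = (\<chi> i. Hinv d k *v (transpose (Rm d \<gamma> k) *v (Nm d \<gamma> k i *v (Bm d \<gamma> *v r))))"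

lemma Dg_mv: "Dg pb d \<gamma> k *v u = (\<Sum>i\<in>UNIV. \<Sum>j\<in>UNIV.
    Nm d \<gamma> k i *v (Rm d \<gamma> k *v (Lam pb d k i j *v (Dm d k j *v u))))"
  by (simp add: Dg_def matrix_sum_mv matrix_vector_mul_assoc matrix_mul_assoc)

lemma Ups_mv: "Ups pb d a b k *v u = (\<Sum>i\<in>UNIV. \<Sum>j\<in>UNIV.
    Nm d a k i *v (Rm d a k *v (Hinv d k *v (Lam pb d k i j *v (transpose (Rm d b k) *v (Nm d b k j *v u))))))"
  by (simp add: Ups_def matrix_sum_mv matrix_vector_mul_assoc matrix_mul_assoc)

text \<open>The norm matrix in \<open>ip\<close> cancels the \<open>Hinv\<close> of the lifting,
  which leaves a pairing on the facet.\<close>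

lemma ip_lift_left:
  assumes k: "k < nel d"
  shows "ip k (lift k \<gamma> r) y =
    (\<Sum>i\<in>UNIV. \<Sum>j\<in>UNIV. r \<bullet> (Bm d \<gamma> *v (Nm d \<gamma> k i *v (Rm d \<gamma> k *v (Lam pb d k i j *v y $ j)))))"
proof -
  have "(Hinv d k *v (transpose (Rm d \<gamma> k) *v w)) \<bullet> (Hm d k *v z) = w \<bullet> (Rm d \<gamma> k *v z)" for w z
  proof -
    have "(Hinv d k *v (transpose (Rm d \<gamma> k) *v w)) \<bullet> (Hm d k *v z) = (transpose (Rm d \<gamma> k) *v w) \<bullet> z"
      by (simp add: Hm_inner[symmetric] Hm_Hinv[OF k])
    then show ?thesis by (simp add: dot_lmul_matrix)
  qed
  then show ?thesis by (simp add: ip_def lift_def Bm_inner[symmetric] Nm_inner[symmetric])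
qed

text \<open>Turns the coupling of a jump with the normal flux into an inner product on the element,
  where squares can be completed.\<close>

lemma ip_lift_grad:
  "k < nel d \<Longrightarrow> ip k (lift k \<gamma> r) (grad_mv k u) = r \<bullet> (Bm d \<gamma> *v (Dg pb d \<gamma> k *v u))"
  by (simp add: ip_lift_left Dg_mv grad_mv_def inner_sum_right matrix_mv_sum)

text \<open>Identifies \<open>Ups\<close>, between two factors \<open>Bm\<close>, as the Gram matrix
  of the liftings. The order of \<open>Hinv\<close> and \<Lambda> is interchanged on the way, which
  is possible since both are diagonal.\<close>

lemma ip_lift_lift:
  assumes "k < nel d"
  shows "ip k (lift k \<gamma> r) (lift k \<epsilon> s) = r \<bullet> (Bm d \<gamma> *v (Ups pb d \<gamma> \<epsilon> k *v (Bm d \<epsilon> *v s)))"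
proof -
  have "Lam pb d k i j *v (Hinv d k *v x) = Hinv d k *v (Lam pb d k i j *v x)" for i j x
    by (simp add: Lam_def Hinv_eq[OF assms] matrix_vector_mul_assoc diagm_commute)
  then show ?thesis
    unfolding ip_lift_left[OF assms] by (simp add: Ups_mv lift_def inner_sum_right matrix_mv_sum)
qed

text \<open>The summation-by-parts property is a discrete divergence theorem. Applied to the
  components of \<Lambda> D u it gives Green's identity, with \<open>Dg\<close> as the normal
  flux.\<close>

lemma D2_by_parts:
  assumes k: "k < nel d"
  shows "v \<bullet> (Hm d k *v (D2 pb d k *v u)) =
    (\<Sum>\<gamma>\<in>facets d k. (Rm d \<gamma> k *v v) \<bullet> (Bm d \<gamma> *v (Dg pb d \<gamma> k *v u))) - ip k (grad_mv k v) (grad_mv k u)"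
proof -
  have parts: "v \<bullet> (Hm d k *v (Dm d k i *v z)) =
      (\<Sum>\<gamma>\<in>facets d k. (Rm d \<gamma> k *v v) \<bullet> (Bm d \<gamma> *v (Nm d \<gamma> k i *v (Rm d \<gamma> k *v z))))
      - (Dm d k i *v v) \<bullet> (Hm d k *v z)" for i z
  proof -
    have "v \<bullet> ((Hm d k ** Dm d k i + transpose (Hm d k ** Dm d k i)) *v z) =
        v \<bullet> (Hm d k *v (Dm d k i *v z)) + (Dm d k i *v v) \<bullet> (Hm d k *v z)"
      by (simp add: matrix_vector_mult_add_rdistrib inner_add_right inner_mv_right Hm_inner del: transpose_matrix_vector)
        (simp add: matrix_vector_mul_assoc[symmetric] Hm_inner)
    moreover have "v \<bullet> ((\<Sum>\<gamma>\<in>facets d k. transpose (Rm d \<gamma> k) ** Bm d \<gamma> ** Nm d \<gamma> k i ** Rm d \<gamma> k) *v z) =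
      (\<Sum>\<gamma>\<in>facets d k. (Rm d \<gamma> k *v v) \<bullet> (Bm d \<gamma> *v (Nm d \<gamma> k i *v (Rm d \<gamma> k *v z))))"
      by (simp add: matrix_sum_mv inner_sum_right matrix_vector_mul_assoc[symmetric] inner_mv_right
          del: transpose_matrix_vector)
    ultimately show ?thesis by (simp add: sbp_property[OF k])
  qed
  have "v \<bullet> (Hm d k *v (D2 pb d k *v u)) = (\<Sum>i\<in>UNIV. \<Sum>j\<in>UNIV.
      v \<bullet> (Hm d k *v (Dm d k i *v (Lam pb d k i j *v (Dm d k j *v u)))))"
    by (simp add: D2_def matrix_sum_mv matrix_mv_sum inner_sum_right matrix_vector_mul_assoc matrix_mul_assoc)
  also have "\<dots> = (\<Sum>i\<in>UNIV. \<Sum>j\<in>UNIV. \<Sum>\<gamma>\<in>facets d k. (Rm d \<gamma> k *v v) \<bullet>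
      (Bm d \<gamma> *v (Nm d \<gamma> k i *v (Rm d \<gamma> k *v (Lam pb d k i j *v (Dm d k j *v u))))))
      - ip k (grad_mv k v) (grad_mv k u)"
    by (simp add: parts sum_subtractf ip_def grad_mv_def)
  also have "(\<Sum>i\<in>UNIV. \<Sum>j\<in>UNIV. \<Sum>\<gamma>\<in>facets d k. (Rm d \<gamma> k *v v) \<bullet>
      (Bm d \<gamma> *v (Nm d \<gamma> k i *v (Rm d \<gamma> k *v (Lam pb d k i j *v (Dm d k j *v u)))))) =
      (\<Sum>\<gamma>\<in>facets d k. (Rm d \<gamma> k *v v) \<bullet> (Bm d \<gamma> *v (Dg pb d \<gamma> k *v u)))"
    unfolding Dg_mv matrix_mv_sum inner_sum_right
    by (simp add: sum.swap[of _ _ "facets d k"])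
  finally show ?thesis .
qed

lemma Rm_one:
  assumes "k < nel d" "\<gamma> \<in> facets d k"
  shows "Rm d \<gamma> k *v 1 = 1"
proof -
  have "\<forall>\<gamma>\<in>facets d k. \<forall>a i j. i + j \<le> p \<longrightarrow>
        (let z = inv_into ref_triangle (emap d k) (fnode d \<gamma> a) in
         (\<Sum>b\<in>UNIV. Rm d \<gamma> k $ a $ b * ((rnode d b $ 1)^i * (rnode d b $ 2)^j)) = (z $ 1)^i * (z $ 2)^j)"
    using sbp[OF assms(1)] unfolding sbp_operators_def by (elim conjE)
  from this[rule_format, OF assms(2), of 0 0] show ?thesis
    by (simp add: vec_eq_iff matrix_vector_mult_def)
qed

lemma Dg_one: "k < nel d \<Longrightarrow> Dg pb d \<gamma> k *v 1 = 0"
  by (simp add: Dg_mv Dm_one)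

lemma alpha_le_1:
  assumes "k < nel d" "\<gamma> \<in> facets d k" shows "alpha d \<gamma> k \<le> 1"
  using member_le_sum[OF assms(2), of "\<lambda>\<gamma>. alpha d \<gamma> k"] alpha_pos[OF assms(1)] alpha_sum[OF assms(1)]
  by (simp add: less_imp_le)

end

section \<open>The penalty coefficients and the symmetric form of the scheme\<close>

locale ldg_disc = sbp_disc p pb d for p pb and d :: "('n::finite, 'f::finite) disc" +
  fixes g :: "real^2" and T :: "'f penalty"
  assumes sw: "switches g d" and sat: "ldg_sat pb d T"
begin

text \<open>The sign rule makes the switch of one side 0 or 1, and the sum condition fixes the
  other. Most identities between coefficients are checked by this case split.\<close>

lemma beta_cases:
  assumes "k < nel d" "\<gamma> \<in> ifacets d k"
  shows "beta d \<gamma> k = 1 \<and> beta d \<gamma> (nb d k \<gamma>) = 0 \<or> beta d \<gamma> k = 0 \<and> beta d \<gamma> (nb d k \<gamma>) = 1"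
proof -
  obtain e where e: "e < 3" "\<gamma> = lfacet d k e" using ifacets_subset[OF assms(2)] by (auto simp: facets_def)
  have "beta d \<gamma> k + beta d \<gamma> (nb d k \<gamma>) = 1 \<and> (beta d \<gamma> k = 1 \<or> beta d \<gamma> k = 0)"
    using sw[unfolded switches_def, rule_format, OF assms(1) e(1)] assms(2)
    unfolding e(2)[symmetric] Let_def by (simp split: if_splits)
  then show ?thesis by auto
qed

text \<open>As the two switches add up to 1, the expression 1 + beta_k - beta_v is twice beta_k.
  This yields the 2 in \<open>T1\<close>, the bare switches in \<open>T2\<close> and
  \<open>T3\<close>, and 4/16 = 1/4 in \<open>T5\<close>. The conditions on the facets \<delta> of
  the neighbour are those on \<epsilon> with the sides exchanged.\<close>

lemma sat_interior:
  assumes "k < nel d" "\<gamma> \<in> ifacets d k"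
  defines "v \<equiv> nb d k \<gamma>"
  shows "T1 T \<gamma> k = Bm d \<gamma> ** ((2 * beta d \<gamma> k / alpha d \<gamma> k) *\<^sub>R Ups pb d \<gamma> \<gamma> k
                    + (2 * beta d \<gamma> v / alpha d \<gamma> v) *\<^sub>R Ups pb d \<gamma> \<gamma> v) ** Bm d \<gamma>" (is ?A)
    and "T2 T \<gamma> k = (- beta d \<gamma> k) *\<^sub>R Bm d \<gamma>" (is ?B)
    and "T3 T \<gamma> k = beta d \<gamma> v *\<^sub>R Bm d \<gamma>" (is ?C)
    and "T4 T \<gamma> k = 0" (is ?D)
    and "\<epsilon> \<in> ifacets d k \<Longrightarrow> \<epsilon> \<noteq> \<gamma> \<Longrightarrow> T5 T \<gamma> \<epsilon> k =
      (beta d \<gamma> k * beta d \<epsilon> k / 4) *\<^sub>R (Bm d \<gamma> ** Ups pb d \<gamma> \<epsilon> k ** Bm d \<epsilon>)" (is "_ \<Longrightarrow> _ \<Longrightarrow> ?E")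
    and "\<epsilon> \<in> ifacets d k \<Longrightarrow> \<epsilon> \<noteq> \<gamma> \<Longrightarrow> T6 T \<gamma> \<epsilon> k = - T5 T \<gamma> \<epsilon> k" (is "_ \<Longrightarrow> _ \<Longrightarrow> ?F")
proof -
  note s = conjunct1[OF sat[unfolded ldg_sat_def], rule_format, OF assms(1,2), unfolded Let_def, folded v_def]
  note bc = beta_cases[OF assms(1,2), folded v_def]
  from s bc show ?A by (elim conjE) auto
  from s bc show ?B by (elim conjE) auto
  from s bc show ?C by (elim conjE) auto
  from s show ?D by (elim conjE)
  assume e: "\<epsilon> \<in> ifacets d k" "\<epsilon> \<noteq> \<gamma>"
  from s e have *: "T5 T \<gamma> \<epsilon> k = ((1 + beta d \<gamma> k - beta d \<gamma> v) * (1 + beta d \<epsilon> k - beta d \<epsilon> (nb d k \<epsilon>)) / 16)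
      *\<^sub>R (Bm d \<gamma> ** Ups pb d \<gamma> \<epsilon> k ** Bm d \<epsilon>)" "- T6 T \<gamma> \<epsilon> k = T5 T \<gamma> \<epsilon> k"
    by (elim conjE, simp)+
  show ?E unfolding * using bc beta_cases[OF assms(1) e(1)] by auto
  show ?F using *(2) by (metis add.inverse_inverse)
qed

lemma sat_dirichlet:
  "k < nel d \<Longrightarrow> \<gamma> \<in> dfacets pb d k \<Longrightarrow>
    TD T \<gamma> = (1 / alpha d \<gamma> k) *\<^sub>R (Bm d \<gamma> ** Ups pb d \<gamma> \<gamma> k ** Bm d \<gamma>)"
  using conjunct2[OF sat[unfolded ldg_sat_def]] by blast

lemma T1_nb:
  assumes "k < nel d" "\<gamma> \<in> ifacets d k" shows "T1 T \<gamma> (nb d k \<gamma>) = T1 T \<gamma> k"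
  using sat_interior(1)[OF assms] sat_interior(1)[OF nb(1,3)[OF assms]]
  by (simp add: nb(4)[OF assms] add.commute)

lemma jmp_nb: "k < nel d \<Longrightarrow> \<gamma> \<in> ifacets d k \<Longrightarrow> jmp d u \<gamma> (nb d k \<gamma>) = - jmp d u \<gamma> k"
  and djmp_nb: "k < nel d \<Longrightarrow> \<gamma> \<in> ifacets d k \<Longrightarrow> djmp pb d u \<gamma> (nb d k \<gamma>) = djmp pb d u \<gamma> k"
  by (simp_all add: jmp_def djmp_def nb)

lemma T6_nb:
  assumes "k < nel d" "\<gamma> \<in> ifacets d k" "\<delta> \<in> ifacets d (nb d k \<gamma>) - {\<gamma>}"
  shows "T6 T \<gamma> \<delta> (nb d k \<gamma>) = - T5 T \<gamma> \<delta> (nb d k \<gamma>)"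
  using sat_interior(6)[OF nb(1,3)[OF assms(1,2)]] assms(3) by auto

text \<open>With complementary switches, \<open>T2 + Bm\<close> and minus the neighbour's
  \<open>T2\<close> both equal \<open>T3\<close>, while \<open>T3 - Bm\<close> and minus the
  neighbour's \<open>T3\<close> both equal \<open>T2\<close>. Besides, \<open>T1\<close> agrees on
  both sides, \<open>T4\<close> vanishes and \<open>T6 = - T5\<close>.\<close>

lemma sI_adj_eq:
  assumes k: "k < nel d" shows "sI_adj pb d T \<psi> k = sI pb d T \<psi> k"
proof -
  have "T1 T \<gamma> k *v (Rm d \<gamma> k *v \<psi> k) - T1 T \<gamma> (nb d k \<gamma>) *v (Rm d \<gamma> (nb d k \<gamma>) *v \<psi> (nb d k \<gamma>))
      + (T2 T \<gamma> k + Bm d \<gamma>) *v (Dg pb d \<gamma> k *v \<psi> k)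
      - T2 T \<gamma> (nb d k \<gamma>) *v (Dg pb d \<gamma> (nb d k \<gamma>) *v \<psi> (nb d k \<gamma>)) =
      T1 T \<gamma> k *v jmp d \<psi> \<gamma> k + T3 T \<gamma> k *v djmp pb d \<psi> \<gamma> k" (is ?A)
    "(T3 T \<gamma> k - Bm d \<gamma>) *v (Rm d \<gamma> k *v \<psi> k) + T3 T \<gamma> (nb d k \<gamma>) *v (Rm d \<gamma> (nb d k \<gamma>) *v \<psi> (nb d k \<gamma>))
      + T4 T \<gamma> k *v (Dg pb d \<gamma> k *v \<psi> k) + T4 T \<gamma> (nb d k \<gamma>) *v (Dg pb d \<gamma> (nb d k \<gamma>) *v \<psi> (nb d k \<gamma>)) =
      T2 T \<gamma> k *v jmp d \<psi> \<gamma> k + T4 T \<gamma> k *v djmp pb d \<psi> \<gamma> k" (is ?B)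
    if g: "\<gamma> \<in> ifacets d k" for \<gamma>
  proof -
    note S = sat_interior(2-4)[OF k g] sat_interior(2-4)[OF nb(1,3)[OF k g]]
    show ?A ?B
      unfolding T1_nb[OF k g] S nb(4)[OF k g] jmp_def djmp_def
      using beta_cases[OF k g]
      by (auto simp: scaleR_mv uminus_mv matrix_vector_mult_diff_distrib matrix_vector_right_distrib)
  qed
  moreover have "(\<Sum>\<epsilon>\<in>ifacets d k - {\<gamma>}. transpose (Rm d \<gamma> k) *v
      (T5 T \<gamma> \<epsilon> k *v (Rm d \<epsilon> k *v \<psi> k) + T6 T \<gamma> \<epsilon> k *v (Rm d \<epsilon> (nb d k \<epsilon>) *v \<psi> (nb d k \<epsilon>)))) =
      (\<Sum>\<epsilon>\<in>ifacets d k - {\<gamma>}. transpose (Rm d \<gamma> k) *v (T5 T \<gamma> \<epsilon> k *v jmp d \<psi> \<epsilon> k))"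
    if "\<gamma> \<in> ifacets d k" for \<gamma>
    by (intro sum.cong refl)
      (use sat_interior(6)[OF k that] in \<open>simp add: jmp_def matrix_vector_mult_diff_distrib uminus_mv\<close>)
  moreover have "(\<Sum>\<delta>\<in>ifacets d (nb d k \<gamma>) - {\<gamma>}. transpose (Rm d \<gamma> k) *v
      (T5 T \<gamma> \<delta> (nb d k \<gamma>) *v (Rm d \<delta> (nb d k \<gamma>) *v \<psi> (nb d k \<gamma>))
      + T6 T \<gamma> \<delta> (nb d k \<gamma>) *v (Rm d \<delta> (nb d (nb d k \<gamma>) \<delta>) *v \<psi> (nb d (nb d k \<gamma>) \<delta>)))) =
      - (\<Sum>\<delta>\<in>ifacets d (nb d k \<gamma>) - {\<gamma>}. transpose (Rm d \<gamma> k) *v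
          (T6 T \<gamma> \<delta> (nb d k \<gamma>) *v jmp d \<psi> \<delta> (nb d k \<gamma>)))"
    if "\<gamma> \<in> ifacets d k" for \<gamma>
    unfolding sum_negf[symmetric]
    by (intro sum.cong refl)
      (use T6_nb[OF k that] in \<open>simp add: jmp_def matrix_vector_mult_diff_distrib uminus_mv vec.neg
        del: transpose_matrix_vector\<close>)
  ultimately show ?thesis
    unfolding sI_adj_def sI_def Let_def by (simp del: transpose_matrix_vector cong: sum.cong)
qed

lemma Lh_adj_eq: "k < nel d \<Longrightarrow> Lh_adj pb d T \<psi>b \<zeta>b \<psi> k = Lh pb d T \<psi>b \<zeta>b \<psi> k"
  by (simp add: Lh_adj_def Lh_def sI_adj_eq)


text \<open>\<open>v\<close> is the test function and \<open>u\<close> the trial function: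
  \<open>v\<close> is constant for conservation and equals \<open>u\<close> for the energy.\<close>

definition interior_form :: "(nat \<Rightarrow> real^'n) \<Rightarrow> (nat \<Rightarrow> real^'n) \<Rightarrow> nat \<Rightarrow> real" where
  "interior_form v u k =
    (\<Sum>\<gamma>\<in>ifacets d k. beta d \<gamma> k *
      (jmp d v \<gamma> k \<bullet> (Bm d \<gamma> *v (Dg pb d \<gamma> k *v u k)) + (Dg pb d \<gamma> k *v v k) \<bullet> (Bm d \<gamma> *v jmp d u \<gamma> k)
       - 2 / alpha d \<gamma> k * (jmp d v \<gamma> k \<bullet> (Bm d \<gamma> *v (Ups pb d \<gamma> \<gamma> k *v (Bm d \<gamma> *v jmp d u \<gamma> k))))))
    - (\<Sum>\<gamma>\<in>ifacets d k. \<Sum>\<epsilon>\<in>ifacets d k - {\<gamma>}. beta d \<gamma> k * beta d \<epsilon> k / 4 *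
        (jmp d v \<gamma> k \<bullet> (Bm d \<gamma> *v (Ups pb d \<gamma> \<epsilon> k *v (Bm d \<epsilon> *v jmp d u \<epsilon> k)))))"

text \<open>
  Collecting both sides of every interior facet, only the side with switch 1 contributes the
  symmetric coupling between jump and flux.
\<close>

lemma interior_sum:
  "(\<Sum>k<nel d. (\<Sum>\<gamma>\<in>ifacets d k. (Rm d \<gamma> k *v v k) \<bullet> (Bm d \<gamma> *v (Dg pb d \<gamma> k *v u k))) - v k \<bullet> sI pb d T u k) =
   (\<Sum>k<nel d. interior_form v u k)"
proof -
  \<comment> \<open>\<open>G\<close> is what one side of a facet contributes through this facet,
    including the flux left by summation by parts, and \<open>A\<close> is its target.
    \<open>K\<close> and \<open>L\<close> are the couplings to the other facets of the element and
    of the neighbour.\<close>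
  define G where "G k \<gamma> = (Rm d \<gamma> k *v v k) \<bullet> (Bm d \<gamma> *v (Dg pb d \<gamma> k *v u k))
    - (Rm d \<gamma> k *v v k) \<bullet> (T1 T \<gamma> k *v jmp d u \<gamma> k + T3 T \<gamma> k *v djmp pb d u \<gamma> k)
    - (Dg pb d \<gamma> k *v v k) \<bullet> (T2 T \<gamma> k *v jmp d u \<gamma> k + T4 T \<gamma> k *v djmp pb d u \<gamma> k)" for k \<gamma>
  define A where "A k \<gamma> = beta d \<gamma> k *
      (jmp d v \<gamma> k \<bullet> (Bm d \<gamma> *v (Dg pb d \<gamma> k *v u k)) + (Dg pb d \<gamma> k *v v k) \<bullet> (Bm d \<gamma> *v jmp d u \<gamma> k)
       - 2 / alpha d \<gamma> k * (jmp d v \<gamma> k \<bullet> (Bm d \<gamma> *v (Ups pb d \<gamma> \<gamma> k *v (Bm d \<gamma> *v jmp d u \<gamma> k)))))" for k \<gamma>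
  define K where "K k \<gamma> = (\<Sum>\<epsilon>\<in>ifacets d k - {\<gamma>}. (Rm d \<gamma> k *v v k) \<bullet> (T5 T \<gamma> \<epsilon> k *v jmp d u \<epsilon> k))" for k \<gamma>
  define L where "L k \<gamma> = (\<Sum>\<delta>\<in>ifacets d (nb d k \<gamma>) - {\<gamma>}.
    (Rm d \<gamma> k *v v k) \<bullet> (T6 T \<gamma> \<delta> (nb d k \<gamma>) *v jmp d u \<delta> (nb d k \<gamma>)))" for k \<gamma>
  have sI: "v k \<bullet> sI pb d T u k = (\<Sum>\<gamma>\<in>ifacets d k.
      (Rm d \<gamma> k *v v k) \<bullet> (T1 T \<gamma> k *v jmp d u \<gamma> k + T3 T \<gamma> k *v djmp pb d u \<gamma> k) +
      (Dg pb d \<gamma> k *v v k) \<bullet> (T2 T \<gamma> k *v jmp d u \<gamma> k + T4 T \<gamma> k *v djmp pb d u \<gamma> k)) +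
      (\<Sum>\<gamma>\<in>ifacets d k. K k \<gamma> + L k \<gamma>)" for k
    unfolding sI_def Let_def K_def L_def
    by (simp only: inner_add_right inner_sum_right inner_mv_right)
  have own: "(\<Sum>k<nel d. \<Sum>\<gamma>\<in>ifacets d k. G k \<gamma>) = (\<Sum>k<nel d. \<Sum>\<gamma>\<in>ifacets d k. A k \<gamma>)"
  proof -
    \<comment> \<open>Only the two sides together match. The flux of the side with switch 0 cancels
      against a \<open>T3\<close> term, and the flux of the side with switch 1 gets paired with the
      full jump of \<open>v\<close>.\<close>
    have "G k \<gamma> + G (nb d k \<gamma>) \<gamma> = A k \<gamma> + A (nb d k \<gamma>) \<gamma>" if k: "k < nel d" and g: "\<gamma> \<in> ifacets d k" for k \<gamma>
    proof -
      note S = sat_interior(1-4)[OF k g] sat_interior(1-4)[OF nb(1,3)[OF k g], unfolded nb(4)[OF k g]]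
      note N = nb[OF k g] jmp_nb[OF k g] djmp_nb[OF k g]
      have T1v: "T1 T \<gamma> k *v y = (2 * beta d \<gamma> k / alpha d \<gamma> k) *\<^sub>R (Bm d \<gamma> *v (Ups pb d \<gamma> \<gamma> k *v (Bm d \<gamma> *v y)))
        + (2 * beta d \<gamma> (nb d k \<gamma>) / alpha d \<gamma> (nb d k \<gamma>)) *\<^sub>R
          (Bm d \<gamma> *v (Ups pb d \<gamma> \<gamma> (nb d k \<gamma>) *v (Bm d \<gamma> *v y)))" for y
        unfolding S(1)
        by (simp add: matrix_vector_mul_assoc[symmetric] matrix_vector_mult_add_rdistrib
            matrix_vector_right_distrib scaleR_mv mv_scaleR)
      have T1v': "(Rm d \<gamma> k *v v k) \<bullet> (T1 T \<gamma> k *v jmp d u \<gamma> k)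
          - (Rm d \<gamma> (nb d k \<gamma>) *v v (nb d k \<gamma>)) \<bullet> (T1 T \<gamma> k *v jmp d u \<gamma> k) =
          jmp d v \<gamma> k \<bullet> (T1 T \<gamma> k *v jmp d u \<gamma> k)"
        by (simp add: jmp_def inner_diff_left)
      have "G k \<gamma> + G (nb d k \<gamma>) \<gamma> =
        (Rm d \<gamma> k *v v k) \<bullet> (Bm d \<gamma> *v (Dg pb d \<gamma> k *v u k))
        + (Rm d \<gamma> (nb d k \<gamma>) *v v (nb d k \<gamma>)) \<bullet> (Bm d \<gamma> *v (Dg pb d \<gamma> (nb d k \<gamma>) *v u (nb d k \<gamma>)))
        - jmp d v \<gamma> k \<bullet> (T1 T \<gamma> k *v jmp d u \<gamma> k)
        - beta d \<gamma> (nb d k \<gamma>) * ((Rm d \<gamma> k *v v k) \<bullet> (Bm d \<gamma> *v djmp pb d u \<gamma> k))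
        - beta d \<gamma> k * ((Rm d \<gamma> (nb d k \<gamma>) *v v (nb d k \<gamma>)) \<bullet> (Bm d \<gamma> *v djmp pb d u \<gamma> k))
        + beta d \<gamma> k * ((Dg pb d \<gamma> k *v v k) \<bullet> (Bm d \<gamma> *v jmp d u \<gamma> k))
        - beta d \<gamma> (nb d k \<gamma>) * ((Dg pb d \<gamma> (nb d k \<gamma>) *v v (nb d k \<gamma>)) \<bullet> (Bm d \<gamma> *v jmp d u \<gamma> k))"
        unfolding G_def T1_nb[OF k g] S(2-4,6-8) N T1v'[symmetric]
        by (simp add: scaleR_mv uminus_mv inner_simps vec.neg)
      also have "\<dots> = A k \<gamma> + A (nb d k \<gamma>) \<gamma>"
        unfolding T1v A_def N using beta_cases[OF k g]
        by (auto simp: jmp_def djmp_def vec.neg matrix_vector_mult_diff_distrib matrix_vector_right_distrib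
            inner_simps algebra_simps)
      finally show ?thesis .
    qed
    then have "(\<Sum>k<nel d. \<Sum>\<gamma>\<in>ifacets d k. G k \<gamma> + G (nb d k \<gamma>) \<gamma>) =
        (\<Sum>k<nel d. \<Sum>\<gamma>\<in>ifacets d k. A k \<gamma> + A (nb d k \<gamma>) \<gamma>)"
      by (intro sum.cong) auto
    then show ?thesis
      unfolding sum.distrib sum_swap_sides[of G, symmetric] sum_swap_sides[of A, symmetric] by simp
  qed
  \<comment> \<open>Moving \<open>L\<close> across the facet places it on the element whose other
    facets carry the jumps. There \<open>T6 = - T5\<close> joins the two traces of \<open>v\<close>
    to a jump.\<close>
  have "(\<Sum>k<nel d. \<Sum>\<gamma>\<in>ifacets d k. K k \<gamma> + L k \<gamma>) =
      (\<Sum>k<nel d. \<Sum>\<gamma>\<in>ifacets d k. K k \<gamma> + L (nb d k \<gamma>) \<gamma>)"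
    unfolding sum.distrib using sum_swap_sides[of L] by simp
  also have "\<dots> = (\<Sum>k<nel d. \<Sum>\<gamma>\<in>ifacets d k. \<Sum>\<epsilon>\<in>ifacets d k - {\<gamma>}. beta d \<gamma> k * beta d \<epsilon> k / 4 *
        (jmp d v \<gamma> k \<bullet> (Bm d \<gamma> *v (Ups pb d \<gamma> \<epsilon> k *v (Bm d \<epsilon> *v jmp d u \<epsilon> k)))))"
  proof (intro sum.cong refl)
    fix k \<gamma> assume "k \<in> {..<nel d}" and g: "\<gamma> \<in> ifacets d k"
    then have k: "k < nel d" by simp
    have "K k \<gamma> + L (nb d k \<gamma>) \<gamma> = (\<Sum>\<epsilon>\<in>ifacets d k - {\<gamma>}. (Rm d \<gamma> k *v v k) \<bullet> (T5 T \<gamma> \<epsilon> k *v jmp d u \<epsilon> k)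
      + (Rm d \<gamma> (nb d k \<gamma>) *v v (nb d k \<gamma>)) \<bullet> (T6 T \<gamma> \<epsilon> k *v jmp d u \<epsilon> k))"
      unfolding K_def L_def nb(4)[OF k g] sum.distrib ..
    also have "\<dots> = (\<Sum>\<epsilon>\<in>ifacets d k - {\<gamma>}. beta d \<gamma> k * beta d \<epsilon> k / 4 *
        (jmp d v \<gamma> k \<bullet> (Bm d \<gamma> *v (Ups pb d \<gamma> \<epsilon> k *v (Bm d \<epsilon> *v jmp d u \<epsilon> k)))))"
    proof (intro sum.cong refl)
      fix \<epsilon> assume e: "\<epsilon> \<in> ifacets d k - {\<gamma>}"
      then have e': "\<epsilon> \<in> ifacets d k" "\<epsilon> \<noteq> \<gamma>" by auto
      have "(Rm d \<gamma> k *v v k) \<bullet> (T5 T \<gamma> \<epsilon> k *v jmp d u \<epsilon> k)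
        + (Rm d \<gamma> (nb d k \<gamma>) *v v (nb d k \<gamma>)) \<bullet> (T6 T \<gamma> \<epsilon> k *v jmp d u \<epsilon> k) =
        jmp d v \<gamma> k \<bullet> (T5 T \<gamma> \<epsilon> k *v jmp d u \<epsilon> k)"
        unfolding sat_interior(6)[OF k g e'] uminus_mv jmp_def[of d v] by (simp add: inner_diff_left)
      then show "(Rm d \<gamma> k *v v k) \<bullet> (T5 T \<gamma> \<epsilon> k *v jmp d u \<epsilon> k)
        + (Rm d \<gamma> (nb d k \<gamma>) *v v (nb d k \<gamma>)) \<bullet> (T6 T \<gamma> \<epsilon> k *v jmp d u \<epsilon> k) =
        beta d \<gamma> k * beta d \<epsilon> k / 4 *
        (jmp d v \<gamma> k \<bullet> (Bm d \<gamma> *v (Ups pb d \<gamma> \<epsilon> k *v (Bm d \<epsilon> *v jmp d u \<epsilon> k))))"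
        unfolding sat_interior(5)[OF k g e'] by (simp add: scaleR_mv matrix_vector_mul_assoc matrix_mul_assoc)
    qed
    finally show "K k \<gamma> + L (nb d k \<gamma>) \<gamma> = \<dots>" .
  qed
  finally have cross: "(\<Sum>k<nel d. \<Sum>\<gamma>\<in>ifacets d k. K k \<gamma> + L k \<gamma>) = \<dots>" .
  have "(\<Sum>k<nel d. (\<Sum>\<gamma>\<in>ifacets d k. (Rm d \<gamma> k *v v k) \<bullet> (Bm d \<gamma> *v (Dg pb d \<gamma> k *v u k))) - v k \<bullet> sI pb d T u k) =
      (\<Sum>k<nel d. \<Sum>\<gamma>\<in>ifacets d k. G k \<gamma>) - (\<Sum>k<nel d. \<Sum>\<gamma>\<in>ifacets d k. K k \<gamma> + L k \<gamma>)"
    unfolding sI G_def by (simp add: sum_subtractf sum.distrib)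
  then show ?thesis unfolding own cross interior_form_def A_def by (simp add: sum_subtractf)
qed

text \<open>Weak form of the scheme: Green's identity on every element, with the interior facet
  terms regrouped by \<open>interior_sum\<close>.\<close>

lemma rhs_form:
  "(\<Sum>k<nel d. v k \<bullet> (Hm d k *v sat_rhs pb d T (\<lambda>_. 0) ub wb u k)) =
   (\<Sum>k<nel d. interior_form v u k - ip k (grad_mv k (v k)) (grad_mv k (u k)) +
     (\<Sum>\<gamma>\<in>facets d k - ifacets d k. (Rm d \<gamma> k *v v k) \<bullet> (Bm d \<gamma> *v (Dg pb d \<gamma> k *v u k))) - v k \<bullet> sB pb d T ub wb u k)"
proof -
  have "v k \<bullet> (Hm d k *v sat_rhs pb d T (\<lambda>_. 0) ub wb u k) =
    ((\<Sum>\<gamma>\<in>ifacets d k. (Rm d \<gamma> k *v v k) \<bullet> (Bm d \<gamma> *v (Dg pb d \<gamma> k *v u k))) - v k \<bullet> sI pb d T u k) +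
    ((\<Sum>\<gamma>\<in>facets d k - ifacets d k. (Rm d \<gamma> k *v v k) \<bullet> (Bm d \<gamma> *v (Dg pb d \<gamma> k *v u k)))
      - ip k (grad_mv k (v k)) (grad_mv k (u k)) - v k \<bullet> sB pb d T ub wb u k)" if k: "k < nel d" for k
  proof -
    have "ifacets d k \<subseteq> facets d k" by (auto intro: ifacets_subset)
    from sum.subset_diff[OF this finite_facets, of "\<lambda>\<gamma>. (Rm d \<gamma> k *v v k) \<bullet> (Bm d \<gamma> *v (Dg pb d \<gamma> k *v u k))"]
    show ?thesis
      unfolding sat_rhs_def
      by (simp add: matrix_vector_mult_diff_distrib matrix_vector_right_distrib inner_diff_right inner_add_right
          Hm_Hinv[OF k] D2_by_parts[OF k])
  qed
  then have "(\<Sum>k<nel d. v k \<bullet> (Hm d k *v sat_rhs pb d T (\<lambda>_. 0) ub wb u k)) =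
    (\<Sum>k<nel d. (\<Sum>\<gamma>\<in>ifacets d k. (Rm d \<gamma> k *v v k) \<bullet> (Bm d \<gamma> *v (Dg pb d \<gamma> k *v u k))) - v k \<bullet> sI pb d T u k) +
    (\<Sum>k<nel d. (\<Sum>\<gamma>\<in>facets d k - ifacets d k. (Rm d \<gamma> k *v v k) \<bullet> (Bm d \<gamma> *v (Dg pb d \<gamma> k *v u k)))
      - ip k (grad_mv k (v k)) (grad_mv k (u k)) - v k \<bullet> sB pb d T ub wb u k)"
    by (simp add: sum.distrib)
  then show ?thesis unfolding interior_sum by (simp add: sum.distrib[symmetric] algebra_simps)
qed

text \<open>Extrapolation and differentiation are exact for constants, so the test function 1 has no
  jumps, no fluxes and no gradient.\<close>

lemma conservative: "conservative pb d T"
  unfolding conservative_def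
proof (intro allI)
  fix ub wb and u :: "nat \<Rightarrow> real^'n"
  have J: "jmp d (\<lambda>_. 1) \<gamma> k = 0" if "k < nel d" "\<gamma> \<in> ifacets d k" for k \<gamma>
    using Rm_one[OF that(1) ifacets_subset[OF that(2)]] Rm_one[OF nb(1)[OF that] ifacets_subset[OF nb(3)[OF that]]]
    by (simp add: jmp_def)
  have B: "(\<Sum>\<gamma>\<in>facets d k - ifacets d k. (Rm d \<gamma> k *v 1) \<bullet> (Bm d \<gamma> *v (Dg pb d \<gamma> k *v u k))) =
      (\<Sum>\<gamma>\<in>facets d k - ifacets d k. 1 \<bullet> (Bm d \<gamma> *v (Dg pb d \<gamma> k *v u k)))" if "k < nel d" for k
    using Rm_one[OF that] by (intro sum.cong) auto
  have "interior_form (\<lambda>_. 1) u k = 0" "grad_mv k 1 = 0" if "k < nel d" for k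
    using that by (simp_all add: interior_form_def J Dg_one grad_mv_def Dm_one vec_eq_iff)
  then show "(\<Sum>k<nel d. 1 \<bullet> (Hm d k *v sat_rhs pb d T (\<lambda>_. 0) ub wb u k)) =
     (\<Sum>k<nel d. (\<Sum>\<gamma>\<in>facets d k - ifacets d k. 1 \<bullet> (Bm d \<gamma> *v (Dg pb d \<gamma> k *v u k)))
        - 1 \<bullet> sB pb d T ub wb u k)"
    unfolding rhs_form[of "\<lambda>_. 1"] by (intro sum.cong) (auto simp: ip_zero B)
qed

text \<open>On a Neumann facet the penalty cancels the flux. On a Dirichlet facet the flux and the
  \<open>Bm\<close> part of the penalty give the same pairing, hence the factor 2; what results has
  the shape needed to complete squares as on interior facets.\<close>

lemma boundary_energy:
  assumes k: "k < nel d"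
  shows "(\<Sum>\<gamma>\<in>facets d k - ifacets d k. (Rm d \<gamma> k *v u k) \<bullet> (Bm d \<gamma> *v (Dg pb d \<gamma> k *v u k)))
      - u k \<bullet> sB pb d T (\<lambda>_. 0) (\<lambda>_. 0) u k =
    (\<Sum>\<gamma>\<in>dfacets pb d k. 2 * ip k (lift k \<gamma> (Rm d \<gamma> k *v u k)) (grad_mv k (u k))
      - 1 / alpha d \<gamma> k * ip k (lift k \<gamma> (Rm d \<gamma> k *v u k)) (lift k \<gamma> (Rm d \<gamma> k *v u k)))"
proof -
  have sB: "u k \<bullet> sB pb d T (\<lambda>_. 0) (\<lambda>_. 0) u k =
    (\<Sum>\<gamma>\<in>dfacets pb d k. (Rm d \<gamma> k *v u k) \<bullet> (TD T \<gamma> *v (Rm d \<gamma> k *v u k))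
      - (Dg pb d \<gamma> k *v u k) \<bullet> (Bm d \<gamma> *v (Rm d \<gamma> k *v u k))) +
    (\<Sum>\<gamma>\<in>nfacets pb d k. (Rm d \<gamma> k *v u k) \<bullet> (Bm d \<gamma> *v (Dg pb d \<gamma> k *v u k)))"
    unfolding sB_def Let_def by (simp only: inner_add_right inner_diff_right inner_sum_right inner_mv_right diff_zero)
  have D: "(Rm d \<gamma> k *v u k) \<bullet> (Bm d \<gamma> *v (Dg pb d \<gamma> k *v u k)) -
      ((Rm d \<gamma> k *v u k) \<bullet> (TD T \<gamma> *v (Rm d \<gamma> k *v u k))
      - (Dg pb d \<gamma> k *v u k) \<bullet> (Bm d \<gamma> *v (Rm d \<gamma> k *v u k))) =
    2 * ip k (lift k \<gamma> (Rm d \<gamma> k *v u k)) (grad_mv k (u k))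
      - 1 / alpha d \<gamma> k * ip k (lift k \<gamma> (Rm d \<gamma> k *v u k)) (lift k \<gamma> (Rm d \<gamma> k *v u k))"
    if g: "\<gamma> \<in> dfacets pb d k" for \<gamma>
  proof -
    have "(Dg pb d \<gamma> k *v u k) \<bullet> (Bm d \<gamma> *v (Rm d \<gamma> k *v u k)) =
        (Rm d \<gamma> k *v u k) \<bullet> (Bm d \<gamma> *v (Dg pb d \<gamma> k *v u k))"
      by (metis Bm_inner inner_commute)
    then show ?thesis
      unfolding ip_lift_lift[OF k] ip_lift_grad[OF k] sat_dirichlet[OF k g]
      by (simp add: scaleR_mv) (simp add: matrix_vector_mul_assoc[symmetric])
  qed
  show ?thesis
    unfolding sB boundary_facets[OF k] sum.union_disjoint[OF finite_dfacets finite_nfacets facets_partition(3)[OF k]]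
    by (simp add: D sum_subtractf[symmetric])
qed

text \<open>
  With \<open>x = D u\<close> and liftings \<open>y\<^sub>\<gamma>\<close>, the weights \<open>\<alpha>\<^sub>\<gamma>\<close> distribute \<open>\<parallel>x\<parallel>\<^sup>2\<close> over the facets. The cross terms add up
  to a quarter of \<open>\<Sum>\<^sub>\<gamma> \<parallel>y\<^sub>\<gamma>\<parallel>\<^sup>2 - \<parallel>\<Sum>\<^sub>\<gamma> y\<^sub>\<gamma>\<parallel>\<^sup>2\<close>, which is absorbed because \<open>\<alpha>\<^sub>\<gamma> \<le> 1\<close>.
\<close>

lemma element_energy:
  assumes k: "k < nel d"
  shows "interior_form u u k - ip k (grad_mv k (u k)) (grad_mv k (u k)) +
    (\<Sum>\<gamma>\<in>dfacets pb d k. 2 * ip k (lift k \<gamma> (Rm d \<gamma> k *v u k)) (grad_mv k (u k))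
      - 1 / alpha d \<gamma> k * ip k (lift k \<gamma> (Rm d \<gamma> k *v u k)) (lift k \<gamma> (Rm d \<gamma> k *v u k))) \<le> 0"
proof -
  define x where "x = grad_mv k (u k)"
  define y where "y \<gamma> = beta d \<gamma> k *\<^sub>R lift k \<gamma> (jmp d u \<gamma> k)" for \<gamma>
  define z where "z \<gamma> = lift k \<gamma> (Rm d \<gamma> k *v u k)" for \<gamma>
  \<comment> \<open>This is minus the square of \<open>alpha *\<^sub>R x - w\<close>, divided by
    \<open>alpha\<close>: each facet receives the share \<open>alpha\<close> of the norm of
    \<open>x\<close>.\<close>
  define q where "q \<gamma> w = - (alpha d \<gamma> k * ip k x x) + 2 * ip k w x - 1 / alpha d \<gamma> k * ip k w w" for \<gamma> w
  have q: "q \<gamma> w \<le> 0" if g: "\<gamma> \<in> facets d k" for \<gamma> w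
  proof -
    have a: "alpha d \<gamma> k > 0" by (rule alpha_pos[OF k g])
    have "0 \<le> ip k (alpha d \<gamma> k *\<^sub>R x - w) (alpha d \<gamma> k *\<^sub>R x - w) / alpha d \<gamma> k"
      using ip_nonneg[OF k] a by simp
    also have "\<dots> = - q \<gamma> w"
      unfolding ip_diff_left ip_diff_right ip_scaleR_left ip_scaleR_right ip_commute[OF k, of x w] q_def
      using a by (simp add: field_simps)
    finally show ?thesis by simp
  qed
  have bb: "beta d \<gamma> k * beta d \<gamma> k = beta d \<gamma> k" if "\<gamma> \<in> ifacets d k" for \<gamma>
    using beta_cases[OF k that] by auto
  have own: "beta d \<gamma> k *
      (jmp d u \<gamma> k \<bullet> (Bm d \<gamma> *v (Dg pb d \<gamma> k *v u k)) + (Dg pb d \<gamma> k *v u k) \<bullet> (Bm d \<gamma> *v jmp d u \<gamma> k)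
       - 2 / alpha d \<gamma> k * (jmp d u \<gamma> k \<bullet> (Bm d \<gamma> *v (Ups pb d \<gamma> \<gamma> k *v (Bm d \<gamma> *v jmp d u \<gamma> k))))) =
      2 * ip k (y \<gamma>) x - 2 / alpha d \<gamma> k * ip k (y \<gamma>) (y \<gamma>)" if g: "\<gamma> \<in> ifacets d k" for \<gamma>
  proof -
    have "(Dg pb d \<gamma> k *v u k) \<bullet> (Bm d \<gamma> *v jmp d u \<gamma> k) = jmp d u \<gamma> k \<bullet> (Bm d \<gamma> *v (Dg pb d \<gamma> k *v u k))"
      by (metis Bm_inner inner_commute)
    moreover have "ip k (y \<gamma>) (y \<gamma>) = beta d \<gamma> k *
        (jmp d u \<gamma> k \<bullet> (Bm d \<gamma> *v (Ups pb d \<gamma> \<gamma> k *v (Bm d \<gamma> *v jmp d u \<gamma> k))))"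
      unfolding y_def ip_scaleR_left ip_scaleR_right ip_lift_lift[OF k] mult.assoc[symmetric] bb[OF g] ..
    ultimately show ?thesis
      unfolding y_def[of \<gamma>] x_def ip_scaleR_left ip_lift_grad[OF k] by (simp add: algebra_simps)
  qed
  have "(\<Sum>\<gamma>\<in>ifacets d k. \<Sum>\<epsilon>\<in>ifacets d k - {\<gamma>}. beta d \<gamma> k * beta d \<epsilon> k / 4 *
        (jmp d u \<gamma> k \<bullet> (Bm d \<gamma> *v (Ups pb d \<gamma> \<epsilon> k *v (Bm d \<epsilon> *v jmp d u \<epsilon> k))))) =
      (\<Sum>\<gamma>\<in>ifacets d k. \<Sum>\<epsilon>\<in>ifacets d k - {\<gamma>}. ip k (y \<gamma>) (y \<epsilon>) / 4)"
    by (simp add: y_def ip_scaleR_left ip_scaleR_right ip_lift_lift[OF k] mult_ac)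
  also have "\<dots> = (\<Sum>\<gamma>\<in>ifacets d k. (\<Sum>\<epsilon>\<in>ifacets d k. ip k (y \<gamma>) (y \<epsilon>) / 4) - ip k (y \<gamma>) (y \<gamma>) / 4)"
    by (simp add: sum_diff1)
  also have "\<dots> = ip k (\<Sum>\<gamma>\<in>ifacets d k. y \<gamma>) (\<Sum>\<gamma>\<in>ifacets d k. y \<gamma>) / 4 - (\<Sum>\<gamma>\<in>ifacets d k. ip k (y \<gamma>) (y \<gamma>) / 4)"
    by (simp add: sum_subtractf ip_sum_left ip_sum_right sum_divide_distrib) (rule sum.swap)
  also have "\<dots> \<ge> - (\<Sum>\<gamma>\<in>ifacets d k. ip k (y \<gamma>) (y \<gamma>) / 4)"
    using ip_nonneg[OF k, of "\<Sum>\<gamma>\<in>ifacets d k. y \<gamma>"] by simp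
  finally have cross: "- (\<Sum>\<gamma>\<in>ifacets d k. \<Sum>\<epsilon>\<in>ifacets d k - {\<gamma>}. beta d \<gamma> k * beta d \<epsilon> k / 4 *
        (jmp d u \<gamma> k \<bullet> (Bm d \<gamma> *v (Ups pb d \<gamma> \<epsilon> k *v (Bm d \<epsilon> *v jmp d u \<epsilon> k))))) \<le>
      (\<Sum>\<gamma>\<in>ifacets d k. ip k (y \<gamma>) (y \<gamma>) / 4)" by simp
  have "interior_form u u k \<le> (\<Sum>\<gamma>\<in>ifacets d k. 2 * ip k (y \<gamma>) x - 2 / alpha d \<gamma> k * ip k (y \<gamma>) (y \<gamma>)) +
      (\<Sum>\<gamma>\<in>ifacets d k. ip k (y \<gamma>) (y \<gamma>) / 4)"
  proof -
    have "(\<Sum>\<gamma>\<in>ifacets d k. beta d \<gamma> k *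
      (jmp d u \<gamma> k \<bullet> (Bm d \<gamma> *v (Dg pb d \<gamma> k *v u k)) + (Dg pb d \<gamma> k *v u k) \<bullet> (Bm d \<gamma> *v jmp d u \<gamma> k)
       - 2 / alpha d \<gamma> k * (jmp d u \<gamma> k \<bullet> (Bm d \<gamma> *v (Ups pb d \<gamma> \<gamma> k *v (Bm d \<gamma> *v jmp d u \<gamma> k)))))) =
      (\<Sum>\<gamma>\<in>ifacets d k. 2 * ip k (y \<gamma>) x - 2 / alpha d \<gamma> k * ip k (y \<gamma>) (y \<gamma>))"
      by (intro sum.cong refl own)
    then show ?thesis unfolding interior_form_def using cross by linarith
  qed
  also have "\<dots> \<le> (\<Sum>\<gamma>\<in>ifacets d k. q \<gamma> (y \<gamma>) + alpha d \<gamma> k * ip k x x)"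
    unfolding sum.distrib[symmetric]
  proof (rule sum_mono)
    fix \<gamma> assume "\<gamma> \<in> ifacets d k"
    then have g: "\<gamma> \<in> facets d k" by (rule ifacets_subset)
    \<comment> \<open>The interior penalty carries 2/\<alpha> and \<open>q\<close> uses 1/\<alpha>
      of it; the remaining 1/\<alpha> has to dominate the 1/4 from the cross terms.\<close>
    have "1 / 4 \<le> 1 / alpha d \<gamma> k" using alpha_pos[OF k g] alpha_le_1[OF k g] by (simp add: field_simps)
    from mult_right_mono[OF this ip_nonneg[OF k, of "y \<gamma>"]]
    show "2 * ip k (y \<gamma>) x - 2 / alpha d \<gamma> k * ip k (y \<gamma>) (y \<gamma>) + ip k (y \<gamma>) (y \<gamma>) / 4
        \<le> q \<gamma> (y \<gamma>) + alpha d \<gamma> k * ip k x x"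
      by (simp add: q_def)
  qed
  finally have "interior_form u u k - ip k x x +
      (\<Sum>\<gamma>\<in>dfacets pb d k. 2 * ip k (z \<gamma>) x - 1 / alpha d \<gamma> k * ip k (z \<gamma>) (z \<gamma>)) \<le>
      (\<Sum>\<gamma>\<in>ifacets d k. q \<gamma> (y \<gamma>) + alpha d \<gamma> k * ip k x x) - (\<Sum>\<gamma>\<in>facets d k. alpha d \<gamma> k) * ip k x x +
      (\<Sum>\<gamma>\<in>dfacets pb d k. q \<gamma> (z \<gamma>) + alpha d \<gamma> k * ip k x x)"
    by (simp add: alpha_sum[OF k] q_def)
  \<comment> \<open>A Neumann facet has neither flux nor penalty left, so its share of the norm of
    \<open>x\<close> is \<open>q\<close> at 0.\<close>
  also have "\<dots> = (\<Sum>\<gamma>\<in>ifacets d k. q \<gamma> (y \<gamma>)) + (\<Sum>\<gamma>\<in>dfacets pb d k. q \<gamma> (z \<gamma>)) + (\<Sum>\<gamma>\<in>nfacets pb d k. q \<gamma> 0)"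
  proof -
    have "q \<gamma> 0 = - (alpha d \<gamma> k * ip k x x)" for \<gamma> by (simp add: q_def ip_zero)
    then show ?thesis
      unfolding sum_facets[OF k] by (simp add: sum.distrib distrib_right sum_distrib_right sum_negf)
  qed
  also have "\<dots> \<le> 0"
    using q by (intro add_nonpos_nonpos sum_nonpos) (auto intro: ifacets_subset dfacets_subset nfacets_subset)
  finally show ?thesis unfolding x_def z_def .
qed

lemma energy_decay:
  "(\<Sum>k<nel d. u k \<bullet> (Hm d k *v sat_rhs pb d T (\<lambda>_. 0) (\<lambda>_. 0) (\<lambda>_. 0) u k)) \<le> 0"
  unfolding rhs_form
proof (rule sum_nonpos)
  fix k assume "k \<in> {..<nel d}"
  then have k: "k < nel d" by simp
  from element_energy[OF k, of u] boundary_energy[OF k, of u]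
  show "interior_form u u k - ip k (grad_mv k (u k)) (grad_mv k (u k)) +
      (\<Sum>\<gamma>\<in>facets d k - ifacets d k. (Rm d \<gamma> k *v u k) \<bullet> (Bm d \<gamma> *v (Dg pb d \<gamma> k *v u k))) -
      u k \<bullet> sB pb d T (\<lambda>_. 0) (\<lambda>_. 0) u k \<le> 0"
    by linarith
qed

lemma energy_stable: "energy_stable pb d T"
  unfolding energy_stable_def
proof (intro allI impI)
  fix u :: "real \<Rightarrow> nat \<Rightarrow> real^'n" and t :: real
  assume u: "\<forall>t\<ge>0. \<forall>k<nel d. ((\<lambda>\<tau>. u \<tau> k) has_vector_derivative
        sat_rhs pb d T (\<lambda>_. 0) (\<lambda>_. 0) (\<lambda>_. 0) (u t) k) (at t within {0..})" and t: "t \<ge> 0"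
  define r where "r k = sat_rhs pb d T (\<lambda>_. 0) (\<lambda>_. 0) (\<lambda>_. 0) (u t) k" for k
  have "((\<lambda>\<tau>. \<Sum>k<nel d. u \<tau> k \<bullet> (Hm d k *v u \<tau> k)) has_vector_derivative
      (\<Sum>k<nel d. u t k \<bullet> (Hm d k *v r k) + r k \<bullet> (Hm d k *v u t k))) (at t within {0..})"
  proof (rule has_vector_derivative_sum)
    fix k assume "k \<in> {..<nel d}"
    then have *: "((\<lambda>\<tau>. u \<tau> k) has_vector_derivative r k) (at t within {0..})" using u t by (simp add: r_def)
    have "((\<lambda>\<tau>. Hm d k *v u \<tau> k) has_vector_derivative Hm d k *v r k) (at t within {0..})"
      by (rule bounded_linear.has_vector_derivative[OF matrix_vector_mul_bounded_linear *])
    from bounded_bilinear.has_vector_derivative[OF bounded_bilinear_inner * this]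
    show "((\<lambda>\<tau>. u \<tau> k \<bullet> (Hm d k *v u \<tau> k)) has_vector_derivative
      (u t k \<bullet> (Hm d k *v r k) + r k \<bullet> (Hm d k *v u t k))) (at t within {0..})" .
  qed
  moreover have "(\<Sum>k<nel d. u t k \<bullet> (Hm d k *v r k) + r k \<bullet> (Hm d k *v u t k)) =
      2 * (\<Sum>k<nel d. u t k \<bullet> (Hm d k *v r k))"
    unfolding sum_distrib_left by (intro sum.cong refl) (metis Hm_inner inner_commute mult_2)
  ultimately show "\<exists>r\<le>0. ((\<lambda>\<tau>. \<Sum>k<nel d. u \<tau> k \<bullet> (Hm d k *v u \<tau> k)) has_real_derivative r) (at t within {0..})"
    using energy_decay[of "u t"] unfolding r_def has_real_derivative_iff_has_vector_derivative
    by (intro exI[of _ "2 * (\<Sum>k<nel d. u t k \<bullet> (Hm d k *v sat_rhs pb d T (\<lambda>_. 0) (\<lambda>_. 0) (\<lambda>_. 0) (u t) k))"]) simp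
qed


subsection \<open>The numerical fluxes of the LDG method\<close>

text \<open>The normals of the two sides are opposite unit vectors, so the numerical trace is the
  one from the element with switch 0: an element with switch 1 sees the whole jump.\<close>

lemma ldg_u_eq:
  assumes k: "k < nel d" and g: "\<gamma> \<in> ifacets d k"
  shows "ldg_u d u k \<gamma> - Rm d \<gamma> k *v u k = (- beta d \<gamma> k) *\<^sub>R jmp d u \<gamma> k"
proof -
  have "nrm d \<gamma> k a \<bullet> nrm d \<gamma> k a = 1" for a
    using norm_nrm[OF k ifacets_subset[OF g], of a] by (simp add: norm_eq_1)
  then show ?thesis
    unfolding ldg_u_def ldg_switch_def ldg_jump_def Let_def nrm_nb[OF k g] jmp_def
    using beta_cases[OF k g] by (auto simp: vec_eq_iff inner_simps field_simps)
qed

lemma trace_normal: "(\<chi> a. trace d \<gamma> k W a \<bullet> nrm d \<gamma> k a) = (\<Sum>i\<in>UNIV. Nm d \<gamma> k i *v (Rm d \<gamma> k *v W i))"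
  by (simp add: vec_eq_iff trace_def inner_vec_def Nm_def diagm_mv mult.commute)

lemma trace_grad: "(\<Sum>i\<in>UNIV. Nm d \<gamma> k i *v (Rm d \<gamma> k *v ldg_grad pb d u k i)) = Dg pb d \<gamma> k *v u k"
  by (simp add: ldg_grad_def Dg_mv matrix_mv_sum matrix_vector_mul_assoc[symmetric])

lemma trace_lift:
  "(\<Sum>i\<in>UNIV. Nm d \<gamma> k i *v (Rm d \<gamma> k *v ldg_lift pb d k \<epsilon> r i)) = Ups pb d \<gamma> \<epsilon> k *v (Bm d \<epsilon> *v r)"
  by (simp add: ldg_lift_def Ups_mv matrix_mv_sum matrix_vector_mul_assoc[symmetric])

text \<open>The auxiliary flux contains the lifted jumps of all interior facets of the element, and
  each of these has a trace on every facet. This is where the coupling expressed by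
  \<open>T5\<close> and \<open>T6\<close> comes from.\<close>

lemma trace_flux:
  assumes k: "k < nel d"
  shows "(\<chi> a. trace d \<gamma> k (ldg_flux pb d u k) a \<bullet> nrm d \<gamma> k a) =
    Dg pb d \<gamma> k *v u k - (\<Sum>\<epsilon>\<in>ifacets d k. beta d \<epsilon> k *\<^sub>R (Ups pb d \<gamma> \<epsilon> k *v (Bm d \<epsilon> *v jmp d u \<epsilon> k)))"
proof -
  have "(\<chi> a. trace d \<gamma> k (ldg_flux pb d u k) a \<bullet> nrm d \<gamma> k a) = Dg pb d \<gamma> k *v u k +
      (\<Sum>\<epsilon>\<in>ifacets d k. Ups pb d \<gamma> \<epsilon> k *v (Bm d \<epsilon> *v (ldg_u d u k \<epsilon> - Rm d \<epsilon> k *v u k)))"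
    unfolding trace_normal ldg_flux_def matrix_vector_right_distrib sum.distrib trace_grad
      matrix_mv_sum sum.swap[of _ "ifacets d k"] trace_lift ..
  also have "(\<Sum>\<epsilon>\<in>ifacets d k. Ups pb d \<gamma> \<epsilon> k *v (Bm d \<epsilon> *v (ldg_u d u k \<epsilon> - Rm d \<epsilon> k *v u k))) =
      - (\<Sum>\<epsilon>\<in>ifacets d k. beta d \<epsilon> k *\<^sub>R (Ups pb d \<gamma> \<epsilon> k *v (Bm d \<epsilon> *v jmp d u \<epsilon> k)))"
    unfolding sum_negf[symmetric]
    by (intro sum.cong refl) (simp add: ldg_u_eq[OF k] mv_scaleR vec.neg)
  finally show ?thesis by simp
qed

text \<open>The flux is taken from the element with switch 1, opposite to the choice for the trace;
  the minus sign accounts for the reversed normal of the neighbour.\<close>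

lemma ldg_w_normal:
  assumes k: "k < nel d" and g: "\<gamma> \<in> ifacets d k"
  defines "v \<equiv> nb d k \<gamma>"
  shows "(\<chi> a. ldg_w pb d 0 u k \<gamma> a \<bullet> nrm d \<gamma> k a) =
    beta d \<gamma> k *\<^sub>R (\<chi> a. trace d \<gamma> k (ldg_flux pb d u k) a \<bullet> nrm d \<gamma> k a)
    - beta d \<gamma> v *\<^sub>R (\<chi> a. trace d \<gamma> v (ldg_flux pb d u v) a \<bullet> nrm d \<gamma> v a)"
proof -
  have "nrm d \<gamma> k a \<bullet> nrm d \<gamma> k a = 1" for a
    using norm_nrm[OF k ifacets_subset[OF g], of a] by (simp add: norm_eq_1)
  then show ?thesis
    unfolding ldg_w_def ldg_switch_def Let_def v_def nrm_nb[OF k g]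
    using beta_cases[OF k g] by (auto simp: vec_eq_iff inner_simps field_simps)
qed

lemma ldg_type: "ldg_type pb d 0 T"
proof -
  \<comment> \<open>The unscaled LDG coefficients. The given ones arise from them by the factors
    2/\<alpha> (of the side with switch 1) in \<open>T1\<close>, 1/4 in \<open>T5\<close> and
    \<open>T6\<close>, and 1/\<alpha> in \<open>TD\<close>.\<close>
  define S where "S = T\<lparr>
    T1 := \<lambda>\<gamma> k. Bm d \<gamma> ** (beta d \<gamma> k *\<^sub>R Ups pb d \<gamma> \<gamma> k
      + beta d \<gamma> (nb d k \<gamma>) *\<^sub>R Ups pb d \<gamma> \<gamma> (nb d k \<gamma>)) ** Bm d \<gamma>,
    T5 := \<lambda>\<gamma> \<epsilon> k. 4 *\<^sub>R T5 T \<gamma> \<epsilon> k, T6 := \<lambda>\<gamma> \<epsilon> k. 4 *\<^sub>R T6 T \<gamma> \<epsilon> k,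
    TD := \<lambda>\<gamma>. let k = (THE k. k < nel d \<and> \<gamma> \<in> dfacets pb d k) in Bm d \<gamma> ** Ups pb d \<gamma> \<gamma> k ** Bm d \<gamma>\<rparr>"
  have S: "T1 S \<gamma> k = Bm d \<gamma> ** (beta d \<gamma> k *\<^sub>R Ups pb d \<gamma> \<gamma> k
      + beta d \<gamma> (nb d k \<gamma>) *\<^sub>R Ups pb d \<gamma> \<gamma> (nb d k \<gamma>)) ** Bm d \<gamma>"
    "T2 S = T2 T" "T3 S = T3 T" "T4 S = T4 T" "T5 S \<gamma> \<epsilon> k = 4 *\<^sub>R T5 T \<gamma> \<epsilon> k" "T6 S \<gamma> \<epsilon> k = 4 *\<^sub>R T6 T \<gamma> \<epsilon> k"
    for \<gamma> \<epsilon> k by (simp_all add: S_def)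
  have SD: "TD S \<gamma> = Bm d \<gamma> ** Ups pb d \<gamma> \<gamma> k ** Bm d \<gamma>" if "k < nel d" "\<gamma> \<in> dfacets pb d k" for \<gamma> k
  proof -
    have "(THE k. k < nel d \<and> \<gamma> \<in> dfacets pb d k) = k"
      using that dfacets_unique by (intro the_equality) auto
    then show ?thesis by (simp add: S_def)
  qed
  have "ldg_coefficients pb d 0 S"
    unfolding ldg_coefficients_def Let_def
  proof (intro conjI allI impI ballI)
    fix u :: "nat \<Rightarrow> real^'n" and k \<gamma> assume k: "k < nel d" and g: "\<gamma> \<in> ifacets d k"
    define v where "v = nb d k \<gamma>"
    note v = nb[OF k g, folded v_def]
    note sk = sat_interior[OF k g, folded v_def]
    show "Bm d \<gamma> *v (ldg_u d u k \<gamma> - Rm d \<gamma> k *v u k) =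
          T2 S \<gamma> k *v jmp d u \<gamma> k + T4 S \<gamma> k *v djmp pb d u \<gamma> k"
      unfolding ldg_u_eq[OF k g] S sk(2,4) by (simp add: mv_scaleR scaleR_mv uminus_mv vec.neg)
    \<comment> \<open>Weighted contribution to the flux through \<gamma> of the jump on \<epsilon>,
      lifted in element \<open>j\<close>. The case \<epsilon> = \<gamma> belongs to
      \<open>T1\<close>, the other cases to \<open>T5\<close> and \<open>T6\<close>.\<close>
    define X where "X j \<epsilon> = beta d \<epsilon> j *\<^sub>R (Bm d \<gamma> *v (Ups pb d \<gamma> \<epsilon> j *v (Bm d \<epsilon> *v jmp d u \<epsilon> j)))" for j \<epsilon>
    have T5: "(\<Sum>\<epsilon>\<in>ifacets d k - {\<gamma>}. T5 S \<gamma> \<epsilon> k *v jmp d u \<epsilon> k) = beta d \<gamma> k *\<^sub>R (\<Sum>\<epsilon>\<in>ifacets d k - {\<gamma>}. X k \<epsilon>)"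
      unfolding scaleR_sum_right
      by (intro sum.cong refl) (auto simp: S sk(5) X_def scaleR_mv matrix_vector_mul_assoc[symmetric])
    have T6: "(\<Sum>\<delta>\<in>ifacets d v - {\<gamma>}. T6 S \<gamma> \<delta> v *v jmp d u \<delta> v) = - beta d \<gamma> v *\<^sub>R (\<Sum>\<delta>\<in>ifacets d v - {\<gamma>}. X v \<delta>)"
      unfolding scaleR_sum_right using sat_interior(5,6)[OF v(1,3)]
      by (intro sum.cong refl) (auto simp: S X_def scaleR_mv uminus_mv matrix_vector_mul_assoc[symmetric])
    have T1: "T1 S \<gamma> k *v jmp d u \<gamma> k = X k \<gamma> - X v \<gamma>"
      unfolding X_def S(1) v_def jmp_nb[OF k g]
      by (simp add: matrix_vector_mul_assoc[symmetric] matrix_vector_mult_add_rdistrib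
          matrix_vector_right_distrib scaleR_mv mv_scaleR vec.neg)
    have split: "(\<Sum>\<epsilon>\<in>ifacets d j. X j \<epsilon>) = X j \<gamma> + (\<Sum>\<epsilon>\<in>ifacets d j - {\<gamma>}. X j \<epsilon>)"
      if "\<gamma> \<in> ifacets d j" for j
      using that by (rule sum.remove[OF finite_ifacets])
    have "Bm d \<gamma> *v (Dg pb d \<gamma> k *v u k - (\<chi> a. ldg_w pb d 0 u k \<gamma> a \<bullet> nrm d \<gamma> k a)) =
      Bm d \<gamma> *v (Dg pb d \<gamma> k *v u k) - beta d \<gamma> k *\<^sub>R (Bm d \<gamma> *v (Dg pb d \<gamma> k *v u k) - (\<Sum>\<epsilon>\<in>ifacets d k. X k \<epsilon>))
      + beta d \<gamma> v *\<^sub>R (Bm d \<gamma> *v (Dg pb d \<gamma> v *v u v) - (\<Sum>\<epsilon>\<in>ifacets d v. X v \<epsilon>))"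
      unfolding ldg_w_normal[OF k g, folded v_def] trace_flux[OF k] trace_flux[OF v(1)] X_def
      by (simp add: matrix_vector_mult_diff_distrib matrix_vector_right_distrib mv_scaleR matrix_mv_sum)
    also have "\<dots> = T1 S \<gamma> k *v jmp d u \<gamma> k + T3 S \<gamma> k *v djmp pb d u \<gamma> k +
          (\<Sum>\<epsilon>\<in>ifacets d k - {\<gamma>}. T5 S \<gamma> \<epsilon> k *v jmp d u \<epsilon> k) +
          (\<Sum>\<delta>\<in>ifacets d v - {\<gamma>}. T6 S \<gamma> \<delta> v *v jmp d u \<delta> v)"
      unfolding T1 T5 T6 split[OF g] split[OF v(3)] S(3) sk(3) djmp_def v_def[symmetric]
      using beta_cases[OF k g, folded v_def]
      by (auto simp: X_def scaleR_mv matrix_vector_right_distrib)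
    finally show "Bm d \<gamma> *v (Dg pb d \<gamma> k *v u k - (\<chi> a. ldg_w pb d 0 u k \<gamma> a \<bullet> nrm d \<gamma> k a)) =
          T1 S \<gamma> k *v jmp d u \<gamma> k + T3 S \<gamma> k *v djmp pb d u \<gamma> k +
          (\<Sum>\<epsilon>\<in>ifacets d k - {\<gamma>}. T5 S \<gamma> \<epsilon> k *v jmp d u \<epsilon> k) +
          (\<Sum>\<delta>\<in>ifacets d (nb d k \<gamma>) - {\<gamma>}. T6 S \<gamma> \<delta> (nb d k \<gamma>) *v jmp d u \<delta> (nb d k \<gamma>))"
      unfolding v_def .
  next
    fix u :: "nat \<Rightarrow> real^'n" and ub k \<gamma> assume k: "k < nel d" and g: "\<gamma> \<in> dfacets pb d k"
    have "(\<chi> a. ldg_w_dirichlet pb d 0 ub u k \<gamma> a \<bullet> nrm d \<gamma> k a) =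
        Dg pb d \<gamma> k *v u k + Ups pb d \<gamma> \<gamma> k *v (Bm d \<gamma> *v (ub - Rm d \<gamma> k *v u k))"
      by (simp add: ldg_w_dirichlet_def trace_normal matrix_vector_right_distrib sum.distrib trace_grad trace_lift)
    then show "Bm d \<gamma> *v (Dg pb d \<gamma> k *v u k - (\<chi> a. ldg_w_dirichlet pb d 0 ub u k \<gamma> a \<bullet> nrm d \<gamma> k a)) =
          TD S \<gamma> *v (Rm d \<gamma> k *v u k - ub)"
      unfolding SD[OF k g]
      by (simp add: matrix_vector_mul_assoc[symmetric] matrix_vector_mult_diff_distrib vec.neg)
  qed
  moreover have "\<exists>c>0. T1 T \<gamma> k = c *\<^sub>R T1 S \<gamma> k" if k: "k < nel d" and g: "\<gamma> \<in> ifacets d k" for k \<gamma>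
  proof -
    define v where "v = nb d k \<gamma>"
    have scale: "A ** (c *\<^sub>R B) ** C = c *\<^sub>R (A ** B ** C)" for A B C :: "real^'f^'f" and c
      by (simp add: matrix_eq scaleR_mv mv_scaleR matrix_vector_mul_assoc[symmetric])
    have a: "alpha d \<gamma> k > 0" "alpha d \<gamma> v > 0"
      unfolding v_def by (intro alpha_pos k ifacets_subset g nb[OF k g])+
    from beta_cases[OF k g, folded v_def] show ?thesis
    proof
      assume "beta d \<gamma> k = 1 \<and> beta d \<gamma> v = 0"
      then show ?thesis using a
        by (intro exI[of _ "2 / alpha d \<gamma> k"]) (simp add: S(1) sat_interior(1)[OF k g] scale flip: v_def)
    next
      assume "beta d \<gamma> k = 0 \<and> beta d \<gamma> v = 1"
      then show ?thesis using a
        by (intro exI[of _ "2 / alpha d \<gamma> v"]) (simp add: S(1) sat_interior(1)[OF k g] scale flip: v_def)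
    qed
  qed
  moreover have "\<exists>c>0. TD T \<gamma> = c *\<^sub>R TD S \<gamma>" if k: "k < nel d" and g: "\<gamma> \<in> dfacets pb d k" for k \<gamma>
    using alpha_pos[OF k dfacets_subset[OF g]]
    by (intro exI[of _ "1 / alpha d \<gamma> k"]) (simp add: SD[OF k g] sat_dirichlet[OF k g])
  moreover have "\<exists>c>0. A = c *\<^sub>R (4 *\<^sub>R A)" for A :: "real^'f^'f"
    by (rule exI[of _ "1/4"]) simp
  ultimately show ?thesis
    unfolding ldg_type_def by (intro exI[of _ S]) (auto simp: S)
qed

end

subsection \<open>Calculus of uniformly bounded derivatives\<close>

text \<open>Directional derivative in terms of partial ones, so that bounds on partial derivatives
  pass to its iterates.\<close>

definition ddir :: "real^2 \<Rightarrow> (real^2 \<Rightarrow> real) \<Rightarrow> real^2 \<Rightarrow> real" where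
  "ddir v f x = (\<Sum>i\<in>UNIV. v $ i * pd i f x)"

lemma pd_eq: "(f has_derivative D) (at x) \<Longrightarrow> pd i f x = D (axis i 1)"
  unfolding pd_def using frechet_derivative_at by metis

lemma has_derivative_ddir:
  assumes "f differentiable (at x)" shows "(f has_derivative (\<lambda>v. ddir v f x)) (at x)"
proof -
  define D where "D = frechet_derivative f (at x)"
  have D: "(f has_derivative D) (at x)" using assms by (simp add: D_def frechet_derivative_works)
  then interpret linear D by (rule has_derivative_linear)
  have "D v = ddir v f x" for v
  proof -
    have "D v = D (\<Sum>i\<in>UNIV. v $ i *s axis i 1)" by (simp only: basis_expansion)
    also have "\<dots> = (\<Sum>i\<in>UNIV. v $ i * D (axis i 1))" by (simp add: sum scale scalar_mult_eq_scaleR)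
    finally show ?thesis by (simp add: ddir_def pd_def D_def)
  qed
  then show ?thesis using D by (metis ext)
qed

lemma ddir_axis: "ddir (axis i 1) f x = pd i f x"
  by (simp add: ddir_def axis_def if_distrib[of "\<lambda>z. z * _"] cong: if_cong)

lemma pd_const [simp]: "pd i (\<lambda>x. c) = (\<lambda>x. 0)"
  by (rule ext, subst pd_eq[OF has_derivative_const]) simp

lemma pd_nth: "pd i (\<lambda>x. x $ l - c) = (\<lambda>x. if i = l then 1 else 0)"
proof
  fix x :: "real^2"
  have "((\<lambda>x::real^2. x $ l - c) has_derivative (\<lambda>v. v $ l)) (at x)"
    by (auto intro!: derivative_eq_intros bounded_linear_imp_has_derivative bounded_linear_vec_nth)
  from pd_eq[OF this] show "pd i (\<lambda>x. x $ l - c) x = (if i = l then 1 else 0)" by (simp add: axis_def)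
qed

lemma pd_add:
  assumes "\<And>x. f differentiable (at x)" "\<And>x. g differentiable (at x)"
  shows "pd i (\<lambda>x. f x + g x) = (\<lambda>x. pd i f x + pd i g x)"
  by (rule ext, subst pd_eq[OF has_derivative_add[OF has_derivative_ddir has_derivative_ddir]])
    (use assms in \<open>auto simp: ddir_axis\<close>)

lemma pd_cmult:
  assumes "\<And>x. f differentiable (at x)"
  shows "pd i (\<lambda>x. c * f x) = (\<lambda>x. c * pd i f x)"
  by (rule ext, subst pd_eq[OF has_derivative_mult_right[OF has_derivative_ddir]])
    (use assms in \<open>auto simp: ddir_axis\<close>)

lemma pd_mult:
  assumes "\<And>x. f differentiable (at x)" "\<And>x. g differentiable (at x)"
  shows "pd i (\<lambda>x. f x * g x) = (\<lambda>x. f x * pd i g x + pd i f x * g x)"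
  by (rule ext, subst pd_eq[OF has_derivative_mult[OF has_derivative_ddir has_derivative_ddir]])
    (use assms in \<open>auto simp: ddir_axis\<close>)

lemma differentiable_vec:
  fixes F :: "real^2 \<Rightarrow> real^2"
  assumes "\<And>l. (\<lambda>x. F x $ l) differentiable (at x)"
  shows "(F has_derivative (\<lambda>v. \<chi> l. ddir v (\<lambda>x. F x $ l) x)) (at x)"
proof -
  have "((\<lambda>x. \<Sum>l\<in>UNIV. F x $ l *\<^sub>R (axis l 1 :: real^2)) has_derivative
      (\<lambda>v. \<Sum>l\<in>UNIV. ddir v (\<lambda>x. F x $ l) x *\<^sub>R axis l 1)) (at x)"
    by (intro has_derivative_sum has_derivative_scaleR_left has_derivative_ddir assms)
  moreover have "(\<Sum>l\<in>UNIV. y l *\<^sub>R (axis l 1 :: real^2)) = (\<chi> l. y l)" for y :: "2 \<Rightarrow> real"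
    by (simp add: vec_eq_iff axis_def if_distrib cong: if_cong)
  ultimately show ?thesis by simp
qed

lemma pd_compose:
  assumes "\<And>x. f differentiable (at x)" "\<And>l x. (\<lambda>x. F x $ l) differentiable (at x)"
  shows "pd i (\<lambda>x. f (F x)) = (\<lambda>x. \<Sum>l\<in>UNIV. pd l f (F x) * pd i (\<lambda>x. F x $ l) x)"
proof
  fix x
  have "((\<lambda>x. f (F x)) has_derivative (\<lambda>v. ddir (\<chi> l. ddir v (\<lambda>x. F x $ l) x) f (F x))) (at x)"
    by (rule has_derivative_compose[OF differentiable_vec has_derivative_ddir]) (use assms in auto)
  from pd_eq[OF this] show "pd i (\<lambda>x. f (F x)) x = (\<Sum>l\<in>UNIV. pd l f (F x) * pd i (\<lambda>x. F x $ l) x)"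
    by (simp add: ddir_axis) (simp add: ddir_def mult.commute)
qed

lemma differentiable_compose2:
  fixes f :: "real^2 \<Rightarrow> real" and F :: "real^2 \<Rightarrow> real^2"
  assumes "\<And>x. f differentiable (at x)" "\<And>l x. (\<lambda>x. F x $ l) differentiable (at x)"
  shows "(\<lambda>x. f (F x)) differentiable (at x)"
  using has_derivative_compose[OF differentiable_vec has_derivative_ddir] assms unfolding differentiable_def by blast

text \<open>Quantitative form of \<open>Ck\<close>: smoothness on the whole plane, but one bound on
  \<open>S\<close> for the function and its partial derivatives up to order \<open>m\<close>. For
  empty \<open>S\<close> it reduces to \<open>Ck\<close>, which thus inherits the closure
  properties.\<close>

primrec bdd :: "(real^2) set \<Rightarrow> nat \<Rightarrow> real \<Rightarrow> (real^2 \<Rightarrow> real) \<Rightarrow> bool" where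
  "bdd S 0 M f \<longleftrightarrow> continuous_on UNIV f \<and> (\<forall>x\<in>S. \<bar>f x\<bar> \<le> M)"
| "bdd S (Suc m) M f \<longleftrightarrow> (\<forall>x. f differentiable (at x)) \<and> (\<forall>x\<in>S. \<bar>f x\<bar> \<le> M) \<and> (\<forall>i. bdd S m M (pd i f))"

lemma bdd_le: "bdd S m M f \<Longrightarrow> x \<in> S \<Longrightarrow> \<bar>f x\<bar> \<le> M"
  by (cases m) auto

lemma bdd_continuous: "bdd S m M f \<Longrightarrow> continuous_on UNIV f"
  by (cases m) (auto intro!: continuous_at_imp_continuous_on differentiable_imp_continuous_within)

lemma bdd_mono: "bdd S m M f \<Longrightarrow> M \<le> M' \<Longrightarrow> S' \<subseteq> S \<Longrightarrow> bdd S' m M' f"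
proof (induction m arbitrary: f)
  case 0
  then show ?case unfolding bdd.simps by (meson order_trans subsetD)
next
  case (Suc m)
  then show ?case unfolding bdd.simps by (meson order_trans subsetD)
qed

lemma bdd_SucD: "bdd S (Suc m) M f \<Longrightarrow> bdd S m M f"
proof (induction m arbitrary: f)
  case 0
  from bdd_continuous[OF this] 0 show ?case by simp
next
  case (Suc m)
  have "bdd S m M (pd i f)" for i
    by (rule Suc.IH) (use Suc.prems bdd.simps(2)[of S "Suc m" M f] in blast)
  then show ?case using Suc.prems unfolding bdd.simps(2)[of S "Suc m" M f] bdd.simps(2)[of S m M f] by blast
qed

lemma bdd_leD: "m' \<le> m \<Longrightarrow> bdd S m M f \<Longrightarrow> bdd S m' M f"
  by (induction m rule: nat_induct_at_least) (auto dest: bdd_SucD simp del: bdd.simps)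

lemma bdd_iff_Ck: "bdd {} m M f \<longleftrightarrow> Ck m f"
  by (induction m arbitrary: f) auto

lemma bdd_Ck: "bdd S m M f \<Longrightarrow> Ck m f"
  using bdd_mono[of S m M f M "{}"] by (simp add: bdd_iff_Ck)

lemma Ck_bdd:
  assumes "compact S" "Ck m f" shows "\<exists>M\<ge>0. bdd S m M f"
  using assms(2)
proof (induction m arbitrary: f)
  case 0
  then have "compact (f ` S)" using assms(1) by (metis Ck.simps(1) compact_continuous_image continuous_on_subset subset_UNIV)
  then obtain M where M: "\<forall>y\<in>f ` S. norm y \<le> M" by (meson bounded_iff compact_imp_bounded)
  have "bdd S 0 (max M 0) f" using 0 M by (auto simp: le_max_iff_disj)
  then show ?case by (intro exI[of _ "max M 0"]) auto
next
  case (Suc m)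
  then have "\<exists>M\<ge>0. bdd S m M (pd i f)" for i by auto
  then obtain N where N: "\<And>i. bdd S m (N i) (pd i f)" by metis
  have "continuous_on UNIV f" using Suc.prems
    by (auto intro!: continuous_at_imp_continuous_on differentiable_imp_continuous_within)
  then have "compact (f ` S)" using assms(1) by (metis compact_continuous_image continuous_on_subset subset_UNIV)
  then obtain M where M: "\<forall>y\<in>f ` S. norm y \<le> M" by (meson bounded_iff compact_imp_bounded)
  define K where "K = max 0 (max M (Max (range N)))"
  have "N i \<le> K" for i by (auto simp: K_def intro!: max.coboundedI2 Max_ge)
  then have "bdd S m K (pd i f)" for i by (rule bdd_mono[OF N]) auto
  then have "bdd S (Suc m) K f" using Suc.prems M
    by (auto simp: K_def le_max_iff_disj)
  then show ?case by (intro exI[of _ K]) (auto simp: K_def)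
qed

lemma bdd_foldr:
  "bdd S m M f \<Longrightarrow> length is \<le> m \<Longrightarrow> x \<in> S \<Longrightarrow> \<bar>foldr pd is f x\<bar> \<le> M"
\<comment> \<open>\<open>foldr\<close> applies the last index of the list first, so the list is
  taken apart from its end.\<close>
proof (induction "is" arbitrary: m f rule: rev_induct)
  case Nil
  then show ?case by (auto dest: bdd_le)
next
  case (snoc i "is")
  then obtain m' where m: "m = Suc m'" by (cases m) auto
  then have "bdd S m' M (pd i f)" "length is \<le> m'" using snoc.prems by auto
  from snoc.IH[OF this snoc.prems(3)] show ?case by simp
qed

lemma bdd_const: "\<bar>c\<bar> \<le> M \<Longrightarrow> bdd S m M (\<lambda>x. c)"
proof (induction m arbitrary: c)
  case (Suc m)
  have "bdd S m M (\<lambda>x. 0)" using Suc.IH[of 0] Suc.prems by auto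
  with Suc show ?case by auto
qed auto

lemma bdd_nth:
  assumes "\<And>x. x \<in> S \<Longrightarrow> \<bar>x $ l - c\<bar> \<le> M" "1 \<le> M"
  shows "bdd S m M (\<lambda>x. x $ l - c)"
proof (cases m)
  case 0
  then show ?thesis using assms by (auto intro!: continuous_intros)
next
  case (Suc m')
  have "(\<lambda>x::real^2. x $ l - c) differentiable (at x)" for x
    by (intro differentiable_diff differentiable_const bounded_linear_imp_differentiable bounded_linear_vec_nth)
  moreover have "bdd S m' M (pd i (\<lambda>x. x $ l - c))" for i
    unfolding pd_nth using assms(2) by (cases "i = l") (auto intro!: bdd_const)
  ultimately show ?thesis using assms Suc by simp
qed

lemma bdd_add: "bdd S m M f \<Longrightarrow> bdd S m N g \<Longrightarrow> bdd S m (M + N) (\<lambda>x. f x + g x)"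
proof (induction m arbitrary: f g)
  case 0
  then show ?case by (auto intro!: continuous_intros order_trans[OF abs_triangle_ineq] add_mono)
next
  case (Suc m)
  then have "pd i (\<lambda>x. f x + g x) = (\<lambda>x. pd i f x + pd i g x)" for i by (intro pd_add) auto
  with Suc show ?case
    by (auto intro!: order_trans[OF abs_triangle_ineq] add_mono differentiable_add)
qed

lemma bdd_sum:
  "finite I \<Longrightarrow> (\<And>s. s \<in> I \<Longrightarrow> bdd S m (M s) (f s)) \<Longrightarrow> bdd S m (\<Sum>s\<in>I. M s) (\<lambda>x. \<Sum>s\<in>I. f s x)"
  by (induction I rule: finite_induct) (auto intro: bdd_const bdd_add)

text \<open>Each differentiation splits a product into two, which doubles the bound.\<close>

lemma bdd_mult:
  "bdd S m M f \<Longrightarrow> bdd S m N g \<Longrightarrow> 0 \<le> M \<Longrightarrow> 0 \<le> N \<Longrightarrow> bdd S m (2^m * (M * N)) (\<lambda>x. f x * g x)"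
proof (induction m arbitrary: f g)
  case 0
  then show ?case by (auto intro!: continuous_intros mult_mono simp: abs_mult)
next
  case (Suc m)
  have "pd i (\<lambda>x. f x * g x) = (\<lambda>x. f x * pd i g x + pd i f x * g x)" for i
    using Suc.prems by (intro pd_mult) auto
  moreover have "2^Suc m * (M * N) = 2^m * (M * N) + 2^m * (M * N)" by simp
  then have "bdd S m (2^Suc m * (M * N)) (\<lambda>x. f x * pd i g x + pd i f x * g x)" for i
    using Suc.prems bdd_SucD[OF Suc.prems(1)] bdd_SucD[OF Suc.prems(2)]
    by (simp only:, intro bdd_add Suc.IH) auto
  moreover have "\<bar>f x * g x\<bar> \<le> 2^Suc m * (M * N)" if "x \<in> S" for x
  proof -
    have "\<bar>f x * g x\<bar> \<le> M * N" using Suc.prems that by (auto simp: abs_mult intro!: mult_mono)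
    also have "\<dots> \<le> 2^Suc m * (M * N)" using Suc.prems(3,4)
      by (metis mult_left_mono mult_nonneg_nonneg mult.commute mult_1_right one_le_power one_le_numeral)
    finally show ?thesis .
  qed
  ultimately show ?case using Suc.prems by (simp del: power_Suc)
qed

lemma bdd_cmult: "bdd S m M f \<Longrightarrow> bdd S m (\<bar>c\<bar> * M) (\<lambda>x. c * f x)"
proof (induction m arbitrary: f)
  case 0
  then show ?case by (auto intro!: continuous_intros mult_left_mono simp: abs_mult)
next
  case (Suc m)
  then have "pd i (\<lambda>x. c * f x) = (\<lambda>x. c * pd i f x)" for i by (intro pd_cmult) auto
  with Suc show ?case by (auto intro!: mult_left_mono simp: abs_mult)
qed

lemma Ck_mult: "Ck m f \<Longrightarrow> Ck m g \<Longrightarrow> Ck m (\<lambda>x. f x * g x)"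
  using bdd_mult[of "{}" m 0 f 0 g] by (simp add: bdd_iff_Ck)

lemma Ck_const: "Ck m (\<lambda>x. c)"
  using bdd_const[of c "\<bar>c\<bar>" "{}" m] by (simp add: bdd_iff_Ck)

lemma Ck_nth: "Ck m (\<lambda>x. x $ l)"
  using bdd_nth[of "{}" l 0 1 m] by (simp add: bdd_iff_Ck)

lemma Ck_power: "Ck m f \<Longrightarrow> Ck m (\<lambda>x. f x ^ n)"
  by (induction n) (auto intro: Ck_const Ck_mult)

lemma Ck_sum: "finite I \<Longrightarrow> (\<And>s. s \<in> I \<Longrightarrow> Ck m (f s)) \<Longrightarrow> Ck m (\<lambda>x. \<Sum>s\<in>I. f s x)"
  using bdd_sum[of I "{}" m "\<lambda>_. 0" f] by (simp add: bdd_iff_Ck)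

text \<open>The chain rule in the plane has two summands, each a product to which
  \<open>bdd_mult\<close> adds the factor 2^m. The summand 1 keeps the constant large enough for the
  undifferentiated composition.\<close>

primrec comp_const :: "nat \<Rightarrow> real \<Rightarrow> real" where
  "comp_const 0 N = 1"
| "comp_const (Suc m) N = 1 + 2 * (2^m * (comp_const m N * N))"

lemma comp_const_ge: "0 \<le> N \<Longrightarrow> comp_const m N \<ge> 1"
  by (induction m) auto

lemma bdd_compose:
  assumes "\<And>l. bdd S m N (\<lambda>x. F x $ l)" "\<And>x. x \<in> S \<Longrightarrow> F x \<in> U" "0 \<le> N" "0 \<le> M" "bdd U m M f"
  shows "bdd S m (comp_const m N * M) (\<lambda>x. f (F x))"
  using assms(1,5)
proof (induction m arbitrary: f)
  case 0
  have "continuous_on UNIV F"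
    using continuous_on_vec_lambda[of UNIV "\<lambda>l x. F x $ l"] 0(1) by simp
  then have "continuous_on UNIV (\<lambda>x. f (F x))"
    using 0(2) by (intro continuous_on_compose2[of UNIV f UNIV F]) auto
  then show ?case using 0 assms(2) by auto
next
  case (Suc m)
  have d: "\<And>x. f differentiable (at x)" "\<And>l x. (\<lambda>x. F x $ l) differentiable (at x)" using Suc.prems by auto
  let ?K = "2^m * (comp_const m N * M * N)"
  have F: "bdd S m N (\<lambda>x. F x $ l)" for l using Suc.prems(1)[of l] by (rule bdd_SucD)
  have c: "0 \<le> comp_const m N" using comp_const_ge[OF assms(3), of m] by simp
  have "bdd S m (\<Sum>l\<in>(UNIV::2 set). ?K) (\<lambda>x. \<Sum>l\<in>UNIV. pd l f (F x) * pd i (\<lambda>x. F x $ l) x)" for i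
    using Suc.prems assms(3,4) c by (intro bdd_sum bdd_mult Suc.IH F) auto
  moreover have "(\<Sum>l\<in>(UNIV::2 set). ?K) \<le> comp_const (Suc m) N * M"
    using assms(4) by (simp add: algebra_simps)
  ultimately have "bdd S m (comp_const (Suc m) N * M) (pd i (\<lambda>x. f (F x)))" for i
    unfolding pd_compose[OF d] by (rule bdd_mono) auto
  moreover have "\<bar>f (F x)\<bar> \<le> comp_const (Suc m) N * M" if "x \<in> S" for x
  proof -
    have "\<bar>f (F x)\<bar> \<le> 1 * M" using bdd_le[OF Suc.prems(2) assms(2)[OF that]] by simp
    also have "\<dots> \<le> comp_const (Suc m) N * M"
      by (intro mult_right_mono comp_const_ge assms)
    finally show ?thesis .
  qed
  ultimately show ?case using differentiable_compose2[OF d] by simp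
qed

subsection \<open>Taylor's theorem along segments\<close>

lemma bdd_ddir:
  assumes "bdd S (Suc m) M f" "0 \<le> M" "norm v \<le> r"
  shows "bdd S m (2 * r * M) (ddir v f)"
proof -
  have "bdd S m (\<Sum>i\<in>(UNIV::2 set). \<bar>v $ i\<bar> * M) (\<lambda>x. \<Sum>i\<in>UNIV. v $ i * pd i f x)"
    using assms by (intro bdd_sum bdd_cmult) auto
  moreover have "\<bar>v $ i\<bar> * M \<le> r * M" for i
    using assms component_le_norm_cart[of v i] by (intro mult_right_mono) auto
  then have "(\<Sum>i\<in>(UNIV::2 set). \<bar>v $ i\<bar> * M) \<le> (\<Sum>i\<in>(UNIV::2 set). r * M)" by (rule sum_mono)
  then have "(\<Sum>i\<in>(UNIV::2 set). \<bar>v $ i\<bar> * M) \<le> 2 * r * M" by simp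
  ultimately show ?thesis unfolding ddir_def by (rule bdd_mono[OF _ _ order_refl])
qed

lemma bdd_ddir_pow:
  assumes "norm v \<le> r" "0 \<le> r"
  shows "bdd S (m + j) M f \<Longrightarrow> 0 \<le> M \<Longrightarrow> bdd S m ((2 * r)^j * M) ((ddir v ^^ j) f)"
proof (induction j arbitrary: m)
  case (Suc j)
  then have "bdd S (Suc m) ((2 * r)^j * M) ((ddir v ^^ j) f)"
    using Suc.IH[of "Suc m"] by (simp del: bdd.simps)
  from bdd_ddir[OF this _ assms(1)] show ?case using assms Suc.prems by (simp add: mult.assoc)
qed simp

lemma ddir_pow_linear:
  assumes "finite I"
  shows "(\<And>i. i \<in> I \<Longrightarrow> Ck j (f i)) \<Longrightarrow>
    (ddir v ^^ j) (\<lambda>x. \<Sum>i\<in>I. c i * f i x) = (\<lambda>x. \<Sum>i\<in>I. c i * (ddir v ^^ j) (f i) x)"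
proof (induction j arbitrary: f)
  case (Suc j)
  have d: "\<And>i x. i \<in> I \<Longrightarrow> f i differentiable (at x)" using Suc.prems by auto
  have pdl: "pd l (\<lambda>x. \<Sum>i\<in>I. c i * f i x) = (\<lambda>x. \<Sum>i\<in>I. c i * pd l (f i) x)" for l
  proof
    fix x
    have "((\<lambda>x. \<Sum>i\<in>I. c i * f i x) has_derivative (\<lambda>v. \<Sum>i\<in>I. c i * ddir v (f i) x)) (at x)"
      using d by (intro has_derivative_sum has_derivative_mult_right has_derivative_ddir) auto
    from pd_eq[OF this] show "pd l (\<lambda>x. \<Sum>i\<in>I. c i * f i x) x = (\<Sum>i\<in>I. c i * pd l (f i) x)"
      by (simp add: ddir_axis)
  qed
  have "ddir v (\<lambda>x. \<Sum>i\<in>I. c i * f i x) = (\<lambda>x. \<Sum>i\<in>I. c i * ddir v (f i) x)"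
    unfolding ddir_def pdl by (rule ext) (simp add: sum_distrib_left sum.swap[of _ I] mult.left_commute)
  moreover have "Ck j (ddir v (f i))" if "i \<in> I" for i
    unfolding ddir_def using Suc.prems[OF that] by (intro Ck_sum Ck_mult Ck_const) auto
  ultimately show ?case
    unfolding funpow_Suc_right o_def using Suc.IH[of "\<lambda>i. ddir v (f i)"] by simp
qed simp

text \<open>The innermost derivative is split into partial ones; the components of the fixed
  \<open>v\<close> pass through the remaining derivatives. Inductions over the order can thus
  replace \<open>f\<close> by \<open>pd i f\<close>.\<close>

lemma ddir_pow_Suc:
  assumes "Ck (Suc j) f"
  shows "(ddir v ^^ Suc j) f x = (\<Sum>i\<in>UNIV. v $ i * (ddir v ^^ j) (pd i f) x)"
proof -
  have "ddir v f = (\<lambda>x. \<Sum>i\<in>UNIV. v $ i * pd i f x)" by (rule ext) (simp add: ddir_def)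
  then have "(ddir v ^^ Suc j) f = (ddir v ^^ j) (\<lambda>x. \<Sum>i\<in>UNIV. v $ i * pd i f x)"
    unfolding funpow_Suc_right o_def by simp
  then show ?thesis using ddir_pow_linear[of UNIV j "\<lambda>i. pd i f" v "\<lambda>i. v $ i"] assms by simp
qed

text \<open>Taylor polynomial at \<open>x\<close> in the displacement \<open>v\<close>. Its degree
  is \<open>m - 1\<close>, and the summand of index \<open>j\<close> is homogeneous of degree
  \<open>j\<close> in \<open>v\<close>.\<close>

definition taylor :: "nat \<Rightarrow> (real^2 \<Rightarrow> real) \<Rightarrow> real^2 \<Rightarrow> real^2 \<Rightarrow> real" where
  "taylor m f x v = (\<Sum>j<m. (ddir v ^^ j) f x / fact j)"

text \<open>One-dimensional Maclaurin expansion along the segment from \<open>x\<close> to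
  \<open>y\<close>, which convexity keeps in \<open>S\<close>. Each derivative along the segment
  costs a factor 2 r, and the factor 1/m! is given away.\<close>

lemma taylor_bound:
  assumes f: "bdd S m M f" and "0 \<le> M" "0 < m" "convex S" "x \<in> S" "y \<in> S" "norm (y - x) \<le> r"
  shows "\<bar>f y - taylor m f x (y - x)\<bar> \<le> (2 * r)^m * M"
proof -
  define v where "v = y - x"
  have r: "norm v \<le> r" "0 \<le> r" using assms(7) norm_ge_zero[of v] unfolding v_def by linarith+
  define \<phi> where "\<phi> j t = (ddir v ^^ j) f (x + t *\<^sub>R v)" for j t
  have B: "bdd S (m - j) ((2 * r)^j * M) ((ddir v ^^ j) f)" if "j \<le> m" for j
    using that f assms(2) by (intro bdd_ddir_pow r) auto
  have "DERIV (\<phi> j) t :> \<phi> (Suc j) t" if j: "j < m" for j t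
  proof -
    obtain m' where m': "m - j = Suc m'" using j by (metis Suc_diff_Suc)
    have "(ddir v ^^ j) f differentiable (at z)" for z using B[of j] j m' by simp
    then have 1: "((ddir v ^^ j) f has_derivative (\<lambda>w. ddir w ((ddir v ^^ j) f) (x + t *\<^sub>R v))) (at (x + t *\<^sub>R v))"
      by (rule has_derivative_ddir)
    have 2: "((\<lambda>t. x + t *\<^sub>R v) has_derivative (\<lambda>s. s *\<^sub>R v)) (at t)"
      by (auto intro!: derivative_eq_intros)
    from has_derivative_compose[OF 2 1] show ?thesis
      unfolding has_field_derivative_def \<phi>_def
      by (rule has_derivative_eq_rhs) (auto simp: ddir_def sum_distrib_left mult_ac)
  qed
  then obtain t where t: "0 < t" "t < 1" "\<phi> 0 1 = (\<Sum>j<m. \<phi> j 0 / fact j * 1^j) + \<phi> m t / fact m * 1^m"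
    using Maclaurin[of 1 m \<phi> "\<phi> 0"] assms(3) by auto
  have "x + t *\<^sub>R v = (1 - t) *\<^sub>R x + t *\<^sub>R y" by (simp add: v_def algebra_simps)
  then have "x + t *\<^sub>R v \<in> S" using assms(4-6) t by (auto intro: convexD)
  then have "\<bar>\<phi> m t\<bar> \<le> (2 * r)^m * M" unfolding \<phi>_def using B[of m] by (auto dest: bdd_le)
  moreover have "\<bar>\<phi> m t\<bar> / fact m \<le> \<bar>\<phi> m t\<bar> / 1" by (intro divide_left_mono) auto
  moreover have "\<phi> 0 1 = f y" by (simp add: \<phi>_def v_def)
  ultimately show ?thesis
    using t(3) by (simp add: taylor_def \<phi>_def v_def[symmetric] abs_divide)
qed

text \<open>With \<open>x\<close> fixed, a Taylor term is a polynomial in \<open>y\<close>, so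
  derivatives of every order \<open>q\<close> are bounded although \<open>f\<close> has only
  \<open>j\<close> of them. This makes Taylor polynomials admissible in
  \<open>order_accurate\<close>.\<close>

lemma taylor_bdd:
  assumes N: "\<And>l y. y \<in> S \<Longrightarrow> \<bar>y $ l - x $ l\<bar> \<le> N" "1 \<le> N" and x: "x \<in> S"
  shows "bdd S j M f \<Longrightarrow> 0 \<le> M \<Longrightarrow> bdd S q ((2 * (2^q * N))^j * M) (\<lambda>y. (ddir (y - x) ^^ j) f x)"
proof (induction j arbitrary: f)
  case 0
  then show ?case using x by (auto intro!: bdd_const)
next
  case (Suc j)
  let ?K = "(2 * (2^q * N))^j * M"
  have "bdd S q ?K (\<lambda>y. (ddir (y - x) ^^ j) (pd i f) x)" for i
    using Suc by auto
  moreover have "bdd S q N (\<lambda>y. (y - x) $ i)" for i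
    using N by (auto intro!: bdd_nth)
  moreover have "0 \<le> ?K" using N Suc.prems by auto
  ultimately have "bdd S q (\<Sum>i\<in>(UNIV::2 set). 2^q * (N * ?K)) (\<lambda>y. \<Sum>i\<in>UNIV. (y - x) $ i * (ddir (y - x) ^^ j) (pd i f) x)"
    using N by (intro bdd_sum bdd_mult) auto
  then show ?case
    unfolding ddir_pow_Suc[OF bdd_Ck[OF Suc.prems(1)]] by (simp add: mult_ac)
qed

text \<open>A Taylor term is a combination of monomials of degree \<open>j\<close>. The monomial in
  front generalizes the induction: each derivative that is removed leaves a coordinate as an
  additional factor.\<close>

lemma extrapolation_exact:
  fixes r :: "'b::finite \<Rightarrow> real" and z :: "'b \<Rightarrow> real^2" and z0 x :: "real^2"
  assumes exact: "\<And>i j. i + j \<le> p \<Longrightarrow> (\<Sum>b\<in>UNIV. r b * ((z b $ 1)^i * (z b $ 2)^j)) = (z0 $ 1)^i * (z0 $ 2)^j"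
  shows "Ck j f \<Longrightarrow> i1 + i2 + j \<le> p \<Longrightarrow>
    (\<Sum>b\<in>UNIV. r b * ((z b $ 1)^i1 * (z b $ 2)^i2 * (ddir (h *\<^sub>R z b) ^^ j) f x)) =
    (z0 $ 1)^i1 * (z0 $ 2)^i2 * (ddir (h *\<^sub>R z0) ^^ j) f x"
proof (induction j arbitrary: f i1 i2)
  case 0
  have "(\<Sum>b\<in>UNIV. r b * ((z b $ 1)^i1 * (z b $ 2)^i2)) * f x = (z0 $ 1)^i1 * (z0 $ 2)^i2 * f x"
    using exact[of i1 i2] 0 by simp
  then show ?case by (simp add: sum_distrib_right mult.assoc)
next
  case (Suc j)
  have f: "Ck j (pd i f)" for i using Suc.prems(1) by simp
  define D where "D i w = (ddir (h *\<^sub>R w) ^^ j) (pd i f) x" for i w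
  have S: "(ddir (h *\<^sub>R w) ^^ Suc j) f x = h * (w $ 1 * D 1 w + w $ 2 * D 2 w)" for w
    unfolding ddir_pow_Suc[OF Suc.prems(1)] D_def by (simp add: sum_2 algebra_simps)
  have "(\<Sum>b\<in>UNIV. r b * ((z b $ 1)^i1 * (z b $ 2)^i2 * (ddir (h *\<^sub>R z b) ^^ Suc j) f x)) =
      h * ((\<Sum>b\<in>UNIV. r b * ((z b $ 1)^Suc i1 * (z b $ 2)^i2 * D 1 (z b))) +
           (\<Sum>b\<in>UNIV. r b * ((z b $ 1)^i1 * (z b $ 2)^Suc i2 * D 2 (z b))))"
    unfolding S sum.distrib[symmetric] sum_distrib_left by (intro sum.cong refl) (simp add: algebra_simps)
  also have "\<dots> = h * ((z0 $ 1)^Suc i1 * (z0 $ 2)^i2 * D 1 z0 + (z0 $ 1)^i1 * (z0 $ 2)^Suc i2 * D 2 z0)"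
    unfolding D_def using Suc.prems(2) by (subst (1 2) Suc.IH[OF f]) auto
  also have "\<dots> = (z0 $ 1)^i1 * (z0 $ 2)^i2 * (ddir (h *\<^sub>R z0) ^^ Suc j) f x"
    unfolding S by (simp add: algebra_simps)
  finally show ?case .
qed

text \<open>The Taylor polynomial at 0 has degree \<open>m - 1\<close>, at most \<open>p\<close>,
  and is reproduced. Only remainders survive: one per node with a weight up to \<open>C\<close>, and
  one at the target point.\<close>

lemma extrapolation_error:
  fixes r :: "'b::finite \<Rightarrow> real" and z :: "'b \<Rightarrow> real^2" and z0 :: "real^2"
  assumes exact: "\<And>i j. i + j \<le> p \<Longrightarrow> (\<Sum>b\<in>UNIV. r b * ((z b $ 1)^i * (z b $ 2)^j)) = (z0 $ 1)^i * (z0 $ 2)^j"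
    and f: "bdd S m M f" "0 \<le> M" "0 < m" "m \<le> p + 1"
    and S: "convex S" "0 \<in> S" "\<And>b. h *\<^sub>R z b \<in> S" "h *\<^sub>R z0 \<in> S"
    and \<rho>: "\<And>b. norm (h *\<^sub>R z b) \<le> \<rho>" "norm (h *\<^sub>R z0) \<le> \<rho>" and C: "\<And>b. \<bar>r b\<bar> \<le> C"
  shows "\<bar>(\<Sum>b\<in>UNIV. r b * f (h *\<^sub>R z b)) - f (h *\<^sub>R z0)\<bar> \<le> (real CARD('b) * C + 1) * ((2 * \<rho>)^m * M)"
proof -
  define P where "P w = taylor m f 0 w" for w
  define K where "K = (2 * \<rho>)^m * M"
  have T: "\<bar>f w - P w\<bar> \<le> K" if "w \<in> S" "norm w \<le> \<rho>" for w
    using taylor_bound[OF f(1-3) S(1,2) that(1), of \<rho>] that(2) by (simp add: P_def K_def)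
  have K: "0 \<le> K" using T[OF S(4) \<rho>(2)] by linarith
  have C0: "0 \<le> C" using C[of undefined] by linarith
  have ex: "(\<Sum>b\<in>UNIV. r b * (ddir (h *\<^sub>R z b) ^^ j) f 0) = (ddir (h *\<^sub>R z0) ^^ j) f 0" if "j < m" for j
  proof -
    have "Ck j f" using bdd_Ck[OF bdd_leD[OF _ f(1)]] that by simp
    from extrapolation_exact[where r=r and z=z and p=p, OF exact this, of 0 0] that f(4) show ?thesis by simp
  qed
  have "(\<Sum>b\<in>UNIV. r b * P (h *\<^sub>R z b)) = (\<Sum>j<m. (\<Sum>b\<in>UNIV. r b * (ddir (h *\<^sub>R z b) ^^ j) f 0) / fact j)"
    unfolding P_def taylor_def sum_distrib_left sum_divide_distrib
    by (subst sum.swap) simp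
  also have "\<dots> = P (h *\<^sub>R z0)" unfolding P_def taylor_def using ex by (intro sum.cong) auto
  finally have "(\<Sum>b\<in>UNIV. r b * f (h *\<^sub>R z b)) - f (h *\<^sub>R z0) =
      (\<Sum>b\<in>UNIV. r b * (f (h *\<^sub>R z b) - P (h *\<^sub>R z b))) - (f (h *\<^sub>R z0) - P (h *\<^sub>R z0))"
    by (simp add: right_diff_distrib sum_subtractf)
  also have "\<bar>\<dots>\<bar> \<le> (\<Sum>b\<in>UNIV. \<bar>r b * (f (h *\<^sub>R z b) - P (h *\<^sub>R z b))\<bar>) + K"
    using T[OF S(4) \<rho>(2)] sum_abs[of "\<lambda>b. r b * (f (h *\<^sub>R z b) - P (h *\<^sub>R z b))" UNIV] by linarith
  also have "(\<Sum>b\<in>UNIV. \<bar>r b * (f (h *\<^sub>R z b) - P (h *\<^sub>R z b))\<bar>) \<le> (\<Sum>b\<in>(UNIV::'b set). C * K)"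
    unfolding abs_mult by (intro sum_mono mult_mono C T S \<rho> C0) auto
  finally show ?thesis by (simp add: K_def algebra_simps)
qed

subsection \<open>Uniform orders of magnitude\<close>

type_synonym 'x indexed = "nat \<Rightarrow> nat \<Rightarrow> facet \<Rightarrow> facet \<Rightarrow> 'x"

text \<open>
  Families depend on the mesh \<open>n\<close>, an element and up to two facets; \<open>Q\<close> restricts the indices.
\<close>

definition sO :: "(nat \<Rightarrow> real) \<Rightarrow> bool indexed \<Rightarrow> int \<Rightarrow> real indexed \<Rightarrow> bool" where
  "sO h Q s c \<longleftrightarrow> (\<exists>K\<ge>0. \<forall>n k \<gamma> \<epsilon>. Q n k \<gamma> \<epsilon> \<longrightarrow> 0 < h n \<and> \<bar>c n k \<gamma> \<epsilon>\<bar> \<le> K * h n powi s)"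

definition vO :: "(nat \<Rightarrow> real) \<Rightarrow> bool indexed \<Rightarrow> int \<Rightarrow> (real^'m) indexed \<Rightarrow> bool" where
  "vO h Q s X \<longleftrightarrow> (\<forall>a. sO h Q s (\<lambda>n k \<gamma> \<epsilon>. X n k \<gamma> \<epsilon> $ a))"

definition mO :: "(nat \<Rightarrow> real) \<Rightarrow> bool indexed \<Rightarrow> int \<Rightarrow> (real^'m^'k) indexed \<Rightarrow> bool" where
  "mO h Q s A \<longleftrightarrow> (\<forall>a. vO h Q s (\<lambda>n k \<gamma> \<epsilon>. A n k \<gamma> \<epsilon> $ a))"

lemma sO_I: "(\<And>n k \<gamma> \<epsilon>. Q n k \<gamma> \<epsilon> \<Longrightarrow> 0 < h n \<and> \<bar>c n k \<gamma> \<epsilon>\<bar> \<le> K * h n powi s) \<Longrightarrow> sO h Q s c"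
proof -
  assume *: "\<And>n k \<gamma> \<epsilon>. Q n k \<gamma> \<epsilon> \<Longrightarrow> 0 < h n \<and> \<bar>c n k \<gamma> \<epsilon>\<bar> \<le> K * h n powi s"
  have "\<bar>c n k \<gamma> \<epsilon>\<bar> \<le> \<bar>K\<bar> * h n powi s" if "Q n k \<gamma> \<epsilon>" for n k \<gamma> \<epsilon>
  proof -
    have "K * h n powi s \<le> \<bar>K\<bar> * h n powi s" using *[OF that] by (intro mult_right_mono) auto
    then show ?thesis using *[OF that] by linarith
  qed
  then show ?thesis unfolding sO_def using * by (intro exI[of _ "\<bar>K\<bar>"]) auto
qed

text \<open>\<open>K\<close>, \<open>G\<close> and \<open>E\<close> rename the indices within one
  mesh. Bounds pass in this way to the neighbouring element, or from one facet argument to the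
  other, with the same constant.\<close>

lemma sO_pull:
  assumes "sO h Q s c" "\<And>n k \<gamma> \<epsilon>. Q' n k \<gamma> \<epsilon> \<Longrightarrow> Q n (K n k \<gamma> \<epsilon>) (G n k \<gamma> \<epsilon>) (E n k \<gamma> \<epsilon>)"
    and "\<And>n k \<gamma> \<epsilon>. Q' n k \<gamma> \<epsilon> \<Longrightarrow> c' n k \<gamma> \<epsilon> = c n (K n k \<gamma> \<epsilon>) (G n k \<gamma> \<epsilon>) (E n k \<gamma> \<epsilon>)"
  shows "sO h Q' s c'"
  using assms unfolding sO_def by metis

lemma vO_pull:
  assumes "vO h Q s X" "\<And>n k \<gamma> \<epsilon>. Q' n k \<gamma> \<epsilon> \<Longrightarrow> Q n (K n k \<gamma> \<epsilon>) (G n k \<gamma> \<epsilon>) (E n k \<gamma> \<epsilon>)"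
    and "\<And>n k \<gamma> \<epsilon>. Q' n k \<gamma> \<epsilon> \<Longrightarrow> X' n k \<gamma> \<epsilon> = X n (K n k \<gamma> \<epsilon>) (G n k \<gamma> \<epsilon>) (E n k \<gamma> \<epsilon>)"
  shows "vO h Q' s X'"
  unfolding vO_def
  by (intro allI sO_pull[where K=K and G=G and E=E and Q=Q and Q'=Q', OF assms(1)[unfolded vO_def, rule_format] assms(2)])
    (auto simp: assms(3))

lemma mO_pull:
  assumes "mO h Q s A" "\<And>n k \<gamma> \<epsilon>. Q' n k \<gamma> \<epsilon> \<Longrightarrow> Q n (K n k \<gamma> \<epsilon>) (G n k \<gamma> \<epsilon>) (E n k \<gamma> \<epsilon>)"
    and "\<And>n k \<gamma> \<epsilon>. Q' n k \<gamma> \<epsilon> \<Longrightarrow> A' n k \<gamma> \<epsilon> = A n (K n k \<gamma> \<epsilon>) (G n k \<gamma> \<epsilon>) (E n k \<gamma> \<epsilon>)"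
  shows "mO h Q' s A'"
  unfolding mO_def
  by (intro allI vO_pull[where K=K and G=G and E=E and Q=Q and Q'=Q', OF assms(1)[unfolded mO_def, rule_format] assms(2)])
    (auto simp: assms(3))

lemma sO_mult: "sO h Q s c \<Longrightarrow> sO h Q t e \<Longrightarrow> sO h Q (s + t) (\<lambda>n k \<gamma> \<epsilon>. c n k \<gamma> \<epsilon> * e n k \<gamma> \<epsilon>)"
proof -
  assume "sO h Q s c" "sO h Q t e"
  then obtain K L where K: "K \<ge> 0" "\<And>n k \<gamma> \<epsilon>. Q n k \<gamma> \<epsilon> \<Longrightarrow> 0 < h n \<and> \<bar>c n k \<gamma> \<epsilon>\<bar> \<le> K * h n powi s"
    and L: "L \<ge> 0" "\<And>n k \<gamma> \<epsilon>. Q n k \<gamma> \<epsilon> \<Longrightarrow> \<bar>e n k \<gamma> \<epsilon>\<bar> \<le> L * h n powi t"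
    unfolding sO_def by metis
  show ?thesis
  proof (rule sO_I[where K="K * L"])
    fix n k \<gamma> \<epsilon> assume q: "Q n k \<gamma> \<epsilon>"
    have "\<bar>c n k \<gamma> \<epsilon> * e n k \<gamma> \<epsilon>\<bar> \<le> (K * h n powi s) * (L * h n powi t)"
      unfolding abs_mult using K(1) K(2)[OF q] L(2)[OF q] by (intro mult_mono) auto
    also have "\<dots> = K * L * h n powi (s + t)" using K(2)[OF q] by (simp add: power_int_add)
    finally show "0 < h n \<and> \<bar>c n k \<gamma> \<epsilon> * e n k \<gamma> \<epsilon>\<bar> \<le> K * L * h n powi (s + t)" using K(2)[OF q] by simp
  qed
qed

lemma sO_add: "sO h Q s c \<Longrightarrow> sO h Q s e \<Longrightarrow> sO h Q s (\<lambda>n k \<gamma> \<epsilon>. c n k \<gamma> \<epsilon> + e n k \<gamma> \<epsilon>)"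
proof -
  assume "sO h Q s c" "sO h Q s e"
  then obtain K L where K: "K \<ge> 0" "\<And>n k \<gamma> \<epsilon>. Q n k \<gamma> \<epsilon> \<Longrightarrow> 0 < h n \<and> \<bar>c n k \<gamma> \<epsilon>\<bar> \<le> K * h n powi s"
    and L: "L \<ge> 0" "\<And>n k \<gamma> \<epsilon>. Q n k \<gamma> \<epsilon> \<Longrightarrow> \<bar>e n k \<gamma> \<epsilon>\<bar> \<le> L * h n powi s"
    unfolding sO_def by metis
  show ?thesis
  proof (rule sO_I[where K="K + L"])
    fix n k \<gamma> \<epsilon> assume q: "Q n k \<gamma> \<epsilon>"
    show "0 < h n \<and> \<bar>c n k \<gamma> \<epsilon> + e n k \<gamma> \<epsilon>\<bar> \<le> (K + L) * h n powi s"
      using K(2)[OF q] L(2)[OF q] unfolding distrib_right by linarith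
  qed
qed

lemma sO_minus: "sO h Q s c \<Longrightarrow> sO h Q s (\<lambda>n k \<gamma> \<epsilon>. - c n k \<gamma> \<epsilon>)"
  by (simp add: sO_def)

text \<open>An empty sum would not do: \<open>sO\<close> also asserts \<open>0 < h n\<close>, which
  has to come from some summand.\<close>

lemma sO_sum:
  assumes "finite I" "I \<noteq> {}" "\<And>i. i \<in> I \<Longrightarrow> sO h Q s (c i)"
  shows "sO h Q s (\<lambda>n k \<gamma> \<epsilon>. \<Sum>i\<in>I. c i n k \<gamma> \<epsilon>)"
  using assms by (induction I rule: finite_ne_induct) (auto intro: sO_add)

text \<open>The index set varies with the mesh, so its size needs a uniform bound; a triangle has at
  most three facets.\<close>

lemma sO_facet_sum:
  assumes "sO h Q s c" "\<And>n k \<gamma> \<epsilon>. Q' n k \<gamma> \<epsilon> \<Longrightarrow> 0 < h n \<and> card (A n k \<gamma>) \<le> 3 \<and> (\<forall>\<delta>\<in>A n k \<gamma>. Q n k \<gamma> \<delta>)"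
  shows "sO h Q' s (\<lambda>n k \<gamma> \<epsilon>. \<Sum>\<delta>\<in>A n k \<gamma>. c n k \<gamma> \<delta>)"
proof -
  obtain K where K: "K \<ge> 0" "\<And>n k \<gamma> \<epsilon>. Q n k \<gamma> \<epsilon> \<Longrightarrow> \<bar>c n k \<gamma> \<epsilon>\<bar> \<le> K * h n powi s"
    using assms(1) unfolding sO_def by metis
  show ?thesis
  proof (rule sO_I[where K="3 * K"])
    fix n k \<gamma> \<epsilon> assume q: "Q' n k \<gamma> \<epsilon>"
    have "\<bar>\<Sum>\<delta>\<in>A n k \<gamma>. c n k \<gamma> \<delta>\<bar> \<le> (\<Sum>\<delta>\<in>A n k \<gamma>. K * h n powi s)"
      using assms(2)[OF q] K(2) by (intro sum_abs[THEN order_trans] sum_mono) auto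
    also have "\<dots> = real (card (A n k \<gamma>)) * (K * h n powi s)" by simp
    also have "\<dots> \<le> 3 * (K * h n powi s)"
      using assms(2)[OF q] K(1) by (intro mult_right_mono) auto
    finally show "0 < h n \<and> \<bar>\<Sum>\<delta>\<in>A n k \<gamma>. c n k \<gamma> \<delta>\<bar> \<le> 3 * K * h n powi s" using assms(2)[OF q] by simp
  qed
qed

lemma vO_add: "vO h Q s X \<Longrightarrow> vO h Q s Y \<Longrightarrow> vO h Q s (\<lambda>n k \<gamma> \<epsilon>. X n k \<gamma> \<epsilon> + Y n k \<gamma> \<epsilon>)"
  and vO_minus: "vO h Q s X \<Longrightarrow> vO h Q s (\<lambda>n k \<gamma> \<epsilon>. - X n k \<gamma> \<epsilon>)"
  by (simp_all add: vO_def sO_add sO_minus)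

lemma vO_diff: "vO h Q s X \<Longrightarrow> vO h Q s Y \<Longrightarrow> vO h Q s (\<lambda>n k \<gamma> \<epsilon>. X n k \<gamma> \<epsilon> - Y n k \<gamma> \<epsilon>)"
  using vO_add[OF _ vO_minus] by fastforce

lemma vO_sum:
  assumes "finite I" "I \<noteq> {}" "\<And>i. i \<in> I \<Longrightarrow> vO h Q s (X i)"
  shows "vO h Q s (\<lambda>n k \<gamma> \<epsilon>. \<Sum>i\<in>I. X i n k \<gamma> \<epsilon>)"
  using assms by (simp add: vO_def sum_component sO_sum)

lemma mO_sum:
  assumes "finite I" "I \<noteq> {}" "\<And>i. i \<in> I \<Longrightarrow> mO h Q s (A i)"
  shows "mO h Q s (\<lambda>n k \<gamma> \<epsilon>. \<Sum>i\<in>I. A i n k \<gamma> \<epsilon>)"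
  using assms by (simp add: mO_def sum_component vO_sum)

lemma mO_add: "mO h Q s A \<Longrightarrow> mO h Q s B \<Longrightarrow> mO h Q s (\<lambda>n k \<gamma> \<epsilon>. A n k \<gamma> \<epsilon> + B n k \<gamma> \<epsilon>)"
  by (simp add: mO_def vO_add)

lemma vO_facet_sum:
  assumes "vO h Q s X" "\<And>n k \<gamma> \<epsilon>. Q' n k \<gamma> \<epsilon> \<Longrightarrow> 0 < h n \<and> card (A n k \<gamma>) \<le> 3 \<and> (\<forall>\<delta>\<in>A n k \<gamma>. Q n k \<gamma> \<delta>)"
  shows "vO h Q' s (\<lambda>n k \<gamma> \<epsilon>. \<Sum>\<delta>\<in>A n k \<gamma>. X n k \<gamma> \<delta>)"
  using assms sO_facet_sum[where Q=Q and Q'=Q' and h=h and A=A, OF _ assms(2)] by (simp add: vO_def sum_component)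

lemma vO_mv: "mO h Q s A \<Longrightarrow> vO h Q t X \<Longrightarrow> vO h Q (s + t) (\<lambda>n k \<gamma> \<epsilon>. A n k \<gamma> \<epsilon> *v X n k \<gamma> \<epsilon>)"
  by (simp add: mO_def vO_def matrix_vector_mult_def sO_sum sO_mult)

lemma mO_mult: "mO h Q s A \<Longrightarrow> mO h Q t B \<Longrightarrow> mO h Q (s + t) (\<lambda>n k \<gamma> \<epsilon>. A n k \<gamma> \<epsilon> ** B n k \<gamma> \<epsilon>)"
  by (simp add: mO_def vO_def matrix_matrix_mult_def sO_sum sO_mult)

lemma mO_transpose: "mO h Q s A \<Longrightarrow> mO h Q s (\<lambda>n k \<gamma> \<epsilon>. transpose (A n k \<gamma> \<epsilon>))"
  by (simp add: mO_def vO_def transpose_def)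

lemma mO_scaleR: "sO h Q s c \<Longrightarrow> mO h Q t A \<Longrightarrow> mO h Q (s + t) (\<lambda>n k \<gamma> \<epsilon>. c n k \<gamma> \<epsilon> *\<^sub>R A n k \<gamma> \<epsilon>)"
  by (simp add: mO_def vO_def sO_mult)

lemma mO_diagm:
  assumes "\<And>a. sO h Q s (\<lambda>n k \<gamma> \<epsilon>. x n k \<gamma> \<epsilon> $ a)" shows "mO h Q s (\<lambda>n k \<gamma> \<epsilon>. diagm (x n k \<gamma> \<epsilon>))"
proof -
  have "sO h Q s (\<lambda>n k \<gamma> \<epsilon>. if i = j then x n k \<gamma> \<epsilon> $ i else 0)" for i j
  proof (cases "i = j")
    case True then show ?thesis using assms by simp
  next
    case False
    then show ?thesis using assms[of i] unfolding sO_def by auto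
  qed
  then show ?thesis by (simp add: mO_def vO_def diagm_def)
qed

subsection \<open>Truncation errors\<close>

lemma norm_le_components:
  assumes "\<And>a. \<bar>x $ a\<bar> \<le> K" shows "norm (x::real^2) \<le> 2 * K"
proof -
  have "norm x \<le> (\<Sum>i\<in>UNIV. \<bar>x $ i\<bar>)" by (rule norm_le_l1_cart)
  also have "\<dots> \<le> (\<Sum>i\<in>(UNIV::2 set). K)" by (intro sum_mono assms)
  finally show ?thesis by simp
qed

lemma ref_triangle_norm: "z \<in> ref_triangle \<Longrightarrow> norm z \<le> 2"
  using norm_le_components[of z 1] ref_triangle_bounds[of z] by (simp add: abs_le_iff)

lemma zero_in_ref_triangle: "0 \<in> ref_triangle"
  using rvert_in[of 0] by (simp add: rvert_def)

text \<open>\<open>C\<close> is the common constant of accuracy and quasi-uniformity.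
  \<open>H\<close> keeps all scaled reference triangles in one ball and lets a surplus power of h be
  traded for a constant.\<close>

locale ldg_family =
  fixes p :: nat and pb :: diffusion and g :: "real^2"
    and \<D> :: "nat \<Rightarrow> ('n::finite, 'f::finite) disc" and \<T> :: "nat \<Rightarrow> 'f penalty" and C H :: real
  assumes p: "p \<ge> 1" and disc: "ldg_disc p pb (\<D> n) g (\<T> n)"
    and acc: "order_accurate p pb C (\<D> n)" and scal: "scaling p C (\<D> n)"
    and H: "mesh_size (\<D> n) \<le> H"
begin

interpretation L: ldg_disc p pb "\<D> n" g "\<T> n" for n
  by (rule disc)

abbreviation h :: "nat \<Rightarrow> real" where "h n \<equiv> mesh_size (\<D> n)"

abbreviation Qe :: "bool indexed" where "Qe n k \<gamma> \<epsilon> \<equiv> k < nel (\<D> n)"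
abbreviation Qf :: "bool indexed" where "Qf n k \<gamma> \<epsilon> \<equiv> k < nel (\<D> n) \<and> \<gamma> \<in> facets (\<D> n) k"
abbreviation Qff :: "bool indexed" where
  "Qff n k \<gamma> \<epsilon> \<equiv> k < nel (\<D> n) \<and> \<gamma> \<in> facets (\<D> n) k \<and> \<epsilon> \<in> facets (\<D> n) k"
abbreviation Qi :: "bool indexed" where "Qi n k \<gamma> \<epsilon> \<equiv> k < nel (\<D> n) \<and> \<gamma> \<in> ifacets (\<D> n) k"

lemma scal_unfolded:
  assumes "k < nel (\<D> n)"
  shows "\<exists>c. poly_map (p + 1) c (emap (\<D> n) k) \<and>
        (\<forall>i j. 1 \<le> i + j \<and> i + j \<le> p + 1 \<longrightarrow> norm (c i j) \<le> C * h n ^ (i + j))"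
    and "(h n)\<^sup>2 \<le> C * measure lebesgue (interior (elem (\<D> n) k))"
    and "(h n)\<^sup>2 \<le> C * Hd (\<D> n) k $ a" and "Hd (\<D> n) k $ a \<le> C * (h n)\<^sup>2"
    and "\<bar>Dm (\<D> n) k i $ a $ b\<bar> \<le> C / h n"
    and "\<gamma> \<in> facets (\<D> n) k \<Longrightarrow> 1 \<le> C * alpha (\<D> n) \<gamma> k"
    and "\<gamma> \<in> facets (\<D> n) k \<Longrightarrow> \<bar>Rm (\<D> n) \<gamma> k $ a' $ b\<bar> \<le> C"
proof -
  note s = scal[of n, unfolded scaling_def Let_def, rule_format, OF assms]
  show "\<exists>c. poly_map (p + 1) c (emap (\<D> n) k) \<and>
        (\<forall>i j. 1 \<le> i + j \<and> i + j \<le> p + 1 \<longrightarrow> norm (c i j) \<le> C * h n ^ (i + j))"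
    using s by (elim conjE)
  show "(h n)\<^sup>2 \<le> C * measure lebesgue (interior (elem (\<D> n) k))" using s by (elim conjE)
  show "(h n)\<^sup>2 \<le> C * Hd (\<D> n) k $ a" "Hd (\<D> n) k $ a \<le> C * (h n)\<^sup>2"
    "\<bar>Dm (\<D> n) k i $ a $ b\<bar> \<le> C / h n"
    using s by (elim conjE, simp)+
  show "\<gamma> \<in> facets (\<D> n) k \<Longrightarrow> 1 \<le> C * alpha (\<D> n) \<gamma> k"
    "\<gamma> \<in> facets (\<D> n) k \<Longrightarrow> \<bar>Rm (\<D> n) \<gamma> k $ a' $ b\<bar> \<le> C"
    using s by (elim conjE, simp)+
qed

lemma elem_compact:
  assumes "k < nel (\<D> n)" shows "compact (elem (\<D> n) k)"
proof -
  have "continuous_on ref_triangle (emap (\<D> n) k)"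
    using L.emap_differentiable[OF assms] by (auto intro!: continuous_at_imp_continuous_on differentiable_imp_continuous_within)
  then show ?thesis unfolding elem_def using ref_triangle_compact by (rule compact_continuous_image)
qed

lemma diameter_le: "k < nel (\<D> n) \<Longrightarrow> diameter (elem (\<D> n) k) \<le> h n"
  unfolding mesh_size_def by (intro Max_ge) auto

text \<open>Scaling bounds the positive entries of \<open>Hd\<close> by C h^2, which excludes h =
  0.\<close>

lemma h_pos: assumes "k < nel (\<D> n)" shows "0 < h n"
proof -
  have "0 \<le> diameter (elem (\<D> n) k)" by (intro diameter_ge_0 compact_imp_bounded elem_compact assms)
  then have "0 \<le> h n" using diameter_le[OF assms] by linarith
  moreover have "h n \<noteq> 0" using scal_unfolded(4)[OF assms, of undefined] L.Hd_pos[OF assms, of undefined] by auto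
  ultimately show ?thesis by simp
qed

lemma vnode_dist:
  assumes "k < nel (\<D> n)" shows "norm (vnode (\<D> n) k b - vnode (\<D> n) k a) \<le> h n"
proof -
  have "vnode (\<D> n) k c \<in> elem (\<D> n) k" for c using L.rnode_in by (simp add: vnode_def elem_def)
  then have "dist (vnode (\<D> n) k b) (vnode (\<D> n) k a) \<le> diameter (elem (\<D> n) k)"
    by (intro diameter_bounded_bound compact_imp_bounded elem_compact assms)
  then show ?thesis using diameter_le[OF assms] by (simp add: dist_norm)
qed

lemma dom_bounded: "\<exists>\<rho>>0. dom pb \<subseteq> cball 0 \<rho>"
proof -
  have "compact (dom pb)" using L.dp unfolding diffusion_problem_def by (elim conjE)
  then obtain \<rho> where "\<rho> > 0" "\<forall>x\<in>dom pb. norm x \<le> \<rho>" using compact_imp_bounded bounded_pos by metis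
  then show ?thesis by (intro exI[of _ \<rho>]) auto
qed

text \<open>
  With \<open>w = h z\<close> the element maps have coefficients bounded independently of the mesh.
\<close>

lemma scaled_emap:
  "\<exists>N\<ge>0. \<forall>n. \<forall>k<nel (\<D> n). \<exists>\<Psi>. (\<forall>z. emap (\<D> n) k z = \<Psi> (h n *\<^sub>R z)) \<and>
    (\<forall>l. bdd (cball 0 (2 * \<bar>H\<bar>)) (p + 1) N (\<lambda>w. \<Psi> w $ l))"
proof -
  let ?S = "cball 0 (2 * \<bar>H\<bar>) :: (real^2) set"
  define \<mu> where "\<mu> i j w = (w $ 1)^i * (w $ 2)^j" for i j and w :: "real^2"
  have "\<exists>M\<ge>0. bdd ?S (p + 1) M (\<mu> i j)" for i j
    unfolding \<mu>_def by (intro Ck_bdd compact_cball Ck_mult Ck_power Ck_nth)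
  then obtain M where M: "\<And>i j. 0 \<le> M i j" "\<And>i j. bdd ?S (p + 1) (M i j) (\<mu> i j)" by metis
  obtain \<rho> where \<rho>: "\<rho> > 0" "dom pb \<subseteq> cball 0 \<rho>" using dom_bounded by blast
  \<comment> \<open>\<open>C\<close> covers the coefficients of positive degree. The constant one is
    the image of a vertex, hence a point of the domain, and is covered by \<rho>.\<close>
  define B where "B = max C \<rho>"
  define N where "N = (\<Sum>i\<le>p + 1. \<Sum>j\<le>p + 1 - i. B * M i j)"
  have "0 \<le> B" using \<rho> by (simp add: B_def)
  then have "0 \<le> N" unfolding N_def by (intro sum_nonneg mult_nonneg_nonneg M)
  moreover have "\<exists>\<Psi>. (\<forall>z. emap (\<D> n) k z = \<Psi> (h n *\<^sub>R z)) \<and> (\<forall>l. bdd ?S (p + 1) N (\<lambda>w. \<Psi> w $ l))"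
    if k: "k < nel (\<D> n)" for n k
  proof -
    obtain c where c: "poly_map (p + 1) c (emap (\<D> n) k)"
      "\<And>i j. 1 \<le> i + j \<Longrightarrow> i + j \<le> p + 1 \<Longrightarrow> norm (c i j) \<le> C * h n ^ (i + j)"
      using scal_unfolded(1)[OF k] by blast
    note h = h_pos[OF k]
    define c' where "c' i j = (1 / h n ^ (i + j)) *\<^sub>R c i j" for i j
    define \<Psi> where "\<Psi> w = (\<Sum>i\<le>p + 1. \<Sum>j\<le>p + 1 - i. \<mu> i j w *\<^sub>R c' i j)" for w
    have "\<mu> i j (h n *\<^sub>R z) *\<^sub>R c' i j = ((z $ 1)^i * (z $ 2)^j) *\<^sub>R c i j" for i j z
      using h by (simp add: \<mu>_def c'_def power_mult_distrib power_add)
    then have 1: "emap (\<D> n) k z = \<Psi> (h n *\<^sub>R z)" for z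
      using c(1) by (simp add: poly_map_def \<Psi>_def)
    have c'B: "norm (c' i j) \<le> B" if "i + j \<le> p + 1" for i j
    proof (cases "i + j = 0")
      case True
      have "emap (\<D> n) k 0 \<in> dom pb" using L.elem_Union[of n] k zero_in_ref_triangle by (auto simp: elem_def)
      moreover have "emap (\<D> n) k 0 = c 0 0"
      proof -
        have *: "((0::real^2) $ 1)^i * (0 $ 2)^j = (if i = 0 \<and> j = 0 then 1 else 0)" for i j :: nat by auto
        have "emap (\<D> n) k 0 = (\<Sum>i\<le>p + 1. \<Sum>j\<le>p + 1 - i. if i = 0 \<and> j = 0 then c i j else 0)"
          using c(1) unfolding poly_map_def * by (auto intro!: sum.cong)
        also have "\<dots> = (\<Sum>i\<le>p + 1. if i = 0 then c 0 0 else 0)"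
          by (intro sum.cong refl) auto
        finally show ?thesis by simp
      qed
      ultimately show ?thesis using True \<rho> by (auto simp: c'_def B_def le_max_iff_disj)
    next
      case False
      then have "1 \<le> i + j" by linarith
      then have "norm (c i j) \<le> C * h n ^ (i + j)" using that by (rule c(2))
      then have "norm (c' i j) \<le> C" using h by (simp add: c'_def field_simps)
      then show ?thesis by (simp add: B_def)
    qed
    have "bdd ?S (p + 1) N (\<lambda>w. \<Psi> w $ l)" for l
    proof -
      have b1: "bdd ?S (p + 1) (\<Sum>i\<le>p + 1. \<Sum>j\<le>p + 1 - i. \<bar>c' i j $ l\<bar> * M i j)
          (\<lambda>w. \<Sum>i\<le>p + 1. \<Sum>j\<le>p + 1 - i. c' i j $ l * \<mu> i j w)"
        by (intro bdd_sum bdd_cmult M finite_atMost)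
      have b2: "(\<Sum>i\<le>p + 1. \<Sum>j\<le>p + 1 - i. \<bar>c' i j $ l\<bar> * M i j) \<le> N"
        unfolding N_def
        by (intro sum_mono mult_right_mono M order_trans[OF component_le_norm_cart] c'B) auto
      have b3: "(\<lambda>w. \<Psi> w $ l) = (\<lambda>w. \<Sum>i\<le>p + 1. \<Sum>j\<le>p + 1 - i. c' i j $ l * \<mu> i j w)"
        by (simp add: \<Psi>_def sum_component mult.commute)
      show ?thesis unfolding b3 by (rule bdd_mono[OF b1 b2 order_refl])
    qed
    with 1 show ?thesis by blast
  qed
  ultimately show ?thesis by blast
qed

lemma scaled_point:
  assumes "k < nel (\<D> n)" "z \<in> ref_triangle"
  shows "norm (h n *\<^sub>R z) \<le> 2 * h n" "h n *\<^sub>R z \<in> cball 0 (2 * \<bar>H\<bar>)"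
proof -
  have "h n * norm z \<le> h n * 2"
    using h_pos[OF assms(1)] ref_triangle_norm[OF assms(2)] by (intro mult_left_mono) auto
  then show "norm (h n *\<^sub>R z) \<le> 2 * h n" using h_pos[OF assms(1)] by simp
  then show "h n *\<^sub>R z \<in> cball 0 (2 * \<bar>H\<bar>)" using H[of n] by simp
qed

lemma facet_node_ref:
  assumes "k < nel (\<D> n)" "\<gamma> \<in> facets (\<D> n) k"
  obtains z where "z \<in> ref_triangle" "fnode (\<D> n) \<gamma> a = emap (\<D> n) k z" "fnode (\<D> n) \<gamma> a \<in> \<gamma>"
    "\<And>i j. i + j \<le> p \<Longrightarrow>
      (\<Sum>b\<in>UNIV. Rm (\<D> n) \<gamma> k $ a $ b * ((rnode (\<D> n) b $ 1)^i * (rnode (\<D> n) b $ 2)^j)) = (z $ 1)^i * (z $ 2)^j"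
proof -
  obtain e s where e: "e < 3" "\<gamma> = lfacet (\<D> n) k e" "s a \<in> {0<..<1}"
    "fnode (\<D> n) \<gamma> a = emap (\<D> n) k (redge e (s a))"
    using L.facet_nodes[OF assms] by metis
  define z where "z = redge e (s a)"
  have z: "z \<in> ref_triangle" unfolding z_def using e(3) by (intro redge_in) auto
  have f: "fnode (\<D> n) \<gamma> a = emap (\<D> n) k z" using e z_def by simp
  have inv: "inv_into ref_triangle (emap (\<D> n) k) (fnode (\<D> n) \<gamma> a) = z"
    unfolding f by (rule inv_into_f_f[OF L.emap_inj[OF assms(1)] z])
  have "\<forall>\<gamma>\<in>facets (\<D> n) k. \<forall>a i j. i + j \<le> p \<longrightarrow>
        (let z = inv_into ref_triangle (emap (\<D> n) k) (fnode (\<D> n) \<gamma> a) in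
         (\<Sum>b\<in>UNIV. Rm (\<D> n) \<gamma> k $ a $ b * ((rnode (\<D> n) b $ 1)^i * (rnode (\<D> n) b $ 2)^j)) = (z $ 1)^i * (z $ 2)^j)"
    using L.sbp[OF assms(1)] unfolding sbp_operators_def by (elim conjE)
  from this[rule_format, OF assms(2), of _ _ a] have
    "i + j \<le> p \<Longrightarrow> (\<Sum>b\<in>UNIV. Rm (\<D> n) \<gamma> k $ a $ b * ((rnode (\<D> n) b $ 1)^i * (rnode (\<D> n) b $ 2)^j)) = (z $ 1)^i * (z $ 2)^j" for i j
    by (simp add: inv)
  moreover have "fnode (\<D> n) \<gamma> a \<in> \<gamma>"
  proof -
    have "(emap (\<D> n) k \<circ> redge e) (s a) \<in> lfacet (\<D> n) k e"
      unfolding lfacet_def path_image_def using e(3) by (intro imageI) auto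
    then show ?thesis using e by simp
  qed
  ultimately show thesis using that z f by blast
qed

text \<open>Needed with \<open>m = p + 1\<close> for the solution and with \<open>m = p\<close> for
  the components of its flux, which have one derivative less.\<close>

lemma vO_extrapolation:
  assumes "Ck m U" "1 \<le> m" "m \<le> p + 1"
  shows "vO h Qf (int m) (\<lambda>n k \<gamma> \<epsilon>. Rm (\<D> n) \<gamma> k *v nodal (\<D> n) U k - fnodal (\<D> n) U \<gamma>)"
proof -
  let ?S = "cball 0 (2 * \<bar>H\<bar>) :: (real^2) set"
  obtain N where N: "N \<ge> 0" "\<And>n k. k < nel (\<D> n) \<Longrightarrow> \<exists>\<Psi>. (\<forall>z. emap (\<D> n) k z = \<Psi> (h n *\<^sub>R z)) \<and>
    (\<forall>l. bdd ?S (p + 1) N (\<lambda>w. \<Psi> w $ l))" using scaled_emap by metis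
  obtain M where M: "M \<ge> 0" "bdd (cball 0 (2 * N)) m M U" using Ck_bdd[OF compact_cball assms(1)] by metis
  define B where "B = comp_const m N * M"
  have B: "0 \<le> B" using comp_const_ge[OF N(1), of m] M by (simp add: B_def)
  \<comment> \<open>Scaled points have norm at most 2 h, and the Taylor remainder doubles this
    again; hence 4^m.\<close>
  define K where "K = (real CARD('n) * C + 1) * (4^m * B)"
  have "\<bar>(Rm (\<D> n) \<gamma> k *v nodal (\<D> n) U k) $ a - fnodal (\<D> n) U \<gamma> $ a\<bar> \<le> K * h n ^ m"
    if k: "k < nel (\<D> n)" and g: "\<gamma> \<in> facets (\<D> n) k" for n k \<gamma> a
  proof -
    obtain \<Psi> where \<Psi>: "\<And>z. emap (\<D> n) k z = \<Psi> (h n *\<^sub>R z)" "\<And>l. bdd ?S (p + 1) N (\<lambda>w. \<Psi> w $ l)"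
      using N(2)[OF k] by blast
    obtain z where z: "z \<in> ref_triangle" "fnode (\<D> n) \<gamma> a = emap (\<D> n) k z"
      "\<And>i j. i + j \<le> p \<Longrightarrow>
      (\<Sum>b\<in>UNIV. Rm (\<D> n) \<gamma> k $ a $ b * ((rnode (\<D> n) b $ 1)^i * (rnode (\<D> n) b $ 2)^j)) = (z $ 1)^i * (z $ 2)^j"
      by (rule facet_node_ref[OF k g, where a=a]) (rule that)
    have "norm (\<Psi> w) \<le> 2 * N" if "w \<in> ?S" for w
      using norm_le_components[of "\<Psi> w" N] bdd_le[OF \<Psi>(2) that] by blast
    then have "bdd ?S m B (\<lambda>w. U (\<Psi> w))"
      unfolding B_def using \<Psi>(2) N(1) M assms(3)
      by (intro bdd_compose[where U="cball 0 (2 * N)"]) (auto intro: bdd_leD)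
    from extrapolation_error[where r="\<lambda>b. Rm (\<D> n) \<gamma> k $ a $ b" and h="h n" and z="rnode (\<D> n)" and p=p and C=C and
        \<rho>="2 * h n", OF z(3) this B _ assms(3)]
    have "\<bar>(\<Sum>b\<in>UNIV. Rm (\<D> n) \<gamma> k $ a $ b * U (\<Psi> (h n *\<^sub>R rnode (\<D> n) b))) - U (\<Psi> (h n *\<^sub>R z))\<bar>
        \<le> (real CARD('n) * C + 1) * ((2 * (2 * h n))^m * B)"
      using assms(2) scaled_point[OF k L.rnode_in] scaled_point[OF k z(1)] scal_unfolded(7)[OF k g] by auto
    then show ?thesis
      by (simp add: K_def matrix_vector_mult_def nodal_def fnodal_def vnode_def \<Psi>(1)[symmetric] z(2)
          power_mult_distrib mult_ac)
  qed
  then show ?thesis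
    unfolding vO_def by (intro allI sO_I[where K=K]) (auto simp: h_pos)
qed

lemma mO_Rm: "mO h Qf 0 (\<lambda>n k \<gamma> \<epsilon>. Rm (\<D> n) \<gamma> k)"
  unfolding mO_def vO_def by (intro allI sO_I[where K=C]) (auto simp: h_pos scal_unfolded(7))

lemma mO_Dm: "mO h Qe (- 1) (\<lambda>n k \<gamma> \<epsilon>. Dm (\<D> n) k i)"
  unfolding mO_def vO_def
  by (intro allI sO_I[where K=C]) (use scal_unfolded(5) in \<open>auto simp: h_pos power_int_minus field_simps\<close>)

lemma mO_Hinv: "mO h Qe (- 2) (\<lambda>n k \<gamma> \<epsilon>. Hinv (\<D> n) k)"
proof -
  have "\<bar>1 / Hd (\<D> n) k $ a\<bar> \<le> C * h n powi (- 2)" if k: "k < nel (\<D> n)" for n k a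
    using scal_unfolded(3)[OF k, of a] L.Hd_pos[OF k, of a] h_pos[OF k]
    by (simp add: power_int_minus field_simps)
  then have "mO h Qe (- 2) (\<lambda>n k \<gamma> \<epsilon>. diagm (\<chi> a. 1 / Hd (\<D> n) k $ a))"
    by (intro mO_diagm sO_I[where K=C]) (auto simp: h_pos)
  then show ?thesis
    by (rule mO_pull[where K="\<lambda>n k \<gamma> \<epsilon>. k" and G="\<lambda>n k \<gamma> \<epsilon>. \<gamma>" and E="\<lambda>n k \<gamma> \<epsilon>. \<epsilon>"]) (auto simp: L.Hinv_eq)
qed

lemma lam_smooth: "Ck p (\<lambda>x. lam pb x $ i $ j)"
  using L.dp unfolding diffusion_problem_def by (elim conjE) blast

lemma mO_Lam: "mO h Qe 0 (\<lambda>n k \<gamma> \<epsilon>. Lam pb (\<D> n) k i j)"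
proof -
  have "compact (dom pb)" using L.dp unfolding diffusion_problem_def by (elim conjE)
  then obtain M where M: "bdd (dom pb) p M (\<lambda>x. lam pb x $ i $ j)" using Ck_bdd lam_smooth by blast
  show ?thesis unfolding Lam_def
    by (intro mO_diagm sO_I[where K=M]) (use bdd_le[OF M] L.vnode_in_dom in \<open>auto simp: h_pos\<close>)
qed

lemma mO_Nm: "mO h Qf 0 (\<lambda>n k \<gamma> \<epsilon>. Nm (\<D> n) \<gamma> k i)"
proof -
  have "\<bar>nrm (\<D> n) \<gamma> k a $ i\<bar> \<le> 1" if "k < nel (\<D> n)" "\<gamma> \<in> facets (\<D> n) k" for n k \<gamma> a
    using component_le_norm_cart[of "nrm (\<D> n) \<gamma> k a" i] L.norm_nrm[OF that, of a] by simp
  then show ?thesis unfolding Nm_def by (intro mO_diagm sO_I[where K=1]) (auto simp: h_pos)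
qed

lemma sO_alpha: "sO h Qf 0 (\<lambda>n k \<gamma> \<epsilon>. c / alpha (\<D> n) \<gamma> k)"
proof (rule sO_I[where K="\<bar>c\<bar> * C"])
  fix n k \<gamma> and \<epsilon> :: facet assume q: "Qf n k \<gamma> \<epsilon>"
  then have "1 / alpha (\<D> n) \<gamma> k \<le> C"
    using scal_unfolded(6)[of k n \<gamma>] L.alpha_pos[of k n \<gamma>] by (simp add: field_simps)
  from mult_left_mono[OF this, of "\<bar>c\<bar>"] show "0 < h n \<and> \<bar>c / alpha (\<D> n) \<gamma> k\<bar> \<le> \<bar>c\<bar> * C * h n powi 0"
    using q L.alpha_pos[of k n \<gamma>] h_pos[of k n] by simp
qed

text \<open>A weight is at most the length of the facet tangent. By the chain rule for \<Psi> (h z)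
  this length carries a factor h; the 4 counts two components with two partial derivatives
  each.\<close>

lemma mO_Bm: "mO h Qf 1 (\<lambda>n k \<gamma> \<epsilon>. Bm (\<D> n) \<gamma>)"
proof -
  let ?S = "cball 0 (2 * \<bar>H\<bar>) :: (real^2) set"
  obtain N where N: "N \<ge> 0" "\<And>n k. k < nel (\<D> n) \<Longrightarrow> \<exists>\<Psi>. (\<forall>z. emap (\<D> n) k z = \<Psi> (h n *\<^sub>R z)) \<and>
    (\<forall>l. bdd ?S (p + 1) N (\<lambda>w. \<Psi> w $ l))" using scaled_emap by metis
  have "\<bar>fwt (\<D> n) \<gamma> $ a\<bar> \<le> 4 * N * h n" if k: "k < nel (\<D> n)" and g: "\<gamma> \<in> facets (\<D> n) k" for n k \<gamma> a
  proof -
    obtain \<Psi> where \<Psi>: "\<And>z. emap (\<D> n) k z = \<Psi> (h n *\<^sub>R z)" "\<And>l. bdd ?S (p + 1) N (\<lambda>w. \<Psi> w $ l)"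
      using N(2)[OF k] by blast
    obtain e s w where e: "e < 3" "s a \<in> {0<..<1}" "w a > 0" "w a \<le> 1"
      "fwt (\<D> n) \<gamma> $ a = w a * norm (ftangent (\<D> n) k e (s a))"
      using L.facet_nodes[OF k g] by metis
    define z where "z = redge e (s a)"
    define t where "t = rvert (Suc e mod 3) - rvert e"
    have z: "z \<in> ref_triangle" unfolding z_def using e(2) by (intro redge_in) auto
    have d: "(\<lambda>w. \<Psi> w $ l) differentiable (at w)" for l w using \<Psi>(2)[of l] by simp
    have "((\<lambda>x. h n *\<^sub>R x) has_derivative (\<lambda>v. h n *\<^sub>R v)) (at z)" by (auto intro!: derivative_eq_intros)
    from has_derivative_compose[OF this differentiable_vec[OF d]]
    have D: "(emap (\<D> n) k has_derivative (\<lambda>v. \<chi> l. ddir (h n *\<^sub>R v) (\<lambda>w. \<Psi> w $ l) (h n *\<^sub>R z))) (at z)"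
      unfolding \<Psi>(1)[abs_def] .
    have "ftangent (\<D> n) k e (s a) = frechet_derivative (emap (\<D> n) k) (at z) t"
      unfolding ftangent_def z_def t_def using L.emap_edge_deriv[OF k] by (rule vector_derivative_at)
    also have "\<dots> = (\<chi> l. ddir (h n *\<^sub>R t) (\<lambda>w. \<Psi> w $ l) (h n *\<^sub>R z))"
      by (simp add: frechet_derivative_at[OF D, symmetric])
    finally have F: "ftangent (\<D> n) k e (s a) = (\<chi> l. ddir (h n *\<^sub>R t) (\<lambda>w. \<Psi> w $ l) (h n *\<^sub>R z))" .
    have "\<bar>ddir (h n *\<^sub>R t) (\<lambda>w. \<Psi> w $ l) (h n *\<^sub>R z)\<bar> \<le> (\<Sum>i\<in>(UNIV::2 set). h n * N)" for l
      unfolding ddir_def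
    proof (intro sum_abs[THEN order_trans] sum_mono)
      fix i :: 2
      have "bdd ?S p N (pd i (\<lambda>w. \<Psi> w $ l))" using \<Psi>(2)[of l] by simp
      from bdd_le[OF this scaled_point(2)[OF k z]] have "\<bar>pd i (\<lambda>w. \<Psi> w $ l) (h n *\<^sub>R z)\<bar> \<le> N" .
      moreover have "\<bar>t $ i\<bar> \<le> 1"
        using ref_triangle_bounds[OF rvert_in[of e], of i] ref_triangle_bounds[OF rvert_in[of "Suc e mod 3"], of i]
        unfolding t_def vector_minus_component abs_le_iff by linarith
      ultimately have "\<bar>t $ i\<bar> * \<bar>pd i (\<lambda>w. \<Psi> w $ l) (h n *\<^sub>R z)\<bar> \<le> 1 * N" by (intro mult_mono) auto
      then show "\<bar>(h n *\<^sub>R t) $ i * pd i (\<lambda>w. \<Psi> w $ l) (h n *\<^sub>R z)\<bar> \<le> h n * N"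
        using h_pos[OF k] by (simp add: abs_mult mult.assoc)
    qed
    then have "norm (ftangent (\<D> n) k e (s a)) \<le> 2 * (2 * (h n * N))"
      unfolding F by (intro norm_le_components) simp
    then have "w a * norm (ftangent (\<D> n) k e (s a)) \<le> 1 * (2 * (2 * (h n * N)))"
      using e(3,4) by (intro mult_mono) auto
    then show ?thesis using e(3,5) by (simp add: abs_mult mult_ac)
  qed
  then show ?thesis unfolding Bm_def by (intro mO_diagm sO_I[where K="4 * N"]) (auto simp: h_pos)
qed

end

lemma vO_mv': "mO h Q s A \<Longrightarrow> vO h Q t X \<Longrightarrow> s + t = r \<Longrightarrow> vO h Q r (\<lambda>n k \<gamma> \<epsilon>. A n k \<gamma> \<epsilon> *v X n k \<gamma> \<epsilon>)"
  using vO_mv by blast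

lemma mO_mult': "mO h Q s A \<Longrightarrow> mO h Q t B \<Longrightarrow> s + t = r \<Longrightarrow> mO h Q r (\<lambda>n k \<gamma> \<epsilon>. A n k \<gamma> \<epsilon> ** B n k \<gamma> \<epsilon>)"
  using mO_mult by blast

lemma vO_mono: "vO h Q s X \<Longrightarrow> (\<And>n k \<gamma> \<epsilon>. Q' n k \<gamma> \<epsilon> \<Longrightarrow> Q n k \<gamma> \<epsilon>) \<Longrightarrow> vO h Q' s X"
  and mO_mono: "mO h Q s A \<Longrightarrow> (\<And>n k \<gamma> \<epsilon>. Q' n k \<gamma> \<epsilon> \<Longrightarrow> Q n k \<gamma> \<epsilon>) \<Longrightarrow> mO h Q' s A"
  unfolding mO_def vO_def sO_def by meson+

lemma vO_cong:
  "vO h Q s X \<Longrightarrow> (\<And>n k \<gamma> \<epsilon>. Q n k \<gamma> \<epsilon> \<Longrightarrow> Y n k \<gamma> \<epsilon> = X n k \<gamma> \<epsilon>) \<Longrightarrow> vO h Q s Y"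
  and mO_cong:
  "mO h Q s A \<Longrightarrow> (\<And>n k \<gamma> \<epsilon>. Q n k \<gamma> \<epsilon> \<Longrightarrow> B n k \<gamma> \<epsilon> = A n k \<gamma> \<epsilon>) \<Longrightarrow> mO h Q s B"
  unfolding mO_def vO_def sO_def by simp_all

text \<open>For \<open>m\<close> at least 2 the remainder is quadratically small at
  \<open>x\<close>, so its derivative there is 0. The derivative of the Taylor polynomial is found
  without differentiating its terms.\<close>

lemma taylor_pd:
  assumes f: "bdd (cball x 1) m M f" "0 \<le> M" "2 \<le> m" and P: "(\<lambda>y. taylor m f x (y - x)) differentiable (at x)"
  shows "pd i (\<lambda>y. taylor m f x (y - x)) x = pd i f x"
proof -
  define P where "P y = taylor m f x (y - x)" for y
  have fd: "f differentiable (at x)" using f(1,3) by (cases m) auto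
  have T: "\<bar>f y - P y\<bar> \<le> 2^m * M * norm (y - x) * norm (y - x)" if "norm (y - x) \<le> 1" for y
  proof -
    have "\<bar>f y - P y\<bar> \<le> (2 * norm (y - x))^m * M"
      unfolding P_def using that f(3) by (intro taylor_bound[OF f(1,2)]) (auto simp: dist_norm norm_minus_commute)
    moreover have "norm (y - x) ^ m \<le> norm (y - x) ^ 2" using that f(3) by (intro power_decreasing) auto
    then have "2^m * M * norm (y - x) ^ m \<le> 2^m * M * norm (y - x) ^ 2"
      using f(2) by (intro mult_left_mono) auto
    ultimately show ?thesis by (simp add: power_mult_distrib power2_eq_square mult_ac)
  qed
  have "((\<lambda>y. f y - P y) has_derivative (\<lambda>_. 0)) (at x within UNIV)"
  proof (rule has_derivativeI_sandwich[where e=1 and H="\<lambda>y. 2^m * M * norm (y - x)"])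
    have "((\<lambda>y. 2^m * M * norm (y - x)) \<longlongrightarrow> 2^m * M * norm (x - x)) (at x within UNIV)"
      by (intro tendsto_intros)
    then show "((\<lambda>y. 2^m * M * norm (y - x)) \<longlongrightarrow> 0) (at x within UNIV)" by simp
    fix y assume "y \<noteq> x" "dist y x < 1"
    then have y: "norm (y - x) \<le> 1" "0 < norm (y - x)" by (auto simp: dist_norm)
    have "\<bar>f x - P x\<bar> \<le> 0" using T[of x] by simp
    then have "norm (f y - P y - (f x - P x) - 0) \<le> 2^m * M * norm (y - x) * norm (y - x)"
      using T[OF y(1)] by simp
    then show "norm (f y - P y - (f x - P x) - 0) / norm (y - x) \<le> 2^m * M * norm (y - x)"
      using y(2) by (simp add: pos_divide_le_eq)
  qed auto
  from pd_eq[OF this] have "pd i (\<lambda>y. f y - P y) x = 0" .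
  moreover have "pd i (\<lambda>y. f y - P y) x = pd i f x - pd i P x"
    using pd_eq[OF has_derivative_diff[OF has_derivative_ddir[OF fd] has_derivative_ddir[OF P[folded P_def]]]]
    by (simp add: ddir_axis)
  ultimately show ?thesis by (simp add: P_def[abs_def])
qed

section \<open>Accuracy of the discrete derivatives and fluxes\<close>

context ldg_family begin

interpretation L: ldg_disc p pb "\<D> n" g "\<T> n" for n
  by (rule disc)

lemma dom_compact: "compact (dom pb)"
  using L.dp unfolding diffusion_problem_def by (elim conjE)

lemma C_nonneg:
  assumes "k < nel (\<D> n)" shows "0 \<le> C"
proof -
  have "0 \<le> C / h n" using scal_unfolded(5)[OF assms, of 1 undefined undefined] by linarith
  then show ?thesis using h_pos[OF assms] by (simp add: zero_le_divide_iff)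
qed

lemma accuracy:
  assumes "bdd S (p + 1) M w" "dom pb \<subseteq> S" "k < nel (\<D> n)"
  shows "\<bar>(Dm (\<D> n) k i *v nodal (\<D> n) w k) $ a - pd i w (vnode (\<D> n) k a)\<bar> \<le> C * h n ^ p * M"
proof -
  have "Ck (p + 1) w \<and> (\<forall>is. length is \<le> p + 1 \<longrightarrow> (\<forall>x\<in>dom pb. \<bar>foldr pd is w x\<bar> \<le> M))"
    using bdd_Ck[OF assms(1)] bdd_foldr[OF assms(1)] assms(2) by blast
  then show ?thesis using acc[of n] assms(3) unfolding order_accurate_def by blast
qed

lemma vO_deriv:
  assumes "Ck (p + 1) U"
  shows "vO h Qe (int p) (\<lambda>n k \<gamma> \<epsilon>. Dm (\<D> n) k i *v nodal (\<D> n) U k - nodal (\<D> n) (pd i U) k)"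
proof -
  obtain M where M: "bdd (dom pb) (p + 1) M U" using Ck_bdd[OF dom_compact assms] by blast
  show ?thesis unfolding vO_def
    by (intro allI sO_I[where K="C * M"])
      (use accuracy[OF M order_refl] in \<open>auto simp: h_pos nodal_def mult_ac\<close>)
qed

text \<open>
  The fluxes are only of class \<open>C\<^sup>p\<close>, so the accuracy of \<open>D\<close> is applied to their Taylor polynomials of
  degree \<open>p - 1\<close>; dividing the remainder by \<open>h\<close> costs one order.
\<close>

lemma vO_deriv_low:
  assumes "Ck p w"
  shows "vO h Qe (int p - 1) (\<lambda>n k \<gamma> \<epsilon>. Dm (\<D> n) k i *v nodal (\<D> n) w k - nodal (\<D> n) (pd i w) k)"
proof -
  obtain \<rho> where \<rho>: "\<rho> > 0" "dom pb \<subseteq> cball 0 \<rho>" using dom_bounded by blast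
  \<comment> \<open>A convex set around the domain that also contains the unit ball about every
    node, as \<open>taylor_pd\<close> requires.\<close>
  define S where "S = (cball 0 (\<rho> + 1) :: (real^2) set)"
  have S: "convex S" "dom pb \<subseteq> S" using \<rho> by (auto simp: S_def)
  obtain M where M: "0 \<le> M" "bdd S p M w" using Ck_bdd[OF _ assms, of S] by (auto simp: S_def)
  define N where "N = 2 * (\<rho> + 1)"
  have N: "1 \<le> N" using \<rho> by (simp add: N_def)
  \<comment> \<open>The factor per degree in \<open>taylor_bdd\<close> for \<open>q = p + 1\<close>,
    the smoothness that \<open>order_accurate\<close> asks for.\<close>
  define c where "c = 2 * (2^(p + 1) * N)"
  define M' where "M' = (\<Sum>j<p. \<bar>1 / fact j\<bar> * (c^j * M))"
  have c: "0 \<le> c" using N by (simp add: c_def)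
  have M': "0 \<le> M'" unfolding M'_def using c M(1) by (intro sum_nonneg mult_nonneg_nonneg) auto
  \<comment> \<open>Three contributions: the error of D on the Taylor polynomial, D applied to the
    remainder, and the difference of the two derivatives at the node.\<close>
  define K where "K = C * \<bar>H\<bar> * M' + real CARD('n) * (C * (2^p * M)) + M"
  have "\<bar>(Dm (\<D> n) k i *v nodal (\<D> n) w k) $ a - pd i w (vnode (\<D> n) k a)\<bar> \<le> K * h n ^ (p - 1)"
    if k: "k < nel (\<D> n)" for n k a
  proof -
    define x where "x = vnode (\<D> n) k a"
    note hp = h_pos[OF k] and C0 = C_nonneg[OF k]
    have xd: "vnode (\<D> n) k b \<in> S" for b using L.vnode_in_dom[OF k] S(2) by auto
    have x: "x \<in> S" "cball x 1 \<subseteq> S"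
    proof -
      have "norm x \<le> \<rho>" using L.vnode_in_dom[OF k, of a] \<rho>(2) by (auto simp: x_def)
      moreover have "norm y \<le> norm x + norm (x - y)" for y
        using norm_triangle_ineq4[of x "x - y"] by simp
      ultimately have "norm y \<le> \<rho> + 1" if "norm (x - y) \<le> 1" for y
        using that by (meson add_mono order_trans)
      then show "x \<in> S" "cball x 1 \<subseteq> S" unfolding S_def by (auto simp: dist_norm)
    qed
    define P where "P y = taylor p w x (y - x)" for y
    have "\<bar>y $ l - x $ l\<bar> \<le> N" if "y \<in> S" for l y
    proof -
      have "\<bar>y $ l\<bar> \<le> \<rho> + 1" "\<bar>x $ l\<bar> \<le> \<rho> + 1"
        using that x(1) component_le_norm_cart[of y l] component_le_norm_cart[of x l] by (auto simp: S_def)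
      then show ?thesis using abs_triangle_ineq4[of "y $ l" "x $ l"] by (simp add: N_def)
    qed
    note tb = taylor_bdd[where S=S and x=x and q="p + 1", OF this N x(1), folded c_def]
    have "bdd S (p + 1) M' (\<lambda>y. \<Sum>j<p. 1 / fact j * (ddir (y - x) ^^ j) w x)"
      unfolding M'_def using M(1) by (intro bdd_sum bdd_cmult tb bdd_leD[OF _ M(2)]) auto
    then have P: "bdd S (p + 1) M' P" unfolding P_def[abs_def] taylor_def by simp
    have rem: "\<bar>w (vnode (\<D> n) k b) - P (vnode (\<D> n) k b)\<bar> \<le> (2 * h n)^p * M" for b
      unfolding P_def using p vnode_dist[OF k] by (intro taylor_bound[OF M(2,1) _ S(1) x(1) xd]) (auto simp: x_def)
    have 1: "\<bar>(Dm (\<D> n) k i *v nodal (\<D> n) P k) $ a - pd i P x\<bar> \<le> C * \<bar>H\<bar> * M' * h n ^ (p - 1)"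
    proof -
      have "C * M' * h n ^ (p - 1) * h n \<le> C * M' * h n ^ (p - 1) * \<bar>H\<bar>"
        using C0 M' hp H[of n] by (intro mult_left_mono) auto
      moreover have "h n ^ p = h n ^ (p - 1) * h n" using p by (metis power_minus_mult zero_less_one order_less_le_trans)
      ultimately show ?thesis using accuracy[OF P S(2) k, of i a] unfolding x_def by (simp add: mult_ac)
    qed
    have 2: "\<bar>(Dm (\<D> n) k i *v nodal (\<D> n) w k) $ a - (Dm (\<D> n) k i *v nodal (\<D> n) P k) $ a\<bar> \<le>
        real CARD('n) * (C * (2^p * M)) * h n ^ (p - 1)"
    proof -
      have "(Dm (\<D> n) k i *v nodal (\<D> n) w k) $ a - (Dm (\<D> n) k i *v nodal (\<D> n) P k) $ a =
          (\<Sum>b\<in>UNIV. Dm (\<D> n) k i $ a $ b * (w (vnode (\<D> n) k b) - P (vnode (\<D> n) k b)))"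
        by (simp add: matrix_vector_mult_def nodal_def right_diff_distrib sum_subtractf)
      also have "\<bar>\<dots>\<bar> \<le> (\<Sum>b\<in>(UNIV::'n set). C / h n * ((2 * h n)^p * M))"
        using C0 hp
        by (intro sum_abs[THEN order_trans] sum_mono, unfold abs_mult, intro mult_mono rem scal_unfolded(5)[OF k]) auto
      also have "\<dots> = real CARD('n) * (C * (2^p * M)) * (h n ^ p / h n)"
        by (simp add: power_mult_distrib)
      also have "h n ^ p / h n = h n ^ (p - 1)" using p hp by (simp add: power_diff)
      finally show ?thesis .
    qed
    \<comment> \<open>The derivatives agree unless \<open>p = 1\<close>. Then the Taylor polynomial
      is constant, and the bound is just that of the derivative of \<open>w\<close>, as h^0 =
      1.\<close>
    have 3: "\<bar>pd i P x - pd i w x\<bar> \<le> M * h n ^ (p - 1)"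
    proof (cases "p = 1")
      case True
      then have "P = (\<lambda>y. w x)" by (simp add: P_def[abs_def] taylor_def)
      moreover have "bdd S 0 M (pd i w)" using M(2) True by simp
      ultimately show ?thesis using True bdd_le[of S 0 M "pd i w" x] x(1) by simp
    next
      case False
      have "(\<lambda>y. taylor p w x (y - x)) differentiable (at x)" using P by (simp add: P_def[abs_def])
      from taylor_pd[OF bdd_mono[OF M(2) order_refl x(2)] M(1) _ this, of i] p False
      have "pd i P x = pd i w x" by (simp add: P_def[abs_def])
      then show ?thesis using M(1) hp by simp
    qed
    show ?thesis using 1 2 3 unfolding K_def distrib_right x_def by linarith
  qed
  moreover have "h n ^ (p - 1) = h n powi (int p - 1)" for n
    using p by (simp add: power_int_def nat_diff_distrib of_nat_diff)
  ultimately show ?thesis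
    unfolding vO_def by (intro allI sO_I[where K=K]) (auto simp: h_pos nodal_def)
qed

lemma flux_nth: "flux pb U y $ i = (\<Sum>j\<in>UNIV. lam pb y $ i $ j * pd j U y)"
  by (simp add: flux_def grad_def matrix_vector_mult_def)

lemma flux_smooth: "Ck (p + 1) U \<Longrightarrow> Ck p (\<lambda>y. flux pb U y $ i)"
  unfolding flux_nth by (intro Ck_sum Ck_mult lam_smooth) auto

lemma nodal_flux:
  "nodal (\<D> n) (\<lambda>y. flux pb U y $ i) k = (\<Sum>j\<in>UNIV. Lam pb (\<D> n) k i j *v nodal (\<D> n) (pd j U) k)"
  by (simp add: vec_eq_iff nodal_def Lam_def diagm_mv flux_nth sum_component)

lemma vO_flux:
  assumes "Ck (p + 1) U"
  shows "vO h Qe (int p) (\<lambda>n k \<gamma> \<epsilon>. (\<Sum>j\<in>UNIV. Lam pb (\<D> n) k i j *v (Dm (\<D> n) k j *v nodal (\<D> n) U k))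
    - nodal (\<D> n) (\<lambda>y. flux pb U y $ i) k)"
proof -
  have "vO h Qe (int p) (\<lambda>n k \<gamma> \<epsilon>. \<Sum>j\<in>UNIV. Lam pb (\<D> n) k i j *v
      (Dm (\<D> n) k j *v nodal (\<D> n) U k - nodal (\<D> n) (pd j U) k))"
    by (intro vO_sum vO_mv'[OF mO_Lam vO_deriv[OF assms]]) auto
  then show ?thesis by (simp add: nodal_flux matrix_vector_mult_diff_distrib sum_subtractf)
qed

text \<open>Two errors of order \<open>p - 1\<close> meet: the O(h^p) error of the discrete flux,
  amplified by the size 1/h of D, and the error of D on the exact flux.\<close>

lemma vO_D2:
  assumes "Ck (p + 1) U"
  shows "vO h Qe (int p - 1) (\<lambda>n k \<gamma> \<epsilon>. D2 pb (\<D> n) k *v nodal (\<D> n) U k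
    - nodal (\<D> n) (\<lambda>x. \<Sum>i\<in>UNIV. pd i (\<lambda>y. flux pb U y $ i) x) k)"
proof -
  have "vO h Qe (int p - 1) (\<lambda>n k \<gamma> \<epsilon>. \<Sum>i\<in>UNIV.
      Dm (\<D> n) k i *v ((\<Sum>j\<in>UNIV. Lam pb (\<D> n) k i j *v (Dm (\<D> n) k j *v nodal (\<D> n) U k))
        - nodal (\<D> n) (\<lambda>y. flux pb U y $ i) k) +
      (Dm (\<D> n) k i *v nodal (\<D> n) (\<lambda>y. flux pb U y $ i) k - nodal (\<D> n) (pd i (\<lambda>y. flux pb U y $ i)) k))"
    by (intro vO_sum vO_add vO_mv'[OF mO_Dm vO_flux[OF assms]] vO_deriv_low flux_smooth assms) auto
  moreover have "D2 pb (\<D> n) k *v nodal (\<D> n) U k - nodal (\<D> n) (\<lambda>x. \<Sum>i\<in>UNIV. pd i (\<lambda>y. flux pb U y $ i) x) k =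
      (\<Sum>i\<in>UNIV. Dm (\<D> n) k i *v ((\<Sum>j\<in>UNIV. Lam pb (\<D> n) k i j *v (Dm (\<D> n) k j *v nodal (\<D> n) U k))
        - nodal (\<D> n) (\<lambda>y. flux pb U y $ i) k) +
      (Dm (\<D> n) k i *v nodal (\<D> n) (\<lambda>y. flux pb U y $ i) k - nodal (\<D> n) (pd i (\<lambda>y. flux pb U y $ i)) k))" for n k
  proof -
    have "D2 pb (\<D> n) k *v nodal (\<D> n) U k = (\<Sum>i\<in>UNIV. Dm (\<D> n) k i *v
        (\<Sum>j\<in>UNIV. Lam pb (\<D> n) k i j *v (Dm (\<D> n) k j *v nodal (\<D> n) U k)))"
      by (simp add: D2_def matrix_sum_mv matrix_mv_sum matrix_vector_mul_assoc[symmetric])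
    moreover have "nodal (\<D> n) (\<lambda>x. \<Sum>i\<in>UNIV. pd i (\<lambda>y. flux pb U y $ i) x) k =
        (\<Sum>i\<in>UNIV. nodal (\<D> n) (pd i (\<lambda>y. flux pb U y $ i)) k)"
      by (simp add: nodal_def vec_eq_iff sum_component)
    ultimately show ?thesis by (simp add: matrix_vector_mult_diff_distrib sum_subtractf)
  qed
  ultimately show ?thesis by simp
qed

text \<open>The error of the discrete flux, carried to the facet by the bounded R, and the error of
  extrapolating the exact flux both have order \<open>p\<close>.\<close>

lemma vO_Dg:
  assumes "Ck (p + 1) U"
  shows "vO h Qf (int p) (\<lambda>n k \<gamma> \<epsilon>. Dg pb (\<D> n) \<gamma> k *v nodal (\<D> n) U k
    - (\<chi> a. flux pb U (fnode (\<D> n) \<gamma> a) \<bullet> nrm (\<D> n) \<gamma> k a))"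
proof -
  have e: "vO h Qf (int p) (\<lambda>n k \<gamma> \<epsilon>. (\<Sum>j\<in>UNIV. Lam pb (\<D> n) k i j *v (Dm (\<D> n) k j *v nodal (\<D> n) U k))
    - nodal (\<D> n) (\<lambda>y. flux pb U y $ i) k)" for i
    by (rule vO_mono[OF vO_flux[OF assms]]) auto
  have x: "vO h Qf (int p) (\<lambda>n k \<gamma> \<epsilon>. Rm (\<D> n) \<gamma> k *v nodal (\<D> n) (\<lambda>y. flux pb U y $ i) k
      - fnodal (\<D> n) (\<lambda>y. flux pb U y $ i) \<gamma>)" for i
    using p by (intro vO_extrapolation flux_smooth assms) auto
  have "vO h Qf (int p) (\<lambda>n k \<gamma> \<epsilon>. \<Sum>i\<in>UNIV. Nm (\<D> n) \<gamma> k i *v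
      (Rm (\<D> n) \<gamma> k *v ((\<Sum>j\<in>UNIV. Lam pb (\<D> n) k i j *v (Dm (\<D> n) k j *v nodal (\<D> n) U k))
        - nodal (\<D> n) (\<lambda>y. flux pb U y $ i) k) +
       (Rm (\<D> n) \<gamma> k *v nodal (\<D> n) (\<lambda>y. flux pb U y $ i) k - fnodal (\<D> n) (\<lambda>y. flux pb U y $ i) \<gamma>)))"
    by (intro vO_sum vO_mv'[OF mO_Nm] vO_add vO_mv'[OF mO_Rm e]) (auto intro: x)
  moreover have "Dg pb (\<D> n) \<gamma> k *v nodal (\<D> n) U k - (\<chi> a. flux pb U (fnode (\<D> n) \<gamma> a) \<bullet> nrm (\<D> n) \<gamma> k a) =
     (\<Sum>i\<in>UNIV. Nm (\<D> n) \<gamma> k i *v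
      (Rm (\<D> n) \<gamma> k *v ((\<Sum>j\<in>UNIV. Lam pb (\<D> n) k i j *v (Dm (\<D> n) k j *v nodal (\<D> n) U k))
        - nodal (\<D> n) (\<lambda>y. flux pb U y $ i) k) +
       (Rm (\<D> n) \<gamma> k *v nodal (\<D> n) (\<lambda>y. flux pb U y $ i) k - fnodal (\<D> n) (\<lambda>y. flux pb U y $ i) \<gamma>)))" for n k \<gamma>
  proof -
    have "(\<chi> a. flux pb U (fnode (\<D> n) \<gamma> a) \<bullet> nrm (\<D> n) \<gamma> k a) =
        (\<Sum>i\<in>UNIV. Nm (\<D> n) \<gamma> k i *v fnodal (\<D> n) (\<lambda>y. flux pb U y $ i) \<gamma>)"
      by (simp add: vec_eq_iff sum_component Nm_def diagm_mv fnodal_def inner_vec_def mult.commute)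
    then show ?thesis
      by (simp add: L.Dg_mv matrix_vector_mult_diff_distrib sum_subtractf matrix_mv_sum)
  qed
  ultimately show ?thesis by simp
qed

lemma mO_Dg: "mO h Qf (- 1) (\<lambda>n k \<gamma> \<epsilon>. Dg pb (\<D> n) \<gamma> k)"
  unfolding Dg_def
  by (intro mO_sum mO_mult'[OF mO_mult'[OF mO_mult'[OF mO_Nm mO_Rm] mO_mono[OF mO_Lam]] mO_mono[OF mO_Dm]]) auto

lemma mO_Ups: "mO h Qff (- 2) (\<lambda>n k \<gamma> \<epsilon>. Ups pb (\<D> n) \<gamma> \<epsilon> k)"
proof -
  have R: "mO h Qff 0 (\<lambda>n k \<gamma> \<epsilon>. Rm (\<D> n) \<epsilon> k)"
    by (rule mO_pull[where K="\<lambda>n k \<gamma> \<epsilon>. k" and G="\<lambda>n k \<gamma> \<epsilon>. \<epsilon>" and E="\<lambda>n k \<gamma> \<epsilon>. \<epsilon>", OF mO_Rm]) auto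
  have N: "mO h Qff 0 (\<lambda>n k \<gamma> \<epsilon>. Nm (\<D> n) \<epsilon> k j)" for j
    by (rule mO_pull[where K="\<lambda>n k \<gamma> \<epsilon>. k" and G="\<lambda>n k \<gamma> \<epsilon>. \<epsilon>" and E="\<lambda>n k \<gamma> \<epsilon>. \<epsilon>", OF mO_Nm]) auto
  show ?thesis
    unfolding Ups_def
    by (intro mO_sum mO_mult'[OF mO_mult'[OF mO_mult'[OF mO_mult'[OF mO_mult'[OF mO_mono[OF mO_Nm] mO_mono[OF mO_Rm]]
      mO_mono[OF mO_Hinv]] mO_mono[OF mO_Lam]] mO_transpose[OF R]] N]) auto
qed

end

lemma sO_bounded:
  assumes "\<And>n k \<gamma> \<epsilon>. Q n k \<gamma> \<epsilon> \<Longrightarrow> 0 < h n \<and> \<bar>c n k \<gamma> \<epsilon>\<bar> \<le> K"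
  shows "sO h Q 0 c"
  using assms by (intro sO_I[where K=K]) auto

section \<open>Sizes of the penalty terms and the truncation error\<close>

context ldg_family begin

interpretation L: ldg_disc p pb "\<D> n" g "\<T> n" for n
  by (rule disc)

abbreviation Qii :: "bool indexed" where
  "Qii n k \<gamma> \<epsilon> \<equiv> k < nel (\<D> n) \<and> \<gamma> \<in> ifacets (\<D> n) k \<and> \<epsilon> \<in> ifacets (\<D> n) k - {\<gamma>}"
abbreviation Qin :: "bool indexed" where
  "Qin n k \<gamma> \<delta> \<equiv> k < nel (\<D> n) \<and> \<gamma> \<in> ifacets (\<D> n) k \<and> \<delta> \<in> ifacets (\<D> n) (nb (\<D> n) k \<gamma>) - {\<gamma>}"

lemma Qi_Qf: "Qi n k \<gamma> \<epsilon> \<Longrightarrow> Qf n k \<gamma> \<epsilon>"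
  using L.ifacets_subset by blast

lemma beta_le: "Qi n k \<gamma> \<epsilon> \<Longrightarrow> \<bar>beta (\<D> n) \<gamma> k\<bar> \<le> 1"
  using L.beta_cases[of k n \<gamma>] by auto

lemma Qi_nb: "Qi n k \<gamma> \<epsilon> \<Longrightarrow> Qi n (nb (\<D> n) k \<gamma>) \<gamma> \<epsilon>"
  using L.nb[of k n \<gamma>] by blast

lemma sO_beta: "sO h Qi 0 (\<lambda>n k \<gamma> \<epsilon>. beta (\<D> n) \<gamma> k)"
  by (rule sO_bounded[where K=1]) (use beta_le h_pos in auto)

lemmas pull_nb = mO_pull[where K="\<lambda>n k \<gamma> \<epsilon>. nb (\<D> n) k \<gamma>" and G="\<lambda>n k \<gamma> \<epsilon>. \<gamma>" and E="\<lambda>n k \<gamma> \<epsilon>. \<epsilon>"]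

lemma mO_Ups_own: "mO h Qi (- 2) (\<lambda>n k \<gamma> \<epsilon>. (2 * beta (\<D> n) \<gamma> k / alpha (\<D> n) \<gamma> k) *\<^sub>R Ups pb (\<D> n) \<gamma> \<gamma> k)"
proof -
  have U: "mO h Qi (- 2) (\<lambda>n k \<gamma> \<epsilon>. Ups pb (\<D> n) \<gamma> \<gamma> k)"
    by (rule mO_pull[where K="\<lambda>n k \<gamma> \<epsilon>. k" and G="\<lambda>n k \<gamma> \<epsilon>. \<gamma>" and E="\<lambda>n k \<gamma> \<epsilon>. \<gamma>", OF mO_Ups])
      (use L.ifacets_subset in auto)
  have a: "sO h Qi 0 (\<lambda>n k \<gamma> \<epsilon>. 2 / alpha (\<D> n) \<gamma> k)"
    using sO_alpha[of 2] Qi_Qf unfolding sO_def by meson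
  from mO_scaleR[OF sO_mult[OF sO_beta a] U] show ?thesis by (simp add: mult.commute)
qed

text \<open>The exponents are 1 - 2 + 1: the two factors \<open>Bm\<close> compensate the
  \<open>Hinv\<close> inside \<open>Ups\<close>.\<close>

lemma mO_T1: "mO h Qi 0 (\<lambda>n k \<gamma> \<epsilon>. T1 (\<T> n) \<gamma> k)"
proof (rule mO_cong)
  show "mO h Qi 0 (\<lambda>n k \<gamma> \<epsilon>. Bm (\<D> n) \<gamma> ** ((2 * beta (\<D> n) \<gamma> k / alpha (\<D> n) \<gamma> k) *\<^sub>R Ups pb (\<D> n) \<gamma> \<gamma> k
      + (2 * beta (\<D> n) \<gamma> (nb (\<D> n) k \<gamma>) / alpha (\<D> n) \<gamma> (nb (\<D> n) k \<gamma>)) *\<^sub>R Ups pb (\<D> n) \<gamma> \<gamma> (nb (\<D> n) k \<gamma>)) ** Bm (\<D> n) \<gamma>)"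
    by (intro mO_mult'[OF mO_mult'[OF mO_mono[OF mO_Bm] mO_add[OF mO_Ups_own pull_nb[OF mO_Ups_own]]] mO_mono[OF mO_Bm]])
      (use Qi_Qf Qi_nb in auto)
qed (use L.sat_interior(1) in blast)

lemma mO_Bm_scaled:
  assumes "sO h Qi 0 c" shows "mO h Qi 1 (\<lambda>n k \<gamma> \<epsilon>. c n k \<gamma> \<epsilon> *\<^sub>R Bm (\<D> n) \<gamma>)"
  using mO_scaleR[OF assms mO_mono[OF mO_Bm Qi_Qf]] by simp

lemma mO_T2: "mO h Qi 1 (\<lambda>n k \<gamma> \<epsilon>. T2 (\<T> n) \<gamma> k)"
  by (rule mO_cong[OF mO_Bm_scaled[OF sO_minus[OF sO_beta]]]) (use L.sat_interior(2) in blast)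

lemma mO_T3: "mO h Qi 1 (\<lambda>n k \<gamma> \<epsilon>. T3 (\<T> n) \<gamma> k)"
proof (rule mO_cong[OF mO_Bm_scaled])
  show "sO h Qi 0 (\<lambda>n k \<gamma> \<epsilon>. beta (\<D> n) \<gamma> (nb (\<D> n) k \<gamma>))"
    by (rule sO_bounded[where K=1]) (use beta_le[OF Qi_nb] h_pos in auto)
qed (use L.sat_interior(3) in blast)

lemma mO_T5: "mO h Qii 0 (\<lambda>n k \<gamma> \<epsilon>. T5 (\<T> n) \<gamma> \<epsilon> k)"
proof (rule mO_cong)
  have b: "sO h Qii 0 (\<lambda>n k \<gamma> \<epsilon>. beta (\<D> n) \<gamma> k * beta (\<D> n) \<epsilon> k / 4)"
  proof (rule sO_bounded[where K=1])
    fix n k \<gamma> \<epsilon> assume q: "Qii n k \<gamma> \<epsilon>"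
    then have "\<bar>beta (\<D> n) \<gamma> k\<bar> * \<bar>beta (\<D> n) \<epsilon> k\<bar> \<le> 1 * 1"
      by (intro mult_mono beta_le) auto
    then show "0 < h n \<and> \<bar>beta (\<D> n) \<gamma> k * beta (\<D> n) \<epsilon> k / 4\<bar> \<le> 1" using h_pos q by (auto simp: abs_mult)
  qed
  have B: "mO h Qii 1 (\<lambda>n k \<gamma> \<epsilon>. Bm (\<D> n) \<epsilon>)"
    by (rule mO_pull[where K="\<lambda>n k \<gamma> \<epsilon>. k" and G="\<lambda>n k \<gamma> \<epsilon>. \<epsilon>" and E="\<lambda>n k \<gamma> \<epsilon>. \<epsilon>", OF mO_Bm])
      (use L.ifacets_subset in auto)
  have "mO h Qii 0 (\<lambda>n k \<gamma> \<epsilon>. Bm (\<D> n) \<gamma> ** Ups pb (\<D> n) \<gamma> \<epsilon> k ** Bm (\<D> n) \<epsilon>)"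
    by (intro mO_mult'[OF mO_mult'[OF mO_mono[OF mO_Bm] mO_mono[OF mO_Ups]] B])
      (use L.ifacets_subset in auto)
  from mO_scaleR[OF b this]
  show "mO h Qii 0 (\<lambda>n k \<gamma> \<epsilon>. (beta (\<D> n) \<gamma> k * beta (\<D> n) \<epsilon> k / 4) *\<^sub>R
      (Bm (\<D> n) \<gamma> ** Ups pb (\<D> n) \<gamma> \<epsilon> k ** Bm (\<D> n) \<epsilon>))" by simp
qed (use L.sat_interior(5) in blast)

lemma mO_T6: "mO h Qii 0 (\<lambda>n k \<gamma> \<epsilon>. T6 (\<T> n) \<gamma> \<epsilon> k)"
proof (rule mO_cong)
  have "sO h Qii 0 (\<lambda>n k \<gamma> \<epsilon>. - 1)" by (rule sO_bounded[where K=1]) (use h_pos in auto)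
  from mO_scaleR[OF this mO_T5] show "mO h Qii 0 (\<lambda>n k \<gamma> \<epsilon>. - T5 (\<T> n) \<gamma> \<epsilon> k)" by simp
qed (use L.sat_interior(6) in blast)

text \<open>Both sides extrapolate to the same values of \<open>U\<close> at the facet nodes, so the
  jump is a difference of two extrapolation errors.\<close>

lemma vO_jmp:
  assumes "Ck (p + 1) U"
  shows "vO h Qi (int p + 1) (\<lambda>n k \<gamma> \<epsilon>. jmp (\<D> n) (nodal (\<D> n) U) \<gamma> k)"
proof -
  have 1: "vO h Qi (int p + 1) (\<lambda>n k \<gamma> \<epsilon>. Rm (\<D> n) \<gamma> k *v nodal (\<D> n) U k - fnodal (\<D> n) U \<gamma>)"
    using vO_mono[OF vO_extrapolation[OF assms] Qi_Qf] by (simp add: add.commute)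
  have 2: "vO h Qi (int p + 1) (\<lambda>n k \<gamma> \<epsilon>. Rm (\<D> n) \<gamma> (nb (\<D> n) k \<gamma>) *v nodal (\<D> n) U (nb (\<D> n) k \<gamma>) - fnodal (\<D> n) U \<gamma>)"
    by (rule vO_pull[where K="\<lambda>n k \<gamma> \<epsilon>. nb (\<D> n) k \<gamma>" and G="\<lambda>n k \<gamma> \<epsilon>. \<gamma>" and E="\<lambda>n k \<gamma> \<epsilon>. \<epsilon>", OF 1]) (use Qi_nb in auto)
  from vO_diff[OF 1 2] show ?thesis by (simp add: jmp_def)
qed

text \<open>The exact normal fluxes cancel because the normals of the two sides are opposite; the
  errors of the two sides remain.\<close>

lemma vO_djmp:
  assumes "Ck (p + 1) U"
  shows "vO h Qi (int p) (\<lambda>n k \<gamma> \<epsilon>. djmp pb (\<D> n) (nodal (\<D> n) U) \<gamma> k)"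
proof -
  let ?e = "\<lambda>n k \<gamma>. Dg pb (\<D> n) \<gamma> k *v nodal (\<D> n) U k - (\<chi> a. flux pb U (fnode (\<D> n) \<gamma> a) \<bullet> nrm (\<D> n) \<gamma> k a)"
  have 1: "vO h Qi (int p) (\<lambda>n k \<gamma> \<epsilon>. ?e n k \<gamma>)"
    by (rule vO_mono[OF vO_Dg[OF assms] Qi_Qf])
  have 2: "vO h Qi (int p) (\<lambda>n k \<gamma> \<epsilon>. ?e n (nb (\<D> n) k \<gamma>) \<gamma>)"
    by (rule vO_pull[where K="\<lambda>n k \<gamma> \<epsilon>. nb (\<D> n) k \<gamma>" and G="\<lambda>n k \<gamma> \<epsilon>. \<gamma>" and E="\<lambda>n k \<gamma> \<epsilon>. \<epsilon>", OF 1]) (use Qi_nb in auto)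
  have "(\<chi> a. flux pb U (fnode (\<D> n) \<gamma> a) \<bullet> nrm (\<D> n) \<gamma> (nb (\<D> n) k \<gamma>) a) =
      - (\<chi> a. flux pb U (fnode (\<D> n) \<gamma> a) \<bullet> nrm (\<D> n) \<gamma> k a)" if "Qi n k \<gamma> \<epsilon>" for n k \<gamma> and \<epsilon> :: facet
    using that by (simp add: L.nrm_nb vec_eq_iff)
  then show ?thesis by (intro vO_cong[OF vO_add[OF 1 2]]) (simp add: djmp_def)
qed

lemma vO_cross:
  assumes "Ck (p + 1) U" and A: "mO h Qii 0 A"
  shows "vO h Qii (int p + 1) (\<lambda>n k \<gamma> \<epsilon>. A n k \<gamma> \<epsilon> *v jmp (\<D> n) (nodal (\<D> n) U) \<epsilon> k)"
proof (rule vO_mv'[OF A])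
  show "vO h Qii (int p + 1) (\<lambda>n k \<gamma> \<epsilon>. jmp (\<D> n) (nodal (\<D> n) U) \<epsilon> k)"
    by (rule vO_pull[where K="\<lambda>n k \<gamma> \<epsilon>. k" and G="\<lambda>n k \<gamma> \<epsilon>. \<epsilon>" and E="\<lambda>n k \<gamma> \<epsilon>. \<epsilon>", OF vO_jmp[OF assms(1)]]) auto
qed simp

lemma card_facet_subset: "F \<subseteq> facets (\<D> n) k \<Longrightarrow> card F \<le> 3"
  using card_mono[OF L.finite_facets] L.card_facets_le le_trans by blast

lemma card_ifacets: "card (ifacets (\<D> n) k - A) \<le> 3"
  by (rule card_facet_subset) (use L.ifacets_subset in blast)

text \<open>\<open>vO_facet_sum\<close> sums over the last index, so the facet is first moved
  there.\<close>

lemma vO_element_sum: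
  assumes "vO h Q s (\<lambda>n k \<gamma> \<epsilon>. X n k \<gamma>)" "\<And>n k. k < nel (\<D> n) \<Longrightarrow> F n k \<subseteq> facets (\<D> n) k"
    and "\<And>n k \<gamma> \<epsilon>. k < nel (\<D> n) \<Longrightarrow> \<gamma> \<in> F n k \<Longrightarrow> Q n k \<gamma> \<epsilon>"
  shows "vO h Qe s (\<lambda>n k \<gamma> \<epsilon>. \<Sum>\<gamma>\<in>F n k. X n k \<gamma>)"
proof -
  have "vO h (\<lambda>n k \<gamma> \<epsilon>. k < nel (\<D> n) \<and> \<epsilon> \<in> F n k) s (\<lambda>n k \<gamma> \<epsilon>. X n k \<epsilon>)"
    by (rule vO_pull[where K="\<lambda>n k \<gamma> \<epsilon>. k" and G="\<lambda>n k \<gamma> \<epsilon>. \<epsilon>" and E="\<lambda>n k \<gamma> \<epsilon>. \<epsilon>", OF assms(1)]) (use assms(3) in auto)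
  then show ?thesis
  proof (rule vO_facet_sum)
    fix n k and \<gamma> \<epsilon> :: facet assume k: "k < nel (\<D> n)"
    then show "0 < h n \<and> card (F n k) \<le> 3 \<and> (\<forall>\<delta>\<in>F n k. k < nel (\<D> n) \<and> \<delta> \<in> F n k)"
      using h_pos[OF k] card_facet_subset[OF assms(2)[OF k]] by blast
  qed
qed

lemma mO_RmT: "mO h Qi 0 (\<lambda>n k \<gamma> \<epsilon>. transpose (Rm (\<D> n) \<gamma> k))"
  by (rule mO_mono[OF mO_transpose[OF mO_Rm] Qi_Qf])

text \<open>The exponents add up to \<open>p + 1\<close> in every term: 0 + (p + 1) for
  \<open>T1\<close>, \<open>T5\<close> and \<open>T6\<close>, 1 + p for \<open>T3\<close>, and -1 +
  1 + (p + 1) for \<open>T2\<close> behind the transposed \<open>Dg\<close>.\<close>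

lemma vO_sI:
  assumes "Ck (p + 1) U"
  shows "vO h Qe (int p + 1) (\<lambda>n k \<gamma> \<epsilon>. sI pb (\<D> n) (\<T> n) (nodal (\<D> n) U) k)"
proof -
  let ?u = "\<lambda>n. nodal (\<D> n) U"
  have T4: "T4 (\<T> n) \<gamma> k = 0" if "Qi n k \<gamma> \<epsilon>" for n k \<gamma> and \<epsilon> :: facet
    using L.sat_interior(4) that by blast
  have own: "vO h Qi (int p + 1) (\<lambda>n k \<gamma> \<epsilon>.
      transpose (Rm (\<D> n) \<gamma> k) *v (T1 (\<T> n) \<gamma> k *v jmp (\<D> n) (?u n) \<gamma> k + T3 (\<T> n) \<gamma> k *v djmp pb (\<D> n) (?u n) \<gamma> k) +
      transpose (Dg pb (\<D> n) \<gamma> k) *v (T2 (\<T> n) \<gamma> k *v jmp (\<D> n) (?u n) \<gamma> k))"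
    by (intro vO_add vO_mv'[OF mO_RmT vO_add[OF vO_mv'[OF mO_T1 vO_jmp[OF assms]] vO_mv'[OF mO_T3 vO_djmp[OF assms]]]]
        vO_mv'[OF mO_mono[OF mO_transpose[OF mO_Dg] Qi_Qf] vO_mv'[OF mO_T2 vO_jmp[OF assms]]]) auto
  have "vO h Qi (int p + 1) (\<lambda>n k \<gamma> \<epsilon>.
      transpose (Rm (\<D> n) \<gamma> k) *v (T1 (\<T> n) \<gamma> k *v jmp (\<D> n) (?u n) \<gamma> k + T3 (\<T> n) \<gamma> k *v djmp pb (\<D> n) (?u n) \<gamma> k) +
      transpose (Dg pb (\<D> n) \<gamma> k) *v (T2 (\<T> n) \<gamma> k *v jmp (\<D> n) (?u n) \<gamma> k + T4 (\<T> n) \<gamma> k *v djmp pb (\<D> n) (?u n) \<gamma> k))"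
    by (rule vO_cong[OF own]) (simp add: T4)
  note own' = vO_element_sum[OF this, of "\<lambda>n. ifacets (\<D> n)"]
  have x5: "vO h Qi (int p + 1) (\<lambda>n k \<gamma> \<epsilon>. \<Sum>\<epsilon>\<in>ifacets (\<D> n) k - {\<gamma>}.
      transpose (Rm (\<D> n) \<gamma> k) *v (T5 (\<T> n) \<gamma> \<epsilon> k *v jmp (\<D> n) (?u n) \<epsilon> k))"
  proof (rule vO_facet_sum[where Q=Qii])
    show "vO h Qii (int p + 1) (\<lambda>n k \<gamma> \<epsilon>. transpose (Rm (\<D> n) \<gamma> k) *v (T5 (\<T> n) \<gamma> \<epsilon> k *v jmp (\<D> n) (?u n) \<epsilon> k))"
      by (intro vO_mv'[OF mO_mono[OF mO_RmT] vO_cross[OF assms mO_T5]]) auto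
  next
    fix n k \<gamma> and \<epsilon> :: facet assume q: "Qi n k \<gamma> \<epsilon>"
    then show "0 < h n \<and> card (ifacets (\<D> n) k - {\<gamma>}) \<le> 3 \<and> (\<forall>\<delta>\<in>ifacets (\<D> n) k - {\<gamma>}. Qii n k \<gamma> \<delta>)"
      using card_ifacets h_pos by blast
  qed
  have x6: "vO h Qi (int p + 1) (\<lambda>n k \<gamma> \<epsilon>. \<Sum>\<delta>\<in>ifacets (\<D> n) (nb (\<D> n) k \<gamma>) - {\<gamma>}.
      transpose (Rm (\<D> n) \<gamma> k) *v (T6 (\<T> n) \<gamma> \<delta> (nb (\<D> n) k \<gamma>) *v jmp (\<D> n) (?u n) \<delta> (nb (\<D> n) k \<gamma>)))"
  proof (rule vO_facet_sum[where Q=Qin])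
    have "vO h Qin (int p + 1) (\<lambda>n k \<gamma> \<delta>. T6 (\<T> n) \<gamma> \<delta> (nb (\<D> n) k \<gamma>) *v jmp (\<D> n) (?u n) \<delta> (nb (\<D> n) k \<gamma>))"
      by (rule vO_pull[where K="\<lambda>n k \<gamma> \<epsilon>. nb (\<D> n) k \<gamma>" and G="\<lambda>n k \<gamma> \<epsilon>. \<gamma>" and E="\<lambda>n k \<gamma> \<epsilon>. \<epsilon>", OF vO_cross[OF assms mO_T6]])
        (use Qi_nb in auto)
    then show "vO h Qin (int p + 1) (\<lambda>n k \<gamma> \<delta>.
      transpose (Rm (\<D> n) \<gamma> k) *v (T6 (\<T> n) \<gamma> \<delta> (nb (\<D> n) k \<gamma>) *v jmp (\<D> n) (?u n) \<delta> (nb (\<D> n) k \<gamma>)))"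
      by (intro vO_mv'[OF mO_mono[OF mO_RmT]]) auto
  next
    fix n k \<gamma> and \<epsilon> :: facet assume q: "Qi n k \<gamma> \<epsilon>"
    then show "0 < h n \<and> card (ifacets (\<D> n) (nb (\<D> n) k \<gamma>) - {\<gamma>}) \<le> 3 \<and>
        (\<forall>\<delta>\<in>ifacets (\<D> n) (nb (\<D> n) k \<gamma>) - {\<gamma>}. Qin n k \<gamma> \<delta>)"
      using card_ifacets h_pos by blast
  qed
  note cross = vO_element_sum[OF vO_add[OF x5 x6], of "\<lambda>n. ifacets (\<D> n)"]
  have sub: "ifacets (\<D> n) k \<subseteq> facets (\<D> n) k" for n k using L.ifacets_subset by blast
  show ?thesis
    unfolding sI_def Let_def by (intro vO_add own' cross sub) auto
qed

lemma mO_TD: "mO h (\<lambda>n k \<gamma> \<epsilon>. k < nel (\<D> n) \<and> \<gamma> \<in> dfacets pb (\<D> n) k) 0 (\<lambda>n k \<gamma> \<epsilon>. TD (\<T> n) \<gamma>)" (is "mO h ?Q 0 _")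
proof (rule mO_cong)
  have Q: "?Q n k \<gamma> \<epsilon> \<Longrightarrow> Qf n k \<gamma> \<epsilon>" for n k \<gamma> \<epsilon> using L.dfacets_subset by blast
  have U: "mO h Qf (- 2) (\<lambda>n k \<gamma> \<epsilon>. Ups pb (\<D> n) \<gamma> \<gamma> k)"
    by (rule mO_pull[where K="\<lambda>n k \<gamma> \<epsilon>. k" and G="\<lambda>n k \<gamma> \<epsilon>. \<gamma>" and E="\<lambda>n k \<gamma> \<epsilon>. \<gamma>", OF mO_Ups]) auto
  have "mO h Qf 0 (\<lambda>n k \<gamma> \<epsilon>. Bm (\<D> n) \<gamma> ** Ups pb (\<D> n) \<gamma> \<gamma> k ** Bm (\<D> n) \<gamma>)"
    by (intro mO_mult'[OF mO_mult'[OF mO_Bm U] mO_Bm]) auto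
  from mO_mono[OF mO_scaleR[OF sO_alpha[of 1] this] Q]
  show "mO h ?Q 0 (\<lambda>n k \<gamma> \<epsilon>. (1 / alpha (\<D> n) \<gamma> k) *\<^sub>R (Bm (\<D> n) \<gamma> ** Ups pb (\<D> n) \<gamma> \<gamma> k ** Bm (\<D> n) \<gamma>))"
    by simp
qed (use L.sat_dirichlet in blast)

text \<open>The facet nodes lie on the facet, and on the boundary their normals are outward ones, so
  the data coincide there with the trace and the normal flux of \<open>U\<close>. Only
  discretization errors enter.\<close>

lemma vO_sB:
  assumes U: "Ck (p + 1) U" and s: "steady_solution pb F uD uN U"
  shows "vO h Qe (int p + 1) (\<lambda>n k \<gamma> \<epsilon>. sB pb (\<D> n) (\<T> n) (fnodal (\<D> n) uD) (fnodal (\<D> n) uN) (nodal (\<D> n) U) k)"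
proof -
  define QD :: "bool indexed" where "QD n k \<gamma> \<epsilon> \<longleftrightarrow> k < nel (\<D> n) \<and> \<gamma> \<in> dfacets pb (\<D> n) k" for n k \<gamma> \<epsilon>
  define QN :: "bool indexed" where "QN n k \<gamma> \<epsilon> \<longleftrightarrow> k < nel (\<D> n) \<and> \<gamma> \<in> nfacets pb (\<D> n) k" for n k \<gamma> \<epsilon>
  have D: "QD n k \<gamma> \<epsilon> \<Longrightarrow> Qf n k \<gamma> \<epsilon>" for n k \<gamma> \<epsilon> using L.dfacets_subset by (auto simp: QD_def)
  have N: "QN n k \<gamma> \<epsilon> \<Longrightarrow> Qf n k \<gamma> \<epsilon>" for n k \<gamma> \<epsilon> using L.nfacets_subset by (auto simp: QN_def)
  have fn: "fnode (\<D> n) \<gamma> a \<in> \<gamma>" if "Qf n k \<gamma> \<epsilon>" for n k \<gamma> a and \<epsilon> :: facet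
    using facet_node_ref[of k n \<gamma> a] that by blast
  have uD: "fnodal (\<D> n) uD \<gamma> = fnodal (\<D> n) U \<gamma>" if "QD n k \<gamma> \<epsilon>" for n k \<gamma> \<epsilon>
  proof -
    have "fnode (\<D> n) \<gamma> a \<in> gamD pb" for a using fn[OF D[OF that]] that by (auto simp: QD_def dfacets_def)
    then show ?thesis using s by (simp add: fnodal_def vec_eq_iff steady_solution_def)
  qed
  have uN: "fnodal (\<D> n) uN \<gamma> = (\<chi> a. flux pb U (fnode (\<D> n) \<gamma> a) \<bullet> nrm (\<D> n) \<gamma> k a)" if q: "QN n k \<gamma> \<epsilon>" for n k \<gamma> \<epsilon>
  proof -
    have k: "k < nel (\<D> n)" and g: "\<gamma> \<in> nfacets pb (\<D> n) k" using q by (auto simp: QN_def)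
    have "\<gamma> \<in> facets (\<D> n) k - ifacets (\<D> n) k" unfolding L.boundary_facets[OF k] using g by blast
    then have "outward_unit_normal (dom pb) (fnode (\<D> n) \<gamma> a) (nrm (\<D> n) \<gamma> k a)" for a
      by (rule L.outward[OF k])
    moreover have "fnode (\<D> n) \<gamma> a \<in> gamN pb" for a using fn[OF N[OF q]] g by (auto simp: nfacets_def)
    ultimately have "flux pb U (fnode (\<D> n) \<gamma> a) \<bullet> nrm (\<D> n) \<gamma> k a = uN (fnode (\<D> n) \<gamma> a)" for a
      using s unfolding steady_solution_def by blast
    then show ?thesis by (simp add: fnodal_def vec_eq_iff)
  qed
  have "vO h Qf (int p + 1) (\<lambda>n k \<gamma> \<epsilon>. Rm (\<D> n) \<gamma> k *v nodal (\<D> n) U k - fnodal (\<D> n) U \<gamma>)"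
    using vO_extrapolation[OF U] by (simp add: add.commute)
  from vO_mono[OF this D] have r: "vO h QD (int p + 1) (\<lambda>n k \<gamma> \<epsilon>. Rm (\<D> n) \<gamma> k *v nodal (\<D> n) U k - fnodal (\<D> n) uD \<gamma>)"
    by (rule vO_cong) (assumption, metis uD)
  have w: "vO h QN (int p) (\<lambda>n k \<gamma> \<epsilon>. Dg pb (\<D> n) \<gamma> k *v nodal (\<D> n) U k - fnodal (\<D> n) uN \<gamma>)"
    by (rule vO_cong[OF vO_mono[OF vO_Dg[OF U] N]]) (assumption, metis uN)
  have T: "mO h QD 0 (\<lambda>n k \<gamma> \<epsilon>. TD (\<T> n) \<gamma>)" using mO_TD by (simp add: QD_def[abs_def])
  have 1: "vO h QD (int p + 1) (\<lambda>n k \<gamma> \<epsilon>.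
      transpose (Rm (\<D> n) \<gamma> k) *v (TD (\<T> n) \<gamma> *v (Rm (\<D> n) \<gamma> k *v nodal (\<D> n) U k - fnodal (\<D> n) uD \<gamma>)) -
      transpose (Dg pb (\<D> n) \<gamma> k) *v (Bm (\<D> n) \<gamma> *v (Rm (\<D> n) \<gamma> k *v nodal (\<D> n) U k - fnodal (\<D> n) uD \<gamma>)))"
    by (intro vO_diff vO_mv'[OF mO_mono[OF mO_transpose[OF mO_Rm] D] vO_mv'[OF T r]]
        vO_mv'[OF mO_mono[OF mO_transpose[OF mO_Dg] D] vO_mv'[OF mO_mono[OF mO_Bm D] r]]) auto
  have 2: "vO h QN (int p + 1) (\<lambda>n k \<gamma> \<epsilon>.
      transpose (Rm (\<D> n) \<gamma> k) *v (Bm (\<D> n) \<gamma> *v (Dg pb (\<D> n) \<gamma> k *v nodal (\<D> n) U k - fnodal (\<D> n) uN \<gamma>)))"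
    by (intro vO_mv'[OF mO_mono[OF mO_transpose[OF mO_Rm] N] vO_mv'[OF mO_mono[OF mO_Bm N] w]]) auto
  show ?thesis unfolding sB_def Let_def
    by (intro vO_add vO_element_sum[OF 1] vO_element_sum[OF 2])
      (use L.dfacets_subset L.nfacets_subset in \<open>auto simp: QD_def QN_def\<close>)
qed

lemma trunc_bound:
  assumes U: "Ck (p + 1) U" and s: "steady_solution pb F uD uN U"
  shows "\<exists>K\<ge>0. \<forall>n. \<forall>k<nel (\<D> n). trunc pb (\<D> n) (\<T> n) F uD uN U k \<le> K * h n ^ p"
proof -
  let ?e = "\<lambda>n k. Lh pb (\<D> n) (\<T> n) (fnodal (\<D> n) uD) (fnodal (\<D> n) uN) (nodal (\<D> n) U) k - nodal (\<D> n) F k"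
  have F: "nodal (\<D> n) F k = - nodal (\<D> n) (\<lambda>x. \<Sum>i\<in>UNIV. pd i (\<lambda>y. flux pb U y $ i) x) k" if k: "k < nel (\<D> n)" for n k
    using s L.vnode_in_dom[OF k] unfolding steady_solution_def by (simp add: nodal_def vec_eq_iff)
  \<comment> \<open>\<open>Hinv\<close> lowers the order of both penalties from p + 1 to that of the
    \<open>D2\<close> error.\<close>
  have "vO h Qe (int p - 1) (\<lambda>n k \<gamma> \<epsilon>. - (D2 pb (\<D> n) k *v nodal (\<D> n) U k
        - nodal (\<D> n) (\<lambda>x. \<Sum>i\<in>UNIV. pd i (\<lambda>y. flux pb U y $ i) x) k)
      + Hinv (\<D> n) k *v sI pb (\<D> n) (\<T> n) (nodal (\<D> n) U) k
      + Hinv (\<D> n) k *v sB pb (\<D> n) (\<T> n) (fnodal (\<D> n) uD) (fnodal (\<D> n) uN) (nodal (\<D> n) U) k)"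
    by (intro vO_add vO_minus vO_D2[OF U] vO_mv'[OF mO_Hinv vO_sI[OF U]] vO_mv'[OF mO_Hinv vO_sB[OF U s]]) auto
  then have "vO h Qe (int p - 1) (\<lambda>n k \<gamma> \<epsilon>. ?e n k)"
    by (rule vO_cong) (simp add: Lh_def F)
  then have "\<exists>K\<ge>0. \<forall>n k. k < nel (\<D> n) \<longrightarrow> \<bar>?e n k $ a\<bar> \<le> K * h n powi (int p - 1)" for a
    unfolding vO_def sO_def by blast
  then obtain K where K: "\<And>a. 0 \<le> K a"
    "\<And>a n k. k < nel (\<D> n) \<Longrightarrow> \<bar>?e n k $ a\<bar> \<le> K a * h n powi (int p - 1)" by metis
  \<comment> \<open>The set of nodes is the same for all elements and meshes, so the maximum over it
    is still a uniform constant.\<close>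
  define Kb where "Kb = Max (range K)"
  have Kb: "K a \<le> Kb" for a unfolding Kb_def by (intro Max_ge) auto
  define R where "R = sqrt (real CARD('n) * \<bar>C\<bar>) * Kb"
  have Kb0: "0 \<le> Kb" using K(1) Kb order_trans by blast
  have "trunc pb (\<D> n) (\<T> n) F uD uN U k \<le> R * h n ^ p" if k: "k < nel (\<D> n)" for n k
  proof -
    note hp = h_pos[OF k]
    have e: "\<bar>?e n k $ a\<bar> \<le> Kb * h n ^ (p - 1)" for a
    proof -
      have "\<bar>?e n k $ a\<bar> \<le> K a * h n powi (int p - 1)" by (rule K(2)[OF k])
      also have "\<dots> \<le> Kb * h n powi (int p - 1)" using Kb hp by (intro mult_right_mono) auto
      also have "h n powi (int p - 1) = h n ^ (p - 1)" using p by (simp add: power_int_def nat_diff_distrib of_nat_diff)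
      finally show ?thesis .
    qed
    have "?e n k \<bullet> (Hm (\<D> n) k *v ?e n k) = (\<Sum>a\<in>UNIV. Hd (\<D> n) k $ a * (?e n k $ a)\<^sup>2)"
      by (simp add: inner_vec_def Hm_def diagm_mv power2_eq_square mult_ac)
    also have "\<dots> \<le> (\<Sum>a\<in>(UNIV::'n set). (\<bar>C\<bar> * (h n)\<^sup>2) * (Kb * h n ^ (p - 1))\<^sup>2)"
    proof (intro sum_mono mult_mono)
      fix a
      have "C * (h n)\<^sup>2 \<le> \<bar>C\<bar> * (h n)\<^sup>2" by (intro mult_right_mono) auto
      then show "Hd (\<D> n) k $ a \<le> \<bar>C\<bar> * (h n)\<^sup>2" using scal_unfolded(4)[OF k, of a] by linarith
      show "(?e n k $ a)\<^sup>2 \<le> (Kb * h n ^ (p - 1))\<^sup>2" using power_mono[OF e[of a], of 2] by simp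
    qed auto
    also have "\<dots> = (real CARD('n) * \<bar>C\<bar>) * (Kb * (h n * h n ^ (p - 1)))\<^sup>2"
      by (simp add: power_mult_distrib)
    also have "h n * h n ^ (p - 1) = h n ^ p" using p by (metis power_eq_if not_one_le_zero)
    finally have "trunc pb (\<D> n) (\<T> n) F uD uN U k \<le> sqrt ((real CARD('n) * \<bar>C\<bar>) * (Kb * h n ^ p)\<^sup>2)"
      unfolding trunc_def Hnorm_def by (rule real_sqrt_le_mono)
    also have "\<dots> = R * h n ^ p" using Kb0 hp by (simp add: real_sqrt_mult R_def)
    finally show ?thesis .
  qed
  moreover have "0 \<le> R" using Kb0 by (simp add: R_def)
  ultimately show ?thesis by blast
qed

text \<open>The interiors of the elements are disjoint, lie in the domain and have area at least of
  order h^2.\<close>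

lemma element_count: "\<exists>V. \<forall>n. real (nel (\<D> n)) * (h n)\<^sup>2 \<le> V"
proof (intro exI allI)
  fix n
  show "real (nel (\<D> n)) * (h n)\<^sup>2 \<le> \<bar>C\<bar> * measure lebesgue (dom pb)"
  proof (cases "nel (\<D> n) = 0")
    case False
    then have C: "0 \<le> C" using C_nonneg[of 0 n] by simp
    let ?I = "\<lambda>k. interior (elem (\<D> n) k)"
    have dm: "dom pb \<in> lmeasurable" using dom_compact by (rule lmeasurable_compact)
    have sub: "(\<Union>k<nel (\<D> n). ?I k) \<subseteq> dom pb"
      unfolding L.elem_Union[of n, symmetric] by (intro UN_mono interior_subset) simp
    have lm: "?I k \<in> lmeasurable" if "k < nel (\<D> n)" for k
      using elem_compact[OF that] by (intro bounded_set_imp_lmeasurable) (auto intro: bounded_interior compact_imp_bounded borel_open)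
    have "(\<Sum>k<nel (\<D> n). measure lebesgue (?I k)) = measure lebesgue (\<Union>k<nel (\<D> n). ?I k)"
    proof (rule measure_finite_Union[symmetric])
      show "disjoint_family_on ?I {..<nel (\<D> n)}" unfolding disjoint_family_on_def using L.elem_disjoint by blast
      show "emeasure lebesgue (?I k) \<noteq> \<infinity>" if "k \<in> {..<nel (\<D> n)}" for k
        using lm[of k] that by (auto simp: fmeasurable_def)
    qed (use lm in \<open>auto simp: fmeasurable_def\<close>)
    also have "\<dots> \<le> measure lebesgue (dom pb)"
      using sub dm by (intro measure_mono_fmeasurable) (auto intro!: borel_open)
    finally have m: "(\<Sum>k<nel (\<D> n). measure lebesgue (?I k)) \<le> measure lebesgue (dom pb)" .
    have "real (nel (\<D> n)) * (h n)\<^sup>2 = (\<Sum>k<nel (\<D> n). (h n)\<^sup>2)" by simp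
    also have "\<dots> \<le> (\<Sum>k<nel (\<D> n). C * measure lebesgue (?I k))"
      by (intro sum_mono scal_unfolded(2)) auto
    also have "\<dots> = C * (\<Sum>k<nel (\<D> n). measure lebesgue (?I k))" by (simp add: sum_distrib_left)
    also have "\<dots> \<le> C * measure lebesgue (dom pb)" using m C by (rule mult_left_mono)
    finally show ?thesis using C by simp
  qed simp
qed

text \<open>O(h^-2) elements with errors O(h^p) leave h^(p - 2), which tends to 0 only from
  \<open>p = 3\<close> on.\<close>

lemma trunc_sum_tendsto:
  assumes U: "Ck (p + 1) U" and s: "steady_solution pb F uD uN U"
    and p3: "p \<ge> 3" and h0: "h \<longlonglongrightarrow> 0"
  shows "(\<lambda>n. \<Sum>k<nel (\<D> n). trunc pb (\<D> n) (\<T> n) F uD uN U k) \<longlonglongrightarrow> 0"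
proof -
  obtain K where K: "0 \<le> K" "\<And>n k. k < nel (\<D> n) \<Longrightarrow> trunc pb (\<D> n) (\<T> n) F uD uN U k \<le> K * h n ^ p"
    using trunc_bound[OF U s] by blast
  obtain V where V: "\<And>n. real (nel (\<D> n)) * (h n)\<^sup>2 \<le> V" using element_count by blast
  have nonneg: "0 \<le> (\<Sum>k<nel (\<D> n). trunc pb (\<D> n) (\<T> n) F uD uN U k)" for n
  proof (rule sum_nonneg)
    fix k assume "k \<in> {..<nel (\<D> n)}"
    then have "0 \<le> x \<bullet> (Hm (\<D> n) k *v x)" for x
      using L.Hd_pos[of k n] by (auto simp: inner_vec_def Hm_def diagm_mv less_imp_le intro!: sum_nonneg)
        (metis less_imp_le mult.left_commute mult_nonneg_nonneg zero_le_square)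
    then show "0 \<le> trunc pb (\<D> n) (\<T> n) F uD uN U k" by (simp add: trunc_def Hnorm_def)
  qed
  \<comment> \<open>The absolute value is for a mesh without elements, whose size is the maximum of
    an empty set and has no known sign.\<close>
  have le: "(\<Sum>k<nel (\<D> n). trunc pb (\<D> n) (\<T> n) F uD uN U k) \<le> K * V * \<bar>h n\<bar> ^ (p - 2)" for n
  proof (cases "nel (\<D> n) = 0")
    case True
    have "0 \<le> V" using V[of n] True by simp
    then show ?thesis using True K(1) by simp
  next
    case False
    then have hp: "0 < h n" using h_pos[of 0 n] by simp
    have "(\<Sum>k<nel (\<D> n). trunc pb (\<D> n) (\<T> n) F uD uN U k) \<le> (\<Sum>k<nel (\<D> n). K * h n ^ p)"
      by (intro sum_mono K) auto
    also have "\<dots> = K * h n ^ (p - 2) * (real (nel (\<D> n)) * (h n)\<^sup>2)"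
    proof -
      have "p = p - 2 + 2" using p3 by simp
      then have "h n ^ p = h n ^ (p - 2) * (h n)\<^sup>2" by (metis power_add)
      then show ?thesis by simp
    qed
    also have "\<dots> \<le> K * h n ^ (p - 2) * V" using V K(1) hp by (intro mult_left_mono) auto
    finally show ?thesis using hp by (simp add: mult_ac)
  qed
  have "(\<lambda>n. K * V * \<bar>h n\<bar> ^ (p - 2)) \<longlonglongrightarrow> K * V * \<bar>0\<bar> ^ (p - 2)"
    by (intro tendsto_intros h0)
  then have "(\<lambda>n. K * V * \<bar>h n\<bar> ^ (p - 2)) \<longlonglongrightarrow> 0" using p3 by (simp add: power_0_left)
  from tendsto_sandwich[OF _ _ tendsto_const this] show ?thesis using nonneg le by auto
qed

end

theorem proposition3:
  fixes p :: nat
    and pb :: diffusion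
    and g :: "real^2"
    and \<D> :: "nat \<Rightarrow> ('n::finite, 'f::finite) disc"
    and \<T> :: "nat \<Rightarrow> 'f penalty"
  assumes "p \<ge> 1"
    and "diffusion_problem p pb"
    and "\<And>n. sbp_discretization p pb (\<D> n)"
    and "\<And>n. switches g (\<D> n)"
    and "\<And>n. ldg_sat pb (\<D> n) (\<T> n)"
  shows "(\<forall>n. conservative pb (\<D> n) (\<T> n) \<and> energy_stable pb (\<D> n) (\<T> n) \<and>
         ldg_type pb (\<D> n) 0 (\<T> n)) \<and>
    (refinement p pb \<D> \<longrightarrow>
       consistent_rate p pb \<D> \<T> \<and> adjoint_consistent_rate p pb \<D> \<T> \<and>
       (p \<ge> 3 \<longrightarrow> consistent p pb \<D> \<T> \<and> adjoint_consistent p pb \<D> \<T>))"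
proof (intro conjI allI impI)
  have disc: "ldg_disc p pb (\<D> n) g (\<T> n)" for n
    by (intro ldg_disc.intro sbp_disc.intro ldg_disc_axioms.intro assms)
  then show "conservative pb (\<D> n) (\<T> n)" "energy_stable pb (\<D> n) (\<T> n)" "ldg_type pb (\<D> n) 0 (\<T> n)" for n
    by (rule ldg_disc.conservative ldg_disc.energy_stable ldg_disc.ldg_type)+
  \<comment> \<open>Adjoint solutions satisfy \<open>steady_solution\<close> for their own data, so
    this equality transfers both the rate and the limit.\<close>
  have adj: "trunc_adj pb (\<D> n) (\<T> n) F uD uN U k = trunc pb (\<D> n) (\<T> n) F uD uN U k"
    if "k < nel (\<D> n)" for n k F uD uN U
    using ldg_disc.Lh_adj_eq[OF disc that] by (simp add: trunc_adj_def trunc_def)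
  assume ref: "refinement p pb \<D>"
  then have h0: "(\<lambda>n. mesh_size (\<D> n)) \<longlonglongrightarrow> 0" by (simp add: refinement_def)
  from ref obtain C where C: "\<And>n. order_accurate p pb C (\<D> n)" "\<And>n. scaling p C (\<D> n)"
    unfolding refinement_def by blast
  obtain H where H: "\<And>n. mesh_size (\<D> n) \<le> H"
    using convergent_imp_Bseq[OF convergentI[OF h0]] unfolding Bseq_def by (metis abs_le_D1 real_norm_def)
  interpret ldg_family p pb g \<D> \<T> C H
    by (intro ldg_family.intro assms disc C H)
  show rate: "consistent_rate p pb \<D> \<T>"
    unfolding consistent_rate_def using trunc_bound by blast
  show "adjoint_consistent_rate p pb \<D> \<T>"
    unfolding adjoint_consistent_rate_def using trunc_bound by (metis adj)
  assume p3: "p \<ge> 3"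
  show "consistent p pb \<D> \<T>"
    unfolding consistent_def using trunc_sum_tendsto[OF _ _ p3 h0] by blast
  show "adjoint_consistent p pb \<D> \<T>"
    unfolding adjoint_consistent_def
  proof (intro allI impI)
    fix G \<psi>D \<psi>N \<psi> assume *: "Ck (p + 1) \<psi> \<and> steady_solution pb G \<psi>D \<psi>N \<psi>"
    have "(\<Sum>k<nel (\<D> n). trunc_adj pb (\<D> n) (\<T> n) G \<psi>D \<psi>N \<psi> k) =
        (\<Sum>k<nel (\<D> n). trunc pb (\<D> n) (\<T> n) G \<psi>D \<psi>N \<psi> k)" for n
      by (intro sum.cong) (auto simp: adj)
    then show "(\<lambda>n. \<Sum>k<nel (\<D> n). trunc_adj pb (\<D> n) (\<T> n) G \<psi>D \<psi>N \<psi> k) \<longlonglongrightarrow> 0"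
      using trunc_sum_tendsto[OF _ _ p3 h0] * by simp
  qed
qed

end
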